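(* The following assignments form a 2-functor $\mathrm{Prd}:\mathcal P\mathsf{rlPoCat}\to\mathcal R\mathsf{gCalc}$ from the 2-category of prerelational po-categories to the 2-category of regular calculi. 1. A prerelational po-category $(\mathbb R,I,\otimes)$ is sent to the regular calculus $(\mathbb R,\mathbb R(I,-))$ whose laxators are $1\to\mathbb R(I,I)$, picking out $\mathrm{id}_I$, and $\mathbb R(I,r)\times\mathbb R(I,r')\to\mathbb R(I,r\otimes r')$, $(f,f')\mapsto\delta_I;(f\otimes f')$. 2. A strong symmetric monoidal po-functor $(F,\varphi):\mathbb R\to\mathbb R'$ is sent to $(F,F^\sharp)$, where $F^\sharp_r:\mathbb R(I,r)\to\mathbb R'(I',Fr)$ is $f\mapsto\varphi_I;F(f)$. 3. A left adjoint oplax-natural transformation $\alpha:(F,\varphi)\Rightarrow(G,\psi)$ is sent to $\alpha$, regarded as a 2-morphism $(F,F^\sharp)\Rightarrow(G,G^\sharp)$ of regular calculi.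
   Context: Composition is written diagrammatically, $f;g$. A po-category is a 2-category whose hom-categories are posets; a po-functor is a functor monotone on homs. An oplax-natural transformation $\alpha:F\Rightarrow G$ is a family $\alpha_c:Fc\to Gc$ with $F(f);\alpha_{c'}\le\alpha_c;G(f)$ for $f:c\to c'$; it is a left adjoint oplax-natural transformation if it is a left adjoint in the po-category of po-functors and oplax-natural transformations ordered componentwise. A symmetric monoidal po-category has a symmetric monoidal structure on its underlying category with $\otimes$ monotone. A monoidal transformation satisfies the usual monoidal equations strictly. The po-prop $\mathbb W$: objects are the natural numbers $n$ (identified with $\underline n=\{1,\dots,n\}$). Hom-posets are the poset reflections of the categories of cospans of finite sets $\underline m\to S\leftarrow\underline n$, where $\omega\le\omega'$ iff there is a function from the apex of $\omega'$ to that of $\omega$ commuting with the legs. Composition is by pushout; the tensor is disjoint union with unit $0$. The morphisms $\epsilon:1\to0$, $\delta:1\to2$, $\eta:0\to1$, $\mu:2\to1$ are the cospans with apex $\underline1$. A supply of $\mathbb W$ in a symmetric monoidal po-category $\mathbb C$ is, for each object $c$, a strong symmetric monoidal po-functor $s_c:\mathbb W\to\mathbb C$ with $s_c(m)=c^{\otimes m}$ (left-bracketed), with strongators $c^{\otimes m}\otimes c^{\otimes n}\to c^{\otimes(m+n)}$ the associators, such that for all $\omega:m\to n$ and objects $c,d$, $(s_c(\omega)\otimes s_d(\omega));\sigma=\sigma;s_{c\otimes d}(\omega)$ with $\sigma$ the canonical symmetry isomorphisms, and $s_I(\omega)$ is compatible with the canonical isomorphisms $I\cong I^{\otimes m}$,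 $I\cong I^{\otimes n}$. Write $\omega_c=s_c(\omega)$. A strong symmetric monoidal po-functor $(F,\varphi)$ preserves the supply if $\omega_{Fc};\varphi=\varphi;F(\omega_c)$ for all $c,\omega$. A prerelational po-category is a symmetric monoidal po-category $\mathbb R$ supplying $\mathbb W$ such that $f;\epsilon_d\le\epsilon_c$ and $f;\delta_d\le\delta_c;(f\otimes f)$ for every $f:c\to d$. $\mathcal P\mathsf{rlPoCat}$ has these as objects, strong symmetric monoidal po-functors as morphisms (these automatically preserve the supply of $\mathbb W$, a known result), and left adjoint oplax-natural transformations as 2-morphisms. A regular calculus $(\mathbb C_P,P)$ is a symmetric monoidal po-category $\mathbb C_P$ supplying $\mathbb W$ with a lax symmetric monoidal po-functor $P:\mathbb C_P\to\mathbb P\mathsf{oset}$ (posets with cartesian product) whose laxators are right adjoints. In $\mathcal R\mathsf{gCalc}$, a morphism $(\mathbb C_P,P)\to(\mathbb C_{P'},P')$ is a pair $(F,F^\sharp)$ with $(F,\varphi):\mathbb C_P\to\mathbb C_{P'}$ a strong symmetric monoidal po-functor preserving the supply and $F^\sharp:P\Rightarrow F;P'$ a monoidal (strict) 2-natural transformation. A 2-morphism $(F,F^\sharp)\Rightarrow(G,G^\sharp)$ is a monoidal left adjoint oplax-natural transformation $\alpha:F\Rightarrow G$ such that $F^\sharp_\Gamma;P'(\alpha_\Gamma)\le G^\sharp_\Gamma$ for all $\Gamma$. Compositions are the evident ones. *)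

theory Defs
  imports Main "HOL-Library.FuncSet" "HOL-Library.Nat_Bijection"
begin

text \<open>
  All composition is diagrammatic.  Categories have explicit carriers (sets of objects and of arrows
  inside types), hence are small relative to the ambient types.  The functions constituting
  1-cells and 2-cells of the 2-categories below are \<^const>\<open>extensional\<close> on their carriers, so that HOL equality
  of cells is the intended one and these 2-categories can be strict.
\<close>

section \<open>Po-categories\<close>

record ('o, 'a) pocat =
  Obj :: "'o set"
  Arr :: "'a set"
  Dom :: "'a \<Rightarrow> 'o"
  Cod :: "'a \<Rightarrow> 'o"
  Idn :: "'o \<Rightarrow> 'a"
  Cmp :: "'a \<Rightarrow> 'a \<Rightarrow> 'a" (infixl ";;\<index>" 60)
  Leq :: "'a \<Rightarrow> 'a \<Rightarrow> bool" (infix "\<sqsubseteq>\<index>" 50)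

definition hom :: "('o, 'a, 'z) pocat_scheme \<Rightarrow> 'o \<Rightarrow> 'o \<Rightarrow> 'a set" where
  "hom C a b = {f \<in> Arr C. Dom C f = a \<and> Cod C f = b}"

locale pocat =
  fixes C :: "('o, 'a, 'z) pocat_scheme" (structure)
  assumes Dom_in: "f \<in> Arr C \<Longrightarrow> Dom C f \<in> Obj C"
    and Cod_in: "f \<in> Arr C \<Longrightarrow> Cod C f \<in> Obj C"
    and Idn_in: "a \<in> Obj C \<Longrightarrow> Idn C a \<in> hom C a a"
    and Cmp_in: "\<lbrakk>f \<in> hom C a b; g \<in> hom C b c\<rbrakk> \<Longrightarrow> f ;; g \<in> hom C a c"
    and Idn_left: "f \<in> hom C a b \<Longrightarrow> Idn C a ;; f = f"
    and Idn_right: "f \<in> hom C a b \<Longrightarrow> f ;; Idn C b = f"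
    and Cmp_assoc: "\<lbrakk>f \<in> hom C a b; g \<in> hom C b c; h \<in> hom C c d\<rbrakk>
      \<Longrightarrow> (f ;; g) ;; h = f ;; (g ;; h)"
    and hom_refl: "reflp_on (hom C a b) (Leq C)"
    and hom_trans: "transp_on (hom C a b) (Leq C)"
    and hom_antisym: "antisymp_on (hom C a b) (Leq C)"
    and Cmp_mono: "\<lbrakk>f \<in> hom C a b; f' \<in> hom C a b; g \<in> hom C b c; g' \<in> hom C b c;
      f \<sqsubseteq> f'; g \<sqsubseteq> g'\<rbrakk> \<Longrightarrow> f ;; g \<sqsubseteq> f' ;; g'"

definition is_inverse :: "('o, 'a, 'z) pocat_scheme \<Rightarrow> 'a \<Rightarrow> 'a \<Rightarrow> bool" where
  "is_inverse C f g \<longleftrightarrow> f \<in> Arr C \<and> g \<in> hom C (Cod C f) (Dom C f) \<and>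
     f ;;\<^bsub>C\<^esub> g = Idn C (Dom C f) \<and> g ;;\<^bsub>C\<^esub> f = Idn C (Cod C f)"

definition iso :: "('o, 'a, 'z) pocat_scheme \<Rightarrow> 'a \<Rightarrow> bool" where
  "iso C f \<longleftrightarrow> (\<exists>g. is_inverse C f g)"

definition inverse_of :: "('o, 'a, 'z) pocat_scheme \<Rightarrow> 'a \<Rightarrow> 'a" where
  "inverse_of C f = (THE g. is_inverse C f g)"

section \<open>Symmetric monoidal po-categories\<close>

text \<open>Tensor of objects is written \<open>\<odot>\<close>, tensor of arrows \<open>\<otimes>\<close>.\<close>

record ('o, 'a) smpocat = "('o, 'a) pocat" +
  Unit :: "'o"
  TenO :: "'o \<Rightarrow> 'o \<Rightarrow> 'o" (infixl "\<odot>\<index>" 70)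
  TenA :: "'a \<Rightarrow> 'a \<Rightarrow> 'a" (infixl "\<otimes>\<index>" 70)
  Assoc :: "'o \<Rightarrow> 'o \<Rightarrow> 'o \<Rightarrow> 'a"
  LUnit :: "'o \<Rightarrow> 'a"
  RUnit :: "'o \<Rightarrow> 'a"
  Swap :: "'o \<Rightarrow> 'o \<Rightarrow> 'a"

locale smpocat = pocat C for C :: "('o, 'a, 'z) smpocat_scheme" (structure) +
  assumes Unit_in: "Unit C \<in> Obj C"
    and TenO_in: "\<lbrakk>a \<in> Obj C; b \<in> Obj C\<rbrakk> \<Longrightarrow> a \<odot> b \<in> Obj C"
    and TenA_in: "\<lbrakk>f \<in> hom C a b; g \<in> hom C a' b'\<rbrakk> \<Longrightarrow> f \<otimes> g \<in> hom C (a \<odot> a') (b \<odot> b')"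
    and TenA_Idn: "\<lbrakk>a \<in> Obj C; b \<in> Obj C\<rbrakk> \<Longrightarrow> Idn C a \<otimes> Idn C b = Idn C (a \<odot> b)"
    and TenA_Cmp: "\<lbrakk>f \<in> hom C a b; f' \<in> hom C b c; g \<in> hom C a' b'; g' \<in> hom C b' c'\<rbrakk>
      \<Longrightarrow> (f ;; f') \<otimes> (g ;; g') = (f \<otimes> g) ;; (f' \<otimes> g')"
    and TenA_mono: "\<lbrakk>f \<in> hom C a b; f' \<in> hom C a b; g \<in> hom C a' b'; g' \<in> hom C a' b';
      f \<sqsubseteq> f'; g \<sqsubseteq> g'\<rbrakk> \<Longrightarrow> f \<otimes> g \<sqsubseteq> f' \<otimes> g'"
    and Assoc_in: "\<lbrakk>a \<in> Obj C; b \<in> Obj C; c \<in> Obj C\<rbrakk>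
      \<Longrightarrow> Assoc C a b c \<in> hom C ((a \<odot> b) \<odot> c) (a \<odot> (b \<odot> c))"
    and LUnit_in: "a \<in> Obj C \<Longrightarrow> LUnit C a \<in> hom C (Unit C \<odot> a) a"
    and RUnit_in: "a \<in> Obj C \<Longrightarrow> RUnit C a \<in> hom C (a \<odot> Unit C) a"
    and Swap_in: "\<lbrakk>a \<in> Obj C; b \<in> Obj C\<rbrakk> \<Longrightarrow> Swap C a b \<in> hom C (a \<odot> b) (b \<odot> a)"
    and Assoc_iso: "\<lbrakk>a \<in> Obj C; b \<in> Obj C; c \<in> Obj C\<rbrakk> \<Longrightarrow> iso C (Assoc C a b c)"
    and LUnit_iso: "a \<in> Obj C \<Longrightarrow> iso C (LUnit C a)"
    and RUnit_iso: "a \<in> Obj C \<Longrightarrow> iso C (RUnit C a)"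
    and Assoc_nat: "\<lbrakk>f \<in> hom C a a'; g \<in> hom C b b'; h \<in> hom C c c'\<rbrakk>
      \<Longrightarrow> ((f \<otimes> g) \<otimes> h) ;; Assoc C a' b' c' = Assoc C a b c ;; (f \<otimes> (g \<otimes> h))"
    and LUnit_nat: "f \<in> hom C a a' \<Longrightarrow> (Idn C (Unit C) \<otimes> f) ;; LUnit C a' = LUnit C a ;; f"
    and RUnit_nat: "f \<in> hom C a a' \<Longrightarrow> (f \<otimes> Idn C (Unit C)) ;; RUnit C a' = RUnit C a ;; f"
    and Swap_nat: "\<lbrakk>f \<in> hom C a a'; g \<in> hom C b b'\<rbrakk>
      \<Longrightarrow> (f \<otimes> g) ;; Swap C a' b' = Swap C a b ;; (g \<otimes> f)"
    and pentagon: "\<lbrakk>a \<in> Obj C; b \<in> Obj C; c \<in> Obj C; d \<in> Obj C\<rbrakk>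
      \<Longrightarrow> Assoc C (a \<odot> b) c d ;; Assoc C a b (c \<odot> d) =
          (Assoc C a b c \<otimes> Idn C d) ;; Assoc C a (b \<odot> c) d ;; (Idn C a \<otimes> Assoc C b c d)"
    and triangle: "\<lbrakk>a \<in> Obj C; b \<in> Obj C\<rbrakk>
      \<Longrightarrow> Assoc C a (Unit C) b ;; (Idn C a \<otimes> LUnit C b) = RUnit C a \<otimes> Idn C b"
    and hexagon: "\<lbrakk>a \<in> Obj C; b \<in> Obj C; c \<in> Obj C\<rbrakk>
      \<Longrightarrow> Assoc C a b c ;; Swap C a (b \<odot> c) ;; Assoc C b c a =
          (Swap C a b \<otimes> Idn C c) ;; Assoc C b a c ;; (Idn C b \<otimes> Swap C a c)"
    and Swap_Swap: "\<lbrakk>a \<in> Obj C; b \<in> Obj C\<rbrakk> \<Longrightarrow> Swap C a b ;; Swap C b a = Idn C (a \<odot> b)"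

section \<open>Strong symmetric monoidal po-functors\<close>

record ('o, 'a, 'p, 'b) smfun =
  FO :: "'o \<Rightarrow> 'p"
  FA :: "'a \<Rightarrow> 'b"
  FU :: "'b"
  FM :: "'o \<Rightarrow> 'o \<Rightarrow> 'b"

locale strong_smpofunctor =
  fixes C :: "('o, 'a, 'z) smpocat_scheme"
    and D :: "('p, 'b, 'y) smpocat_scheme" (structure)
    and F :: "('o, 'a, 'p, 'b) smfun"
  assumes FO_in: "a \<in> Obj C \<Longrightarrow> FO F a \<in> Obj D"
    and FA_in: "f \<in> hom C a b \<Longrightarrow> FA F f \<in> hom D (FO F a) (FO F b)"
    and FA_Idn: "a \<in> Obj C \<Longrightarrow> FA F (Idn C a) = Idn D (FO F a)"
    and FA_Cmp: "\<lbrakk>f \<in> hom C a b; g \<in> hom C b c\<rbrakk> \<Longrightarrow> FA F (f ;;\<^bsub>C\<^esub> g) = FA F f ;; FA F g"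
    and FA_mono: "monotone_on (hom C a b) (Leq C) (Leq D) (FA F)"
    and FU_in: "FU F \<in> hom D (Unit D) (FO F (Unit C))"
    and FU_iso: "iso D (FU F)"
    and FM_in: "\<lbrakk>a \<in> Obj C; b \<in> Obj C\<rbrakk> \<Longrightarrow> FM F a b \<in> hom D (FO F a \<odot> FO F b) (FO F (a \<odot>\<^bsub>C\<^esub> b))"
    and FM_iso: "\<lbrakk>a \<in> Obj C; b \<in> Obj C\<rbrakk> \<Longrightarrow> iso D (FM F a b)"
    and FM_nat: "\<lbrakk>f \<in> hom C a a'; g \<in> hom C b b'\<rbrakk>
      \<Longrightarrow> (FA F f \<otimes> FA F g) ;; FM F a' b' = FM F a b ;; FA F (f \<otimes>\<^bsub>C\<^esub> g)"
    and FM_Assoc: "\<lbrakk>a \<in> Obj C; b \<in> Obj C; c \<in> Obj C\<rbrakk>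
      \<Longrightarrow> (FM F a b \<otimes> Idn D (FO F c)) ;; FM F (a \<odot>\<^bsub>C\<^esub> b) c ;; FA F (Assoc C a b c) =
          Assoc D (FO F a) (FO F b) (FO F c) ;; (Idn D (FO F a) \<otimes> FM F b c) ;; FM F a (b \<odot>\<^bsub>C\<^esub> c)"
    and FM_LUnit: "a \<in> Obj C
      \<Longrightarrow> (FU F \<otimes> Idn D (FO F a)) ;; FM F (Unit C) a ;; FA F (LUnit C a) = LUnit D (FO F a)"
    and FM_RUnit: "a \<in> Obj C
      \<Longrightarrow> (Idn D (FO F a) \<otimes> FU F) ;; FM F a (Unit C) ;; FA F (RUnit C a) = RUnit D (FO F a)"
    and FM_Swap: "\<lbrakk>a \<in> Obj C; b \<in> Obj C\<rbrakk>
      \<Longrightarrow> FM F a b ;; FA F (Swap C a b) = Swap D (FO F a) (FO F b) ;; FM F b a"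

definition ext_smfun :: "('o, 'a, 'z) smpocat_scheme \<Rightarrow> ('o, 'a, 'p, 'b) smfun \<Rightarrow> bool" where
  "ext_smfun C F \<longleftrightarrow> FO F \<in> extensional (Obj C) \<and> FA F \<in> extensional (Arr C) \<and>
     FM F \<in> extensional (Obj C) \<and> (\<forall>c \<in> Obj C. FM F c \<in> extensional (Obj C))"

definition id_smfun :: "('o, 'a, 'z) smpocat_scheme \<Rightarrow> ('o, 'a, 'o, 'a) smfun" where
  "id_smfun C = \<lparr>FO = \<lambda>c \<in> Obj C. c, FA = \<lambda>f \<in> Arr C. f, FU = Idn C (Unit C),
     FM = \<lambda>c \<in> Obj C. \<lambda>d \<in> Obj C. Idn C (c \<odot>\<^bsub>C\<^esub> d)\<rparr>"

definition comp_smfun :: "('o, 'a, 'z) smpocat_scheme \<Rightarrow> ('q, 'c, 'x) smpocat_scheme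
    \<Rightarrow> ('o, 'a, 'p, 'b) smfun \<Rightarrow> ('p, 'b, 'q, 'c) smfun \<Rightarrow> ('o, 'a, 'q, 'c) smfun" where
  "comp_smfun C E F G = \<lparr>
     FO = \<lambda>c \<in> Obj C. FO G (FO F c),
     FA = \<lambda>f \<in> Arr C. FA G (FA F f),
     FU = FU G ;;\<^bsub>E\<^esub> FA G (FU F),
     FM = \<lambda>c \<in> Obj C. \<lambda>d \<in> Obj C. FM G (FO F c) (FO F d) ;;\<^bsub>E\<^esub> FA G (FM F c d)\<rparr>"

section \<open>Transformations\<close>

definition oplax_natural :: "('o, 'a, 'z) smpocat_scheme \<Rightarrow> ('p, 'b, 'y) smpocat_scheme
    \<Rightarrow> ('o, 'a, 'p, 'b) smfun \<Rightarrow> ('o, 'a, 'p, 'b) smfun \<Rightarrow> ('o \<Rightarrow> 'b) \<Rightarrow> bool" where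
  "oplax_natural C D F G \<alpha> \<longleftrightarrow>
     (\<forall>c \<in> Obj C. \<alpha> c \<in> hom D (FO F c) (FO G c)) \<and>
     (\<forall>c c' f. f \<in> hom C c c' \<longrightarrow> FA F f ;;\<^bsub>D\<^esub> \<alpha> c' \<sqsubseteq>\<^bsub>D\<^esub> \<alpha> c ;;\<^bsub>D\<^esub> FA G f)"

text \<open>
  Being a left adjoint in the po-category of po-functors and oplax-natural transformations, ordered
  componentwise: the right adjoint \<open>\<beta>\<close> is itself required to be oplax-natural, not merely to consist
  of componentwise right adjoints.
\<close>

definition left_adjoint_oplax :: "('o, 'a, 'z) smpocat_scheme \<Rightarrow> ('p, 'b, 'y) smpocat_scheme
    \<Rightarrow> ('o, 'a, 'p, 'b) smfun \<Rightarrow> ('o, 'a, 'p, 'b) smfun \<Rightarrow> ('o \<Rightarrow> 'b) \<Rightarrow> bool" where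
  "left_adjoint_oplax C D F G \<alpha> \<longleftrightarrow> oplax_natural C D F G \<alpha> \<and>
     (\<exists>\<beta>. oplax_natural C D G F \<beta> \<and>
        (\<forall>c \<in> Obj C. Idn D (FO F c) \<sqsubseteq>\<^bsub>D\<^esub> \<alpha> c ;;\<^bsub>D\<^esub> \<beta> c \<and>
                     \<beta> c ;;\<^bsub>D\<^esub> \<alpha> c \<sqsubseteq>\<^bsub>D\<^esub> Idn D (FO G c)))"

definition monoidal_transformation :: "('o, 'a, 'z) smpocat_scheme \<Rightarrow> ('p, 'b, 'y) smpocat_scheme
    \<Rightarrow> ('o, 'a, 'p, 'b) smfun \<Rightarrow> ('o, 'a, 'p, 'b) smfun \<Rightarrow> ('o \<Rightarrow> 'b) \<Rightarrow> bool" where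
  "monoidal_transformation C D F G \<alpha> \<longleftrightarrow>
     FU F ;;\<^bsub>D\<^esub> \<alpha> (Unit C) = FU G \<and>
     (\<forall>c \<in> Obj C. \<forall>d \<in> Obj C.
        FM F c d ;;\<^bsub>D\<^esub> \<alpha> (c \<odot>\<^bsub>C\<^esub> d) = (\<alpha> c \<otimes>\<^bsub>D\<^esub> \<alpha> d) ;;\<^bsub>D\<^esub> FM G c d)"

definition id_trans :: "('o, 'a, 'z) smpocat_scheme \<Rightarrow> ('p, 'b, 'y) smpocat_scheme
    \<Rightarrow> ('o, 'a, 'p, 'b) smfun \<Rightarrow> 'o \<Rightarrow> 'b" where
  "id_trans C D F = (\<lambda>c \<in> Obj C. Idn D (FO F c))"

definition vcomp_trans :: "('o, 'a, 'z) smpocat_scheme \<Rightarrow> ('p, 'b, 'y) smpocat_scheme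
    \<Rightarrow> ('o \<Rightarrow> 'b) \<Rightarrow> ('o \<Rightarrow> 'b) \<Rightarrow> 'o \<Rightarrow> 'b" where
  "vcomp_trans C D \<alpha> \<beta> = (\<lambda>c \<in> Obj C. \<alpha> c ;;\<^bsub>D\<^esub> \<beta> c)"

text \<open>
  Horizontal composite of \<open>\<alpha> : F \<Rightarrow> G : C \<rightarrow> D\<close> and \<open>\<alpha>' : F' \<Rightarrow> G' : D \<rightarrow> E\<close>.  For merely oplax
  transformations this may differ from \<open>\<alpha>' (F c) ; G' (\<alpha> c)\<close>; the two agree when each \<open>\<alpha> c\<close> is a
  left adjoint.
\<close>

definition hcomp_trans :: "('o, 'a, 'z) smpocat_scheme \<Rightarrow> ('q, 'c, 'x) smpocat_scheme
    \<Rightarrow> ('o, 'a, 'p, 'b) smfun \<Rightarrow> ('p, 'b, 'q, 'c) smfun \<Rightarrow> ('o \<Rightarrow> 'b) \<Rightarrow> ('p \<Rightarrow> 'c) \<Rightarrow> 'o \<Rightarrow> 'c" where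
  "hcomp_trans C E G F' \<alpha> \<alpha>' = (\<lambda>c \<in> Obj C. FA F' (\<alpha> c) ;;\<^bsub>E\<^esub> \<alpha>' (FO G c))"

section \<open>Canonical isomorphisms for tensor powers\<close>

fun tpow :: "('o, 'a, 'z) smpocat_scheme \<Rightarrow> 'o \<Rightarrow> nat \<Rightarrow> 'o" where
  "tpow C c 0 = Unit C"
| "tpow C c (Suc 0) = c"
| "tpow C c (Suc (Suc n)) = tpow C c (Suc n) \<odot>\<^bsub>C\<^esub> c"

text \<open>\<open>tpow c m \<odot> tpow c n \<rightarrow> tpow c (m + n)\<close>\<close>

fun tpow_add :: "('o, 'a, 'z) smpocat_scheme \<Rightarrow> 'o \<Rightarrow> nat \<Rightarrow> nat \<Rightarrow> 'a" where
  "tpow_add C c m 0 = RUnit C (tpow C c m)"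
| "tpow_add C c m (Suc 0) = (if m = 0 then LUnit C c else Idn C (tpow C c (Suc m)))"
| "tpow_add C c m (Suc (Suc n)) =
     inverse_of C (Assoc C (tpow C c m) (tpow C c (Suc n)) c) ;;\<^bsub>C\<^esub>
     (tpow_add C c m (Suc n) \<otimes>\<^bsub>C\<^esub> Idn C c)"

text \<open>\<open>(a \<odot> b) \<odot> (c \<odot> d) \<rightarrow> (a \<odot> c) \<odot> (b \<odot> d)\<close>\<close>

definition mid4 :: "('o, 'a, 'z) smpocat_scheme \<Rightarrow> 'o \<Rightarrow> 'o \<Rightarrow> 'o \<Rightarrow> 'o \<Rightarrow> 'a" where
  "mid4 C a b c d =
     Assoc C a b (c \<odot>\<^bsub>C\<^esub> d) ;;\<^bsub>C\<^esub>
     (Idn C a \<otimes>\<^bsub>C\<^esub>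
       (inverse_of C (Assoc C b c d) ;;\<^bsub>C\<^esub> (Swap C b c \<otimes>\<^bsub>C\<^esub> Idn C d) ;;\<^bsub>C\<^esub> Assoc C c b d)) ;;\<^bsub>C\<^esub>
     inverse_of C (Assoc C a c (b \<odot>\<^bsub>C\<^esub> d))"

text \<open>\<open>tpow c n \<odot> tpow d n \<rightarrow> tpow (c \<odot> d) n\<close>\<close>

fun tpow_sym :: "('o, 'a, 'z) smpocat_scheme \<Rightarrow> 'o \<Rightarrow> 'o \<Rightarrow> nat \<Rightarrow> 'a" where
  "tpow_sym C c d 0 = LUnit C (Unit C)"
| "tpow_sym C c d (Suc 0) = Idn C (c \<odot>\<^bsub>C\<^esub> d)"
| "tpow_sym C c d (Suc (Suc n)) =
     mid4 C (tpow C c (Suc n)) c (tpow C d (Suc n)) d ;;\<^bsub>C\<^esub>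
     (tpow_sym C c d (Suc n) \<otimes>\<^bsub>C\<^esub> Idn C (c \<odot>\<^bsub>C\<^esub> d))"

text \<open>\<open>I \<rightarrow> tpow I n\<close>\<close>

fun tpow_unit :: "('o, 'a, 'z) smpocat_scheme \<Rightarrow> nat \<Rightarrow> 'a" where
  "tpow_unit C 0 = Idn C (Unit C)"
| "tpow_unit C (Suc 0) = Idn C (Unit C)"
| "tpow_unit C (Suc (Suc n)) =
     inverse_of C (LUnit C (Unit C)) ;;\<^bsub>C\<^esub> (tpow_unit C (Suc n) \<otimes>\<^bsub>C\<^esub> Idn C (Unit C))"

text \<open>The iterated strongator \<open>tpow (F c) n \<rightarrow> F (tpow c n)\<close>\<close>

fun tpow_fun :: "('o, 'a, 'z) smpocat_scheme \<Rightarrow> ('p, 'b, 'y) smpocat_scheme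
    \<Rightarrow> ('o, 'a, 'p, 'b) smfun \<Rightarrow> 'o \<Rightarrow> nat \<Rightarrow> 'b" where
  "tpow_fun C D F c 0 = FU F"
| "tpow_fun C D F c (Suc 0) = Idn D (FO F c)"
| "tpow_fun C D F c (Suc (Suc n)) =
     (tpow_fun C D F c (Suc n) \<otimes>\<^bsub>D\<^esub> Idn D (FO F c)) ;;\<^bsub>D\<^esub> FM F (tpow C c (Suc n)) c"

section \<open>The po-prop of cospans\<close>

text \<open>
  A cospan \<open>{1..m} \<rightarrow> S \<leftarrow> {1..n}\<close>.  Up to isomorphism of cospans the apex may be taken to be a finite
  set of natural numbers.  Only the values of the legs on \<open>{1..m}\<close> and \<open>{1..n}\<close> matter.
\<close>

record cospan =
  csrc :: nat
  ctgt :: nat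
  apex :: "nat set"
  lleg :: "nat \<Rightarrow> nat"
  rleg :: "nat \<Rightarrow> nat"

definition cospans :: "cospan set" where
  "cospans = {w. finite (apex w) \<and> lleg w \<in> {1..csrc w} \<rightarrow> apex w \<and> rleg w \<in> {1..ctgt w} \<rightarrow> apex w}"

definition cospan_le :: "cospan \<Rightarrow> cospan \<Rightarrow> bool" where
  "cospan_le w w' \<longleftrightarrow> csrc w = csrc w' \<and> ctgt w = ctgt w' \<and>
     (\<exists>h \<in> apex w' \<rightarrow> apex w.
        (\<forall>i \<in> {1..csrc w}. h (lleg w' i) = lleg w i) \<and>
        (\<forall>j \<in> {1..ctgt w}. h (rleg w' j) = rleg w j))"

definition cospan_eq :: "(cospan \<times> cospan) set" where
  "cospan_eq = {(w, w'). w \<in> cospans \<and> w' \<in> cospans \<and> cospan_le w w' \<and> cospan_le w' w}"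

type_synonym wmor = "cospan set"

definition wclass :: "cospan \<Rightarrow> wmor" where
  "wclass w = cospan_eq `` {w}"

definition is_pushout :: "nat set \<Rightarrow> (nat \<Rightarrow> nat) \<Rightarrow> (nat \<Rightarrow> nat) \<Rightarrow> nat set \<Rightarrow> nat set
    \<Rightarrow> nat set \<Rightarrow> (nat \<Rightarrow> nat) \<Rightarrow> (nat \<Rightarrow> nat) \<Rightarrow> bool" where
  "is_pushout N r l S T Q i j \<longleftrightarrow>
     finite Q \<and> i \<in> S \<rightarrow> Q \<and> j \<in> T \<rightarrow> Q \<and> (\<forall>k \<in> N. i (r k) = j (l k)) \<and>
     (\<forall>(Z :: nat set) f g. finite Z \<and> f \<in> S \<rightarrow> Z \<and> g \<in> T \<rightarrow> Z \<and> (\<forall>k \<in> N. f (r k) = g (l k)) \<longrightarrow>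
        (\<exists>!u. u \<in> Q \<rightarrow>\<^sub>E Z \<and> (\<forall>s \<in> S. u (i s) = f s) \<and> (\<forall>t \<in> T. u (j t) = g t)))"

definition is_cospan_comp :: "cospan \<Rightarrow> cospan \<Rightarrow> cospan \<Rightarrow> bool" where
  "is_cospan_comp x y q \<longleftrightarrow> ctgt x = csrc y \<and> csrc q = csrc x \<and> ctgt q = ctgt y \<and>
     (\<exists>i j. is_pushout {1..ctgt x} (rleg x) (lleg y) (apex x) (apex y) (apex q) i j \<and>
        (\<forall>k \<in> {1..csrc q}. lleg q k = i (lleg x k)) \<and>
        (\<forall>k \<in> {1..ctgt q}. rleg q k = j (rleg y k)))"

definition cospan_ten :: "cospan \<Rightarrow> cospan \<Rightarrow> cospan" where
  "cospan_ten x y = \<lparr>csrc = csrc x + csrc y, ctgt = ctgt x + ctgt y,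
     apex = sum_encode ` (apex x <+> apex y),
     lleg = \<lambda>k. sum_encode (if k \<le> csrc x then Inl (lleg x k) else Inr (lleg y (k - csrc x))),
     rleg = \<lambda>k. sum_encode (if k \<le> ctgt x then Inl (rleg x k) else Inr (rleg y (k - ctgt x)))\<rparr>"

definition W_idn :: "nat \<Rightarrow> wmor" where
  "W_idn n = wclass \<lparr>csrc = n, ctgt = n, apex = {1..n}, lleg = \<lambda>k. k, rleg = \<lambda>k. k\<rparr>"

definition W_swap :: "nat \<Rightarrow> nat \<Rightarrow> wmor" where
  "W_swap m n = wclass \<lparr>csrc = m + n, ctgt = n + m, apex = {1..n + m},
     lleg = \<lambda>k. if k \<le> m then n + k else k - m, rleg = \<lambda>k. k\<rparr>"

text \<open>
  Arrows are equivalence classes of cospans for the poset reflection of the hom-preorders.  In \<open>Cmp\<close>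
  and \<open>TenA\<close> all classes in the union coincide, since composition and tensor respect the preorder.
\<close>

definition W :: "(nat, wmor) smpocat" where
  "W = \<lparr>Obj = UNIV, Arr = cospans // cospan_eq,
     Dom = \<lambda>A. the_elem (csrc ` A), Cod = \<lambda>A. the_elem (ctgt ` A),
     Idn = W_idn,
     Cmp = \<lambda>A B. \<Union>x \<in> A. \<Union>y \<in> B. \<Union>q \<in> {q. is_cospan_comp x y q}. wclass q,
     Leq = \<lambda>A B. \<exists>x \<in> A. \<exists>y \<in> B. cospan_le x y,
     Unit = 0, TenO = (+),
     TenA = \<lambda>A B. \<Union>x \<in> A. \<Union>y \<in> B. wclass (cospan_ten x y),
     Assoc = \<lambda>m n p. W_idn (m + n + p), LUnit = W_idn, RUnit = W_idn, Swap = W_swap\<rparr>"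

definition W_eps :: wmor where
  "W_eps = wclass \<lparr>csrc = 1, ctgt = 0, apex = {1}, lleg = \<lambda>_. 1, rleg = \<lambda>_. 1\<rparr>"

definition W_delta :: wmor where
  "W_delta = wclass \<lparr>csrc = 1, ctgt = 2, apex = {1}, lleg = \<lambda>_. 1, rleg = \<lambda>_. 1\<rparr>"

section \<open>Supply and prerelational po-categories\<close>

text \<open>
  In a supply \<open>s\<close> only the action of \<open>s\<^sub>c\<close> on arrows of \<^const>\<open>W\<close> is data; its object part and
  strongators are prescribed.
\<close>

record ('o, 'a) scat = "('o, 'a) smpocat" +
  Supply :: "'o \<Rightarrow> wmor \<Rightarrow> 'a"

definition supply_fun :: "('o, 'a, 'z) scat_scheme \<Rightarrow> 'o \<Rightarrow> (nat, wmor, 'o, 'a) smfun" where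
  "supply_fun C c = \<lparr>FO = tpow C c, FA = Supply C c, FU = Idn C (Unit C), FM = tpow_add C c\<rparr>"

locale supplies_W = smpocat C for C :: "('o, 'a, 'z) scat_scheme" (structure) +
  assumes supply_strong: "c \<in> Obj C \<Longrightarrow> strong_smpofunctor W C (supply_fun C c)"
    and supply_TenO: "\<lbrakk>w \<in> hom W m n; c \<in> Obj C; d \<in> Obj C\<rbrakk>
      \<Longrightarrow> (Supply C c w \<otimes> Supply C d w) ;; tpow_sym C c d n = tpow_sym C c d m ;; Supply C (c \<odot> d) w"
    and supply_Unit: "w \<in> hom W m n
      \<Longrightarrow> tpow_unit C m ;; Supply C (Unit C) w = tpow_unit C n"

locale prerelational = supplies_W C for C :: "('o, 'a, 'z) scat_scheme" (structure) +
  assumes lax_eps: "f \<in> hom C c d \<Longrightarrow> f ;; Supply C d W_eps \<sqsubseteq> Supply C c W_eps"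
    and lax_delta: "f \<in> hom C c d \<Longrightarrow> f ;; Supply C d W_delta \<sqsubseteq> Supply C c W_delta ;; (f \<otimes> f)"

definition preserves_supply :: "('o, 'a, 'z) scat_scheme \<Rightarrow> ('p, 'b, 'y) scat_scheme
    \<Rightarrow> ('o, 'a, 'p, 'b) smfun \<Rightarrow> bool" where
  "preserves_supply C D F \<longleftrightarrow>
     (\<forall>c \<in> Obj C. \<forall>m n. \<forall>w \<in> hom W m n.
        Supply D (FO F c) w ;;\<^bsub>D\<^esub> tpow_fun C D F c n = tpow_fun C D F c m ;;\<^bsub>D\<^esub> FA F (Supply C c w))"

section \<open>Lax symmetric monoidal po-functors to posets\<close>

record 'p poset =
  car :: "'p set"
  ple :: "'p \<Rightarrow> 'p \<Rightarrow> bool"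

definition is_poset :: "'p poset \<Rightarrow> bool" where
  "is_poset A \<longleftrightarrow> reflp_on (car A) (ple A) \<and> transp_on (car A) (ple A) \<and> antisymp_on (car A) (ple A)"

definition poset_maps :: "'p poset \<Rightarrow> 'q poset \<Rightarrow> ('p \<Rightarrow> 'q) set" where
  "poset_maps A B = {f \<in> car A \<rightarrow> car B. monotone_on (car A) (ple A) (ple B) f}"

definition prod_poset :: "'p poset \<Rightarrow> 'q poset \<Rightarrow> ('p \<times> 'q) poset" where
  "prod_poset A B = \<lparr>car = car A \<times> car B, ple = rel_prod (ple A) (ple B)\<rparr>"

definition one_poset :: "unit poset" where
  "one_poset = \<lparr>car = UNIV, ple = (=)\<rparr>"

definition right_adjoint_map :: "'p poset \<Rightarrow> 'q poset \<Rightarrow> ('p \<Rightarrow> 'q) \<Rightarrow> bool" where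
  "right_adjoint_map A B g \<longleftrightarrow> g \<in> poset_maps A B \<and>
     (\<exists>f \<in> poset_maps B A. (\<forall>b \<in> car B. ple B b (g (f b))) \<and> (\<forall>a \<in> car A. ple A (f (g a)) a))"

text \<open>
  The cartesian monoidal po-category of posets does not fit into a single \<^typ>\<open>('o, 'a) smpocat\<close>,
  because products leave the type of elements; so functors into it are spelled out.
\<close>

record ('o, 'a, 'p) laxfun =
  PO :: "'o \<Rightarrow> 'p poset"
  PA :: "'a \<Rightarrow> 'p \<Rightarrow> 'p"
  PU :: "unit \<Rightarrow> 'p"
  PM :: "'o \<Rightarrow> 'o \<Rightarrow> 'p \<times> 'p \<Rightarrow> 'p"

locale lax_smpofunctor =
  fixes C :: "('o, 'a, 'z) smpocat_scheme" (structure)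
    and P :: "('o, 'a, 'p) laxfun"
  assumes PO_poset: "c \<in> Obj C \<Longrightarrow> is_poset (PO P c)"
    and PA_in: "f \<in> hom C c d \<Longrightarrow> PA P f \<in> poset_maps (PO P c) (PO P d)"
    and PA_Idn: "\<lbrakk>c \<in> Obj C; x \<in> car (PO P c)\<rbrakk> \<Longrightarrow> PA P (Idn C c) x = x"
    and PA_Cmp: "\<lbrakk>f \<in> hom C c d; g \<in> hom C d e; x \<in> car (PO P c)\<rbrakk>
      \<Longrightarrow> PA P (f ;; g) x = PA P g (PA P f x)"
    and PA_mono: "\<lbrakk>f \<in> hom C c d; g \<in> hom C c d; f \<sqsubseteq> g; x \<in> car (PO P c)\<rbrakk>
      \<Longrightarrow> ple (PO P d) (PA P f x) (PA P g x)"
    and PU_in: "PU P \<in> poset_maps one_poset (PO P (Unit C))"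
    and PM_in: "\<lbrakk>c \<in> Obj C; d \<in> Obj C\<rbrakk>
      \<Longrightarrow> PM P c d \<in> poset_maps (prod_poset (PO P c) (PO P d)) (PO P (c \<odot> d))"
    and PM_nat: "\<lbrakk>f \<in> hom C c c'; g \<in> hom C d d'; x \<in> car (PO P c); y \<in> car (PO P d)\<rbrakk>
      \<Longrightarrow> PM P c' d' (PA P f x, PA P g y) = PA P (f \<otimes> g) (PM P c d (x, y))"
    and PM_Assoc: "\<lbrakk>c \<in> Obj C; d \<in> Obj C; e \<in> Obj C;
        x \<in> car (PO P c); y \<in> car (PO P d); z \<in> car (PO P e)\<rbrakk>
      \<Longrightarrow> PA P (Assoc C c d e) (PM P (c \<odot> d) e (PM P c d (x, y), z)) =
          PM P c (d \<odot> e) (x, PM P d e (y, z))"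
    and PM_LUnit: "\<lbrakk>c \<in> Obj C; x \<in> car (PO P c)\<rbrakk>
      \<Longrightarrow> PA P (LUnit C c) (PM P (Unit C) c (PU P (), x)) = x"
    and PM_RUnit: "\<lbrakk>c \<in> Obj C; x \<in> car (PO P c)\<rbrakk>
      \<Longrightarrow> PA P (RUnit C c) (PM P c (Unit C) (x, PU P ())) = x"
    and PM_Swap: "\<lbrakk>c \<in> Obj C; d \<in> Obj C; x \<in> car (PO P c); y \<in> car (PO P d)\<rbrakk>
      \<Longrightarrow> PA P (Swap C c d) (PM P c d (x, y)) = PM P d c (y, x)"

text \<open>The composite of a strong functor \<open>F : C \<rightarrow> D\<close> with a lax functor \<open>P\<close> on \<open>D\<close>\<close>

definition pre_laxfun :: "('o, 'a, 'p, 'b) smfun \<Rightarrow> ('p, 'b, 'q) laxfun \<Rightarrow> ('o, 'a, 'q) laxfun" where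
  "pre_laxfun F P = \<lparr>
     PO = \<lambda>c. PO P (FO F c),
     PA = \<lambda>f. PA P (FA F f),
     PU = \<lambda>u. PA P (FU F) (PU P u),
     PM = \<lambda>c d xy. PA P (FM F c d) (PM P (FO F c) (FO F d) xy)\<rparr>"

definition monoidal_2natural :: "('o, 'a, 'z) smpocat_scheme \<Rightarrow> ('o, 'a, 'p) laxfun
    \<Rightarrow> ('o, 'a, 'q) laxfun \<Rightarrow> ('o \<Rightarrow> 'p \<Rightarrow> 'q) \<Rightarrow> bool" where
  "monoidal_2natural C P Q \<tau> \<longleftrightarrow>
     (\<forall>c \<in> Obj C. \<tau> c \<in> poset_maps (PO P c) (PO Q c)) \<and>
     (\<forall>c d f. f \<in> hom C c d \<longrightarrow> (\<forall>x \<in> car (PO P c). \<tau> d (PA P f x) = PA Q f (\<tau> c x))) \<and>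
     \<tau> (Unit C) (PU P ()) = PU Q () \<and>
     (\<forall>c \<in> Obj C. \<forall>d \<in> Obj C. \<forall>x \<in> car (PO P c). \<forall>y \<in> car (PO P d).
        \<tau> (c \<odot>\<^bsub>C\<^esub> d) (PM P c d (x, y)) = PM Q c d (\<tau> c x, \<tau> d y))"

locale regular_calculus = supplies_W C + lax_smpofunctor C P
  for C :: "('o, 'a, 'z) scat_scheme" (structure) and P :: "('o, 'a, 'p) laxfun" +
  assumes PU_right_adjoint: "right_adjoint_map one_poset (PO P (Unit C)) (PU P)"
    and PM_right_adjoint: "\<lbrakk>c \<in> Obj C; d \<in> Obj C\<rbrakk>
      \<Longrightarrow> right_adjoint_map (prod_poset (PO P c) (PO P d)) (PO P (c \<odot> d)) (PM P c d)"

section \<open>Strict 2-categories and 2-functors\<close>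

text \<open>
  Homs are indexed by their boundaries, as are the operations; arguments of \<open>C1\<close>, \<open>VC\<close> and \<open>HC\<close>
  come in diagrammatic order, so that for \<open>\<alpha> : F \<Rightarrow> G : X \<rightarrow> Y\<close> and \<open>\<alpha>' : F' \<Rightarrow> G' : Y \<rightarrow> Z\<close> the horizontal
  composite is \<open>HC X Y Z F G F' G' \<alpha> \<alpha>'\<close>.
\<close>

record ('x, 'm, 't) twocat =
  Ob :: "'x set"
  H1 :: "'x \<Rightarrow> 'x \<Rightarrow> 'm set"
  H2 :: "'x \<Rightarrow> 'x \<Rightarrow> 'm \<Rightarrow> 'm \<Rightarrow> 't set"
  I1 :: "'x \<Rightarrow> 'm"
  C1 :: "'x \<Rightarrow> 'x \<Rightarrow> 'x \<Rightarrow> 'm \<Rightarrow> 'm \<Rightarrow> 'm"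
  I2 :: "'x \<Rightarrow> 'x \<Rightarrow> 'm \<Rightarrow> 't"
  VC :: "'x \<Rightarrow> 'x \<Rightarrow> 'm \<Rightarrow> 'm \<Rightarrow> 'm \<Rightarrow> 't \<Rightarrow> 't \<Rightarrow> 't"
  HC :: "'x \<Rightarrow> 'x \<Rightarrow> 'x \<Rightarrow> 'm \<Rightarrow> 'm \<Rightarrow> 'm \<Rightarrow> 'm \<Rightarrow> 't \<Rightarrow> 't \<Rightarrow> 't"

locale two_category =
  fixes K :: "('x, 'm, 't) twocat"
  assumes I1_in: "X \<in> Ob K \<Longrightarrow> I1 K X \<in> H1 K X X"
    and C1_in: "\<lbrakk>X \<in> Ob K; Y \<in> Ob K; Z \<in> Ob K; F \<in> H1 K X Y; G \<in> H1 K Y Z\<rbrakk>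
      \<Longrightarrow> C1 K X Y Z F G \<in> H1 K X Z"
    and C1_left: "\<lbrakk>X \<in> Ob K; Y \<in> Ob K; F \<in> H1 K X Y\<rbrakk> \<Longrightarrow> C1 K X X Y (I1 K X) F = F"
    and C1_right: "\<lbrakk>X \<in> Ob K; Y \<in> Ob K; F \<in> H1 K X Y\<rbrakk> \<Longrightarrow> C1 K X Y Y F (I1 K Y) = F"
    and C1_assoc: "\<lbrakk>X \<in> Ob K; Y \<in> Ob K; Z \<in> Ob K; U \<in> Ob K;
        F \<in> H1 K X Y; G \<in> H1 K Y Z; H \<in> H1 K Z U\<rbrakk>
      \<Longrightarrow> C1 K X Z U (C1 K X Y Z F G) H = C1 K X Y U F (C1 K Y Z U G H)"
    and I2_in: "\<lbrakk>X \<in> Ob K; Y \<in> Ob K; F \<in> H1 K X Y\<rbrakk> \<Longrightarrow> I2 K X Y F \<in> H2 K X Y F F"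
    and VC_in: "\<lbrakk>X \<in> Ob K; Y \<in> Ob K; F \<in> H1 K X Y; G \<in> H1 K X Y; H \<in> H1 K X Y;
        \<alpha> \<in> H2 K X Y F G; \<beta> \<in> H2 K X Y G H\<rbrakk>
      \<Longrightarrow> VC K X Y F G H \<alpha> \<beta> \<in> H2 K X Y F H"
    and VC_left: "\<lbrakk>X \<in> Ob K; Y \<in> Ob K; F \<in> H1 K X Y; G \<in> H1 K X Y; \<alpha> \<in> H2 K X Y F G\<rbrakk>
      \<Longrightarrow> VC K X Y F F G (I2 K X Y F) \<alpha> = \<alpha>"
    and VC_right: "\<lbrakk>X \<in> Ob K; Y \<in> Ob K; F \<in> H1 K X Y; G \<in> H1 K X Y; \<alpha> \<in> H2 K X Y F G\<rbrakk>
      \<Longrightarrow> VC K X Y F G G \<alpha> (I2 K X Y G) = \<alpha>"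
    and VC_assoc: "\<lbrakk>X \<in> Ob K; Y \<in> Ob K; F \<in> H1 K X Y; G \<in> H1 K X Y; H \<in> H1 K X Y; L \<in> H1 K X Y;
        \<alpha> \<in> H2 K X Y F G; \<beta> \<in> H2 K X Y G H; \<gamma> \<in> H2 K X Y H L\<rbrakk>
      \<Longrightarrow> VC K X Y F H L (VC K X Y F G H \<alpha> \<beta>) \<gamma> = VC K X Y F G L \<alpha> (VC K X Y G H L \<beta> \<gamma>)"
    and HC_in: "\<lbrakk>X \<in> Ob K; Y \<in> Ob K; Z \<in> Ob K; F \<in> H1 K X Y; G \<in> H1 K X Y;
        F' \<in> H1 K Y Z; G' \<in> H1 K Y Z; \<alpha> \<in> H2 K X Y F G; \<alpha>' \<in> H2 K Y Z F' G'\<rbrakk>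
      \<Longrightarrow> HC K X Y Z F G F' G' \<alpha> \<alpha>' \<in> H2 K X Z (C1 K X Y Z F F') (C1 K X Y Z G G')"
    and HC_left: "\<lbrakk>X \<in> Ob K; Y \<in> Ob K; F \<in> H1 K X Y; G \<in> H1 K X Y; \<alpha> \<in> H2 K X Y F G\<rbrakk>
      \<Longrightarrow> HC K X X Y (I1 K X) (I1 K X) F G (I2 K X X (I1 K X)) \<alpha> = \<alpha>"
    and HC_right: "\<lbrakk>X \<in> Ob K; Y \<in> Ob K; F \<in> H1 K X Y; G \<in> H1 K X Y; \<alpha> \<in> H2 K X Y F G\<rbrakk>
      \<Longrightarrow> HC K X Y Y F G (I1 K Y) (I1 K Y) \<alpha> (I2 K Y Y (I1 K Y)) = \<alpha>"
    and HC_assoc: "\<lbrakk>X \<in> Ob K; Y \<in> Ob K; Z \<in> Ob K; U \<in> Ob K; F \<in> H1 K X Y; G \<in> H1 K X Y;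
        F' \<in> H1 K Y Z; G' \<in> H1 K Y Z; F'' \<in> H1 K Z U; G'' \<in> H1 K Z U;
        \<alpha> \<in> H2 K X Y F G; \<alpha>' \<in> H2 K Y Z F' G'; \<alpha>'' \<in> H2 K Z U F'' G''\<rbrakk>
      \<Longrightarrow> HC K X Z U (C1 K X Y Z F F') (C1 K X Y Z G G') F'' G'' (HC K X Y Z F G F' G' \<alpha> \<alpha>') \<alpha>'' =
          HC K X Y U F G (C1 K Y Z U F' F'') (C1 K Y Z U G' G'') \<alpha> (HC K Y Z U F' G' F'' G'' \<alpha>' \<alpha>'')"
    and HC_I2: "\<lbrakk>X \<in> Ob K; Y \<in> Ob K; Z \<in> Ob K; F \<in> H1 K X Y; F' \<in> H1 K Y Z\<rbrakk>
      \<Longrightarrow> HC K X Y Z F F F' F' (I2 K X Y F) (I2 K Y Z F') = I2 K X Z (C1 K X Y Z F F')"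
    and interchange: "\<lbrakk>X \<in> Ob K; Y \<in> Ob K; Z \<in> Ob K;
        F \<in> H1 K X Y; G \<in> H1 K X Y; H \<in> H1 K X Y; F' \<in> H1 K Y Z; G' \<in> H1 K Y Z; H' \<in> H1 K Y Z;
        \<alpha> \<in> H2 K X Y F G; \<beta> \<in> H2 K X Y G H; \<alpha>' \<in> H2 K Y Z F' G'; \<beta>' \<in> H2 K Y Z G' H'\<rbrakk>
      \<Longrightarrow> HC K X Y Z F H F' H' (VC K X Y F G H \<alpha> \<beta>) (VC K Y Z F' G' H' \<alpha>' \<beta>') =
          VC K X Z (C1 K X Y Z F F') (C1 K X Y Z G G') (C1 K X Y Z H H')
            (HC K X Y Z F G F' G' \<alpha> \<alpha>') (HC K X Y Z G H G' H' \<beta> \<beta>')"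

locale two_functor = K: two_category K + L: two_category L
  for K :: "('x, 'm, 't) twocat" and L :: "('y, 'n, 'u) twocat" +
  fixes T0 :: "'x \<Rightarrow> 'y"
    and T1 :: "'x \<Rightarrow> 'x \<Rightarrow> 'm \<Rightarrow> 'n"
    and T2 :: "'x \<Rightarrow> 'x \<Rightarrow> 'm \<Rightarrow> 'm \<Rightarrow> 't \<Rightarrow> 'u"
  assumes T0_in: "X \<in> Ob K \<Longrightarrow> T0 X \<in> Ob L"
    and T1_in: "\<lbrakk>X \<in> Ob K; Y \<in> Ob K; F \<in> H1 K X Y\<rbrakk> \<Longrightarrow> T1 X Y F \<in> H1 L (T0 X) (T0 Y)"
    and T2_in: "\<lbrakk>X \<in> Ob K; Y \<in> Ob K; F \<in> H1 K X Y; G \<in> H1 K X Y; \<alpha> \<in> H2 K X Y F G\<rbrakk>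
      \<Longrightarrow> T2 X Y F G \<alpha> \<in> H2 L (T0 X) (T0 Y) (T1 X Y F) (T1 X Y G)"
    and T1_I1: "X \<in> Ob K \<Longrightarrow> T1 X X (I1 K X) = I1 L (T0 X)"
    and T1_C1: "\<lbrakk>X \<in> Ob K; Y \<in> Ob K; Z \<in> Ob K; F \<in> H1 K X Y; G \<in> H1 K Y Z\<rbrakk>
      \<Longrightarrow> T1 X Z (C1 K X Y Z F G) = C1 L (T0 X) (T0 Y) (T0 Z) (T1 X Y F) (T1 Y Z G)"
    and T2_I2: "\<lbrakk>X \<in> Ob K; Y \<in> Ob K; F \<in> H1 K X Y\<rbrakk>
      \<Longrightarrow> T2 X Y F F (I2 K X Y F) = I2 L (T0 X) (T0 Y) (T1 X Y F)"
    and T2_VC: "\<lbrakk>X \<in> Ob K; Y \<in> Ob K; F \<in> H1 K X Y; G \<in> H1 K X Y; H \<in> H1 K X Y;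
        \<alpha> \<in> H2 K X Y F G; \<beta> \<in> H2 K X Y G H\<rbrakk>
      \<Longrightarrow> T2 X Y F H (VC K X Y F G H \<alpha> \<beta>) =
          VC L (T0 X) (T0 Y) (T1 X Y F) (T1 X Y G) (T1 X Y H) (T2 X Y F G \<alpha>) (T2 X Y G H \<beta>)"
    and T2_HC: "\<lbrakk>X \<in> Ob K; Y \<in> Ob K; Z \<in> Ob K; F \<in> H1 K X Y; G \<in> H1 K X Y;
        F' \<in> H1 K Y Z; G' \<in> H1 K Y Z; \<alpha> \<in> H2 K X Y F G; \<alpha>' \<in> H2 K Y Z F' G'\<rbrakk>
      \<Longrightarrow> T2 X Z (C1 K X Y Z F F') (C1 K X Y Z G G') (HC K X Y Z F G F' G' \<alpha> \<alpha>') =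
          HC L (T0 X) (T0 Y) (T0 Z) (T1 X Y F) (T1 X Y G) (T1 Y Z F') (T1 Y Z G')
            (T2 X Y F G \<alpha>) (T2 Y Z F' G' \<alpha>')"

section \<open>The 2-categories of prerelational po-categories and of regular calculi\<close>

definition PrlPoCat :: "(('o, 'a) scat, ('o, 'a, 'o, 'a) smfun, 'o \<Rightarrow> 'a) twocat" where
  "PrlPoCat = \<lparr>
     Ob = {R. prerelational R},
     H1 = \<lambda>R R'. {F. strong_smpofunctor R R' F \<and> ext_smfun R F},
     H2 = \<lambda>R R' F G. {\<alpha> \<in> extensional (Obj R). left_adjoint_oplax R R' F G \<alpha>},
     I1 = id_smfun,
     C1 = \<lambda>R R' R'' F G. comp_smfun R R'' F G,
     I2 = id_trans,
     VC = \<lambda>R R' F G H \<alpha> \<beta>. vcomp_trans R R' \<alpha> \<beta>,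
     HC = \<lambda>R R' R'' F G F' G' \<alpha> \<alpha>'. hcomp_trans R R'' G F' \<alpha> \<alpha>'\<rparr>"

type_synonym ('o, 'a, 'p) rcalc = "('o, 'a) scat \<times> ('o, 'a, 'p) laxfun"
type_synonym ('o, 'a, 'p) rcalc_mor = "('o, 'a, 'o, 'a) smfun \<times> ('o \<Rightarrow> 'p \<Rightarrow> 'p)"

definition rcalc_mors :: "('o, 'a, 'p) rcalc \<Rightarrow> ('o, 'a, 'p) rcalc \<Rightarrow> ('o, 'a, 'p) rcalc_mor set" where
  "rcalc_mors = (\<lambda>(C, P) (C', P'). {(F, F\<^sub>s).
     strong_smpofunctor C C' F \<and> preserves_supply C C' F \<and> ext_smfun C F \<and>
     monoidal_2natural C P (pre_laxfun F P') F\<^sub>s \<and>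
     F\<^sub>s \<in> extensional (Obj C) \<and> (\<forall>c \<in> Obj C. F\<^sub>s c \<in> extensional (car (PO P c)))})"

definition rcalc_2mors :: "('o, 'a, 'p) rcalc \<Rightarrow> ('o, 'a, 'p) rcalc
    \<Rightarrow> ('o, 'a, 'p) rcalc_mor \<Rightarrow> ('o, 'a, 'p) rcalc_mor \<Rightarrow> ('o \<Rightarrow> 'a) set" where
  "rcalc_2mors = (\<lambda>(C, P) (C', P') (F, F\<^sub>s) (G, G\<^sub>s). {\<alpha> \<in> extensional (Obj C).
     left_adjoint_oplax C C' F G \<alpha> \<and> monoidal_transformation C C' F G \<alpha> \<and>
     (\<forall>c \<in> Obj C. \<forall>x \<in> car (PO P c). ple (PO P' (FO G c)) (PA P' (\<alpha> c) (F\<^sub>s c x)) (G\<^sub>s c x))})"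

definition RgCalc :: "(('o, 'a, 'p) rcalc, ('o, 'a, 'p) rcalc_mor, 'o \<Rightarrow> 'a) twocat" where
  "RgCalc = \<lparr>
     Ob = {(C, P). regular_calculus C P},
     H1 = rcalc_mors,
     H2 = rcalc_2mors,
     I1 = \<lambda>(C, P). (id_smfun C, \<lambda>c \<in> Obj C. \<lambda>x \<in> car (PO P c). x),
     C1 = \<lambda>(C, P) (C', P') (C'', P'') (F, F\<^sub>s) (G, G\<^sub>s).
       (comp_smfun C C'' F G, \<lambda>c \<in> Obj C. \<lambda>x \<in> car (PO P c). G\<^sub>s (FO F c) (F\<^sub>s c x)),
     I2 = \<lambda>(C, P) (C', P') (F, F\<^sub>s). id_trans C C' F,
     VC = \<lambda>(C, P) (C', P') F G H \<alpha> \<beta>. vcomp_trans C C' \<alpha> \<beta>,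
     HC = \<lambda>(C, P) (C', P') (C'', P'') (F, F\<^sub>s) (G, G\<^sub>s) (F', F'\<^sub>s) (G', G'\<^sub>s) \<alpha> \<alpha>'.
       hcomp_trans C C'' G F' \<alpha> \<alpha>'\<rparr>"

section \<open>The assignments of Prd\<close>

definition Prd_ob :: "('o, 'a) scat \<Rightarrow> ('o, 'a, 'a) rcalc" where
  "Prd_ob R = (R, \<lparr>
     PO = \<lambda>r. \<lparr>car = hom R (Unit R) r, ple = Leq R\<rparr>,
     PA = \<lambda>g f. f ;;\<^bsub>R\<^esub> g,
     PU = \<lambda>_. Idn R (Unit R),
     PM = \<lambda>r r' (f, f'). Supply R (Unit R) W_delta ;;\<^bsub>R\<^esub> (f \<otimes>\<^bsub>R\<^esub> f')\<rparr>)"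

definition Prd_mor :: "('o, 'a) scat \<Rightarrow> ('o, 'a) scat \<Rightarrow> ('o, 'a, 'o, 'a) smfun
    \<Rightarrow> ('o, 'a, 'a) rcalc_mor" where
  "Prd_mor R R' F = (F, \<lambda>r \<in> Obj R. \<lambda>f \<in> hom R (Unit R) r. FU F ;;\<^bsub>R'\<^esub> FA F f)"

definition Prd_cell :: "('o, 'a) scat \<Rightarrow> ('o, 'a) scat \<Rightarrow> ('o, 'a, 'o, 'a) smfun
    \<Rightarrow> ('o, 'a, 'o, 'a) smfun \<Rightarrow> ('o \<Rightarrow> 'a) \<Rightarrow> 'o \<Rightarrow> 'a" where
  "Prd_cell R R' F G \<alpha> = \<alpha>"

end

theory Submission
  imports Defs
begin

text \<open>
  On the unit object the supply axioms force \<open>\<epsilon>\<^sub>I = id\<close> and \<open>\<delta>\<^sub>I = \<lambda>\<^sub>I\<^sup>-\<^sup>1\<close>, so the lax monoidal structure of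
  \<open>R(I, -)\<close> reduces to the coherence facts \<open>\<lambda>\<^sub>I = \<rho>\<^sub>I\<close> and \<open>\<sigma>\<^sub>I\<^sub>,\<^sub>I = id\<close>; the left adjoints of the laxators
  are given by the two projections.

  The remaining point is that the left adjoints of a prerelational po-category form a cartesian category:
  they commute strictly with \<open>\<epsilon>\<close> and \<open>\<delta>\<close>, a left adjoint into the unit is \<open>\<epsilon>\<close>, and a left adjoint into
  \<open>y \<odot> z\<close> is determined by its projections, as \<open>\<delta> ; (\<pi>\<^sub>1 \<otimes> \<pi>\<^sub>2) = id\<close>.  Since a strong functor preserves left
  adjoints, it preserves \<open>\<epsilon>\<close>, hence all projections of tensor powers, hence the supply of every cospan
  \<open>k \<rightarrow> k \<leftarrow> m\<close> with identity left leg, which is a left adjoint.  The reversed cospans are right adjoints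
  of these, and every cospan is a composite of one of each kind.  In the same way, a left adjoint oplax
  transformation is strictly natural on left adjoints, in particular on projections, which makes it
  strictly monoidal.
\<close>

section \<open>Calculus in po-categories\<close>

text \<open>A strong functor is not told about the supply, so whatever it is to preserve has to be
  characterised through order and tensor alone; adjointness is such a characterisation. Both axioms
  of a prerelational po-category are inequalities. For a left adjoint \<open>f\<close> with right
  adjoint \<open>g\<close>, the converse inequality comes from the same axiom at \<open>g\<close>,
  transported along unit and counit of the adjunction. The equation for \<open>delta\<close> and the
  projections rests on the compatibility of the supply with \<open>\<odot>\<close>: discarding the
  two middle factors of a middle-four interchange leaves only the symmetry of I with itself, so
  coherence is needed at the unit object only. Strict naturality on left adjoints holds over all
  symmetric monoidal po-categories, hence also over the bases of regular calculi. There it gives the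
  interchange law, which mere oplaxness does not give, and closure of monoidal 2-cells under
  horizontal composition, where monoidality is part of the data instead of a consequence.\<close>

context pocat
begin

lemma hom_iff: "f \<in> hom C a b \<longleftrightarrow> f \<in> Arr C \<and> Dom C f = a \<and> Cod C f = b"
  by (simp add: hom_def)

lemma hom_obj: "f \<in> hom C a b \<Longrightarrow> a \<in> Obj C \<and> b \<in> Obj C"
  using Dom_in Cod_in by (auto simp: hom_def)

lemma Arr_hom: "f \<in> Arr C \<Longrightarrow> f \<in> hom C (Dom C f) (Cod C f)"
  by (simp add: hom_def)

lemma Idn_simps [simp]:
  assumes "a \<in> Obj C"
  shows "Idn C a \<in> Arr C" "Dom C (Idn C a) = a" "Cod C (Idn C a) = a"
  using Idn_in[OF assms] by (auto simp: hom_def)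

text \<open>Membership in \<open>hom\<close> leaves the middle object of a composite to be guessed;
  equations for \<open>Dom\<close> and \<open>Cod\<close> let the simplifier check typing without a
  guess.\<close>

lemma Cmp_simps [simp]:
  assumes "f \<in> Arr C" "g \<in> Arr C" "Cod C f = Dom C g"
  shows "f ;; g \<in> Arr C" "Dom C (f ;; g) = Dom C f" "Cod C (f ;; g) = Cod C g"
  using Cmp_in[of f "Dom C f" "Cod C f" g "Cod C g"] assms by (auto simp: hom_def)

lemma Idn_left' [simp]: "\<lbrakk>f \<in> Arr C; Dom C f = a\<rbrakk> \<Longrightarrow> Idn C a ;; f = f"
  using Idn_left[of f a "Cod C f"] by (simp add: hom_def)

lemma Idn_right' [simp]: "\<lbrakk>f \<in> Arr C; Cod C f = a\<rbrakk> \<Longrightarrow> f ;; Idn C a = f"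
  using Idn_right[of f "Dom C f" a] by (simp add: hom_def)

lemma assoc: "\<lbrakk>f \<in> Arr C; g \<in> Arr C; h \<in> Arr C; Cod C f = Dom C g; Cod C g = Dom C h\<rbrakk>
    \<Longrightarrow> (f ;; g) ;; h = f ;; (g ;; h)"
  using Cmp_assoc[of f "Dom C f" "Cod C f" g "Cod C g" h "Cod C h"] by (simp add: hom_def)

text \<open>Composites are normally nested to the right, where an equation for \<open>f ;; g\<close>
  no longer matches; this form applies it to a prefix.\<close>

lemma assoc_eq: "\<lbrakk>f ;; g = k; f \<in> Arr C; g \<in> Arr C; h \<in> Arr C; Cod C f = Dom C g; Cod C g = Dom C h\<rbrakk>
    \<Longrightarrow> f ;; (g ;; h) = k ;; h"
  using assoc by metis

lemma Leq_refl [simp]: "f \<in> Arr C \<Longrightarrow> f \<sqsubseteq> f"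
  using hom_refl[of "Dom C f" "Cod C f"] by (auto simp: hom_def reflp_on_def)

lemma Leq_trans:
  "\<lbrakk>f \<sqsubseteq> g; g \<sqsubseteq> h; f \<in> hom C a b; g \<in> hom C a b; h \<in> hom C a b\<rbrakk> \<Longrightarrow> f \<sqsubseteq> h"
  using hom_trans[of a b] by (auto dest: transp_onD)

lemma Leq_antisym:
  "\<lbrakk>f \<sqsubseteq> g; g \<sqsubseteq> f; f \<in> hom C a b; g \<in> hom C a b\<rbrakk> \<Longrightarrow> f = g"
  using hom_antisym[of a b] by (auto dest: antisymp_onD)

lemma Cmp_mono_left: "\<lbrakk>f \<sqsubseteq> f'; f \<in> hom C a b; f' \<in> hom C a b; g \<in> hom C b c\<rbrakk> \<Longrightarrow> f ;; g \<sqsubseteq> f' ;; g"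
  by (rule Cmp_mono[of _ a b _ _ c]) (auto simp: hom_def)

lemma Cmp_mono_right: "\<lbrakk>g \<sqsubseteq> g'; f \<in> hom C a b; g \<in> hom C b c; g' \<in> hom C b c\<rbrakk> \<Longrightarrow> f ;; g \<sqsubseteq> f ;; g'"
  by (rule Cmp_mono[of _ a b _ _ c]) (auto simp: hom_def)

section \<open>Isomorphisms: uniqueness of inverses and cancellation\<close>

lemma is_inverse_unique: "\<lbrakk>is_inverse C f g; is_inverse C f h\<rbrakk> \<Longrightarrow> g = h"
proof -
  assume g: "is_inverse C f g" and h: "is_inverse C f h"
  have "g = g ;; (f ;; h)" using g h by (simp add: is_inverse_def hom_def)
  also have "\<dots> = (g ;; f) ;; h" by (rule assoc[symmetric]) (use g h in \<open>auto simp: is_inverse_def hom_def\<close>)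
  also have "\<dots> = h" using g h by (simp add: is_inverse_def hom_def)
  finally show "g = h" .
qed

lemma inverse_of_eq: "is_inverse C f g \<Longrightarrow> inverse_of C f = g"
  unfolding inverse_of_def using is_inverse_unique by blast

lemma iso_inverse: "iso C f \<Longrightarrow> is_inverse C f (inverse_of C f)"
  unfolding iso_def using inverse_of_eq by metis

lemma inverse_simps [simp]:
  assumes "iso C f"
  shows "inverse_of C f \<in> Arr C" "Dom C (inverse_of C f) = Cod C f" "Cod C (inverse_of C f) = Dom C f"
    "f ;; inverse_of C f = Idn C (Dom C f)" "inverse_of C f ;; f = Idn C (Cod C f)"
  using iso_inverse[OF assms] by (auto simp: is_inverse_def hom_def)

lemma iso_Arr: "iso C f \<Longrightarrow> f \<in> Arr C"
  by (auto simp: iso_def is_inverse_def)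

lemma inverse_cancel [simp]:
  assumes "iso C f" "g \<in> Arr C"
  shows "Dom C g = Dom C f \<Longrightarrow> f ;; (inverse_of C f ;; g) = g"
    "Dom C g = Cod C f \<Longrightarrow> inverse_of C f ;; (f ;; g) = g"
  using assms iso_Arr[OF assms(1)] by (simp_all flip: assoc)

lemma iso_cancel_left:
  assumes "iso C f" "f ;; g = f ;; h" "g \<in> Arr C" "h \<in> Arr C" "Dom C g = Cod C f" "Dom C h = Cod C f"
  shows "g = h"
proof -
  have "g = inverse_of C f ;; (f ;; g)" using assms(1,3,5) by simp
  also have "\<dots> = inverse_of C f ;; (f ;; h)" by (simp only: assms(2))
  also have "\<dots> = h" using assms(1,4,6) by simp
  finally show ?thesis .
qed

lemma iso_cancel_right:
  assumes "iso C f" "g ;; f = h ;; f" "g \<in> Arr C" "h \<in> Arr C" "Cod C g = Dom C f" "Cod C h = Dom C f"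
  shows "g = h"
proof -
  have "k = (k ;; f) ;; inverse_of C f" if "k \<in> Arr C" "Cod C k = Dom C f" for k
    using that assms(1) iso_Arr[OF assms(1)] by (simp add: assoc)
  from this[OF assms(3,5)] this[OF assms(4,6)] show ?thesis by (simp only: assms(2))
qed

lemma is_inverse_Idn: "a \<in> Obj C \<Longrightarrow> is_inverse C (Idn C a) (Idn C a)"
  by (simp add: is_inverse_def hom_def)

lemma iso_Idn [simp]: "a \<in> Obj C \<Longrightarrow> iso C (Idn C a)"
  unfolding iso_def using is_inverse_Idn by blast

lemma iso_Cmp:
  assumes "iso C f" "iso C g" "Cod C f = Dom C g"
  shows "iso C (f ;; g)"
proof -
  have "is_inverse C (f ;; g) (inverse_of C g ;; inverse_of C f)"
    using assms iso_Arr[OF assms(1)] iso_Arr[OF assms(2)]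
    by (simp add: is_inverse_def hom_def assoc)
  then show ?thesis unfolding iso_def by blast
qed

section \<open>Adjunctions between arrows of a po-category\<close>

text \<open>The triangle identities are automatic: 2-cells are inequalities, so parallel ones
  agree.\<close>

definition ladj :: "'a \<Rightarrow> 'a \<Rightarrow> bool" where
  "ladj f g \<longleftrightarrow> f \<in> Arr C \<and> g \<in> hom C (Cod C f) (Dom C f) \<and>
     Idn C (Dom C f) \<sqsubseteq> f ;; g \<and> g ;; f \<sqsubseteq> Idn C (Cod C f)"

definition left_adjoint :: "'a \<Rightarrow> bool" where
  "left_adjoint f \<longleftrightarrow> (\<exists>g. ladj f g)"

lemma ladj_iso: "iso C f \<Longrightarrow> ladj f (inverse_of C f)"
  by (auto simp: ladj_def hom_def iso_Arr Dom_in Cod_in)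

text \<open>The unit of the second adjunction is inserted between \<open>f\<close> and
  \<open>g\<close>, and the counit of the first is cancelled between \<open>g'\<close> and
  \<open>f'\<close>.\<close>

lemma ladj_Cmp:
  assumes "ladj f g" "ladj f' g'" "Cod C f = Dom C f'"
  shows "ladj (f ;; f') (g' ;; g)"
proof -
  define a b c where [simp]: "a = Dom C f" "b = Dom C f'" "c = Cod C f'"
  have f: "f \<in> Arr C" "g \<in> Arr C" "Cod C f = b" "Dom C g = b" "Cod C g = a"
    and f': "f' \<in> Arr C" "g' \<in> Arr C" "Dom C g' = c" "Cod C g' = b"
    and le: "Idn C a \<sqsubseteq> f ;; g" "g ;; f \<sqsubseteq> Idn C b" "Idn C b \<sqsubseteq> f' ;; g'" "g' ;; f' \<sqsubseteq> Idn C c"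
    using assms by (auto simp: ladj_def hom_def)
  have ob: "a \<in> Obj C" "b \<in> Obj C" "c \<in> Obj C" using f f' Dom_in Cod_in by auto
  have 1: "Idn C b ;; g \<sqsubseteq> (f' ;; g') ;; g"
    by (rule Cmp_mono_left[OF le(3), of b b _ a]) (use f f' ob in \<open>auto simp: hom_def\<close>)
  have "f ;; (Idn C b ;; g) \<sqsubseteq> f ;; ((f' ;; g') ;; g)"
    by (rule Cmp_mono_right[OF 1, of _ a b a]) (use f f' ob in \<open>auto simp: hom_def\<close>)
  then have "f ;; g \<sqsubseteq> (f ;; f') ;; (g' ;; g)" using f f' ob by (simp add: assoc)
  then have u: "Idn C a \<sqsubseteq> (f ;; f') ;; (g' ;; g)"
    by (rule Leq_trans[OF le(1), of _ a a]) (use f f' ob in \<open>auto simp: hom_def\<close>)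
  have 2: "(g ;; f) ;; f' \<sqsubseteq> Idn C b ;; f'"
    by (rule Cmp_mono_left[OF le(2), of b b _ c]) (use f f' ob in \<open>auto simp: hom_def\<close>)
  have "g' ;; ((g ;; f) ;; f') \<sqsubseteq> g' ;; (Idn C b ;; f')"
    by (rule Cmp_mono_right[OF 2, of _ c b c]) (use f f' ob in \<open>auto simp: hom_def\<close>)
  then have "(g' ;; g) ;; (f ;; f') \<sqsubseteq> g' ;; f'" using f f' ob by (simp add: assoc)
  then have "(g' ;; g) ;; (f ;; f') \<sqsubseteq> Idn C c"
    by (rule Leq_trans[OF _ le(4), of _ c c]) (use f f' ob in \<open>auto simp: hom_def\<close>)
  with u show ?thesis using f f' ob by (simp add: ladj_def hom_def)
qed

text \<open>\<open>g \<le> g ;; f ;; h \<le> h\<close> and the same with roles exchanged;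
  antisymmetry of the homs turns this into an equality, which later carries preservation from
  \<open>W_up\<close> over to \<open>W_dn\<close>.\<close>

lemma ladj_right_unique:
  assumes "ladj f g" "ladj f h"
  shows "g = h"
proof -
  define a b where [simp]: "a = Dom C f" "b = Cod C f"
  have *: "g \<sqsubseteq> h" if "ladj f g" "ladj f h" for g h
  proof -
    have f: "f \<in> Arr C" "g \<in> Arr C" "Dom C g = b" "Cod C g = a" "h \<in> Arr C" "Dom C h = b" "Cod C h = a"
      and le: "g ;; f \<sqsubseteq> Idn C b" "Idn C a \<sqsubseteq> f ;; h"
      using that by (auto simp: ladj_def hom_def)
    have ob: "a \<in> Obj C" "b \<in> Obj C" using f Dom_in Cod_in by auto
    have "g ;; Idn C a \<sqsubseteq> g ;; (f ;; h)"
      by (rule Cmp_mono_right[OF le(2), of _ b a a]) (use f ob in \<open>auto simp: hom_def\<close>)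
    moreover have "(g ;; f) ;; h \<sqsubseteq> Idn C b ;; h"
      by (rule Cmp_mono_left[OF le(1), of b b _ a]) (use f ob in \<open>auto simp: hom_def\<close>)
    ultimately show "g \<sqsubseteq> h"
      using Leq_trans[of g "g ;; (f ;; h)" h b a] f ob by (simp add: assoc hom_def)
  qed
  show ?thesis
    by (rule Leq_antisym[OF *[OF assms] *[OF assms(2,1)], of b a]) (use assms in \<open>simp_all add: ladj_def\<close>)
qed

lemma left_adjoint_iso: "iso C f \<Longrightarrow> left_adjoint f"
  unfolding left_adjoint_def using ladj_iso by blast

lemma left_adjoint_Cmp: "\<lbrakk>left_adjoint f; left_adjoint g; Cod C f = Dom C g\<rbrakk> \<Longrightarrow> left_adjoint (f ;; g)"
  unfolding left_adjoint_def using ladj_Cmp by blast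

lemma left_adjoint_Arr: "left_adjoint f \<Longrightarrow> f \<in> Arr C"
  by (auto simp: left_adjoint_def ladj_def)

lemma iso_inverse_iso: "iso C f \<Longrightarrow> iso C (inverse_of C f)"
  unfolding iso_def[of _ "inverse_of C f"]
  by (rule exI[of _ f]) (simp add: is_inverse_def hom_def iso_Arr)

lemma inverse_Idn [simp]: "a \<in> Obj C \<Longrightarrow> inverse_of C (Idn C a) = Idn C a"
  by (rule inverse_of_eq[OF is_inverse_Idn])

text \<open>Turns a naturality square with invertible sides around; inverse associators and unitors
  get their naturality from here.\<close>

lemma inverse_natural:
  assumes "iso C s" "iso C t" "f ;; t = s ;; g" "f \<in> Arr C" "g \<in> Arr C"
    "Cod C f = Dom C t" "Dom C g = Cod C s" "Dom C f = Dom C s" "Cod C g = Cod C t"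
  shows "g ;; inverse_of C t = inverse_of C s ;; f"
proof -
  have "g ;; inverse_of C t = inverse_of C s ;; ((s ;; g) ;; inverse_of C t)"
    using assms iso_Arr[OF assms(1)] by (simp add: assoc)
  also have "\<dots> = inverse_of C s ;; f"
    using assms iso_Arr[OF assms(2)] by (simp add: assoc flip: assms(3))
  finally show ?thesis .
qed

end

section \<open>Coherence in symmetric monoidal po-categories\<close>

context smpocat
begin

lemma TenO_simps [simp]: "Unit C \<in> Obj C" "\<lbrakk>a \<in> Obj C; b \<in> Obj C\<rbrakk> \<Longrightarrow> a \<odot> b \<in> Obj C"
  by (rule Unit_in) (rule TenO_in)

lemma TenA_simps [simp]:
  assumes "f \<in> Arr C" "g \<in> Arr C"
  shows "f \<otimes> g \<in> Arr C" "Dom C (f \<otimes> g) = Dom C f \<odot> Dom C g" "Cod C (f \<otimes> g) = Cod C f \<odot> Cod C g"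
  using TenA_in[of f "Dom C f" "Cod C f" g "Dom C g" "Cod C g"] assms by (auto simp: hom_def)

lemma Assoc_simps [simp]:
  assumes "a \<in> Obj C" "b \<in> Obj C" "c \<in> Obj C"
  shows "Assoc C a b c \<in> Arr C" "Dom C (Assoc C a b c) = (a \<odot> b) \<odot> c"
    "Cod C (Assoc C a b c) = a \<odot> (b \<odot> c)" "iso C (Assoc C a b c)"
  using Assoc_in[OF assms] Assoc_iso[OF assms] by (auto simp: hom_def)

lemma Unitor_simps [simp]:
  assumes "a \<in> Obj C"
  shows "LUnit C a \<in> Arr C" "Dom C (LUnit C a) = Unit C \<odot> a" "Cod C (LUnit C a) = a" "iso C (LUnit C a)"
    "RUnit C a \<in> Arr C" "Dom C (RUnit C a) = a \<odot> Unit C" "Cod C (RUnit C a) = a" "iso C (RUnit C a)"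
  using LUnit_in[OF assms] LUnit_iso[OF assms] RUnit_in[OF assms] RUnit_iso[OF assms] by (auto simp: hom_def)

lemma Swap_simps [simp]:
  assumes "a \<in> Obj C" "b \<in> Obj C"
  shows "Swap C a b \<in> Arr C" "Dom C (Swap C a b) = a \<odot> b" "Cod C (Swap C a b) = b \<odot> a" "iso C (Swap C a b)"
proof -
  show s: "Swap C a b \<in> Arr C" "Dom C (Swap C a b) = a \<odot> b" "Cod C (Swap C a b) = b \<odot> a"
    using Swap_in[OF assms] by (auto simp: hom_def)
  show "iso C (Swap C a b)" unfolding iso_def
    by (rule exI[of _ "Swap C b a"])
      (use s Swap_in[OF assms(2,1)] Swap_Swap assms in \<open>simp add: is_inverse_def hom_def\<close>)
qed

text \<open>Oriented so that the simplifier fuses tensors. Proofs that must split a tensor pad one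
  factor with an identity and apply the rule backwards.\<close>

lemma exchange: "\<lbrakk>f \<in> Arr C; f' \<in> Arr C; g \<in> Arr C; g' \<in> Arr C; Cod C f = Dom C f'; Cod C g = Dom C g'\<rbrakk>
    \<Longrightarrow> (f \<otimes> g) ;; (f' \<otimes> g') = (f ;; f') \<otimes> (g ;; g')"
  using TenA_Cmp[of f "Dom C f" "Cod C f" f' "Cod C f'" g "Dom C g" "Cod C g" g' "Cod C g'"]
  by (simp add: hom_def)

lemma exchange_assoc: "\<lbrakk>f \<in> Arr C; f' \<in> Arr C; g \<in> Arr C; g' \<in> Arr C; Cod C f = Dom C f'; Cod C g = Dom C g';
    h \<in> Arr C; Dom C h = Cod C f' \<odot> Cod C g'\<rbrakk>
    \<Longrightarrow> (f \<otimes> g) ;; ((f' \<otimes> g') ;; h) = ((f ;; f') \<otimes> (g ;; g')) ;; h"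
  by (subst assoc[symmetric]) (simp_all add: exchange)

lemma TenA_iso:
  assumes "iso C f" "iso C g"
  shows "iso C (f \<otimes> g)" "inverse_of C (f \<otimes> g) = inverse_of C f \<otimes> inverse_of C g"
proof -
  have "is_inverse C (f \<otimes> g) (inverse_of C f \<otimes> inverse_of C g)"
    using assms iso_Arr[OF assms(1)] iso_Arr[OF assms(2)] Dom_in Cod_in
    by (simp add: is_inverse_def hom_def exchange TenA_Idn)
  then show "iso C (f \<otimes> g)" "inverse_of C (f \<otimes> g) = inverse_of C f \<otimes> inverse_of C g"
    using inverse_of_eq by (auto simp: iso_def)
qed

lemma LUnit_natural: "\<lbrakk>f \<in> Arr C; Dom C f = a; Cod C f = b\<rbrakk> \<Longrightarrow> (Idn C (Unit C) \<otimes> f) ;; LUnit C b = LUnit C a ;; f"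
  by (rule LUnit_nat) (simp add: hom_def)

lemma RUnit_natural: "\<lbrakk>f \<in> Arr C; Dom C f = a; Cod C f = b\<rbrakk> \<Longrightarrow> (f \<otimes> Idn C (Unit C)) ;; RUnit C b = RUnit C a ;; f"
  by (rule RUnit_nat) (simp add: hom_def)

text \<open>\<open>LUnit\<close> is a natural isomorphism from tensoring with I to the identity
  functor, so tensoring with I is faithful.\<close>

lemma Unit_tensor_faithful:
  assumes "Idn C (Unit C) \<otimes> f = Idn C (Unit C) \<otimes> g"
    "f \<in> Arr C" "g \<in> Arr C" "Dom C f = Dom C g" "Cod C f = Cod C g"
  shows "f = g"
proof (rule iso_cancel_left[of "LUnit C (Dom C f)"])
  show "LUnit C (Dom C f) ;; f = LUnit C (Dom C f) ;; g"
    using LUnit_natural[OF assms(2) refl refl] LUnit_natural[OF assms(3) refl refl] assms(1,4,5) by simp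
qed (use assms Dom_in in auto)

lemma tensor_Unit_faithful:
  assumes "f \<otimes> Idn C (Unit C) = g \<otimes> Idn C (Unit C)"
    "f \<in> Arr C" "g \<in> Arr C" "Dom C f = Dom C g" "Cod C f = Cod C g"
  shows "f = g"
proof (rule iso_cancel_left[of "RUnit C (Dom C f)"])
  show "RUnit C (Dom C f) ;; f = RUnit C (Dom C f) ;; g"
    using RUnit_natural[OF assms(2) refl refl] RUnit_natural[OF assms(3) refl refl] assms(1,4,5) by simp
qed (use assms Dom_in in auto)

lemma Assoc_natural:
  "\<lbrakk>f \<in> Arr C; g \<in> Arr C; h \<in> Arr C; Dom C f = a; Dom C g = b; Dom C h = c; Cod C f = a'; Cod C g = b'; Cod C h = c'\<rbrakk>
    \<Longrightarrow> ((f \<otimes> g) \<otimes> h) ;; Assoc C a' b' c' = Assoc C a b c ;; (f \<otimes> (g \<otimes> h))"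
  by (rule Assoc_nat) (simp_all add: hom_def)

section \<open>Coherence at the unit object\<close>

text \<open>Kelly's argument: the pentagon at I, I, \<open>a\<close>, \<open>b\<close> together with
  two triangles yields the equation tensored with the identity of I, and that tensoring is
  faithful.\<close>

lemma Assoc_LUnit:
  assumes a: "a \<in> Obj C" and b: "b \<in> Obj C"
  shows "Assoc C (Unit C) a b ;; LUnit C (a \<odot> b) = LUnit C a \<otimes> Idn C b"
proof -
  let ?I = "Unit C" and ?i = "Idn C (Unit C)"
  have "(Assoc C ?I ?I a \<otimes> Idn C b) ;; (Assoc C ?I (?I \<odot> a) b ;; (?i \<otimes> (Assoc C ?I a b ;; LUnit C (a \<odot> b))))
      = ((Assoc C ?I ?I a \<otimes> Idn C b) ;; Assoc C ?I (?I \<odot> a) b ;; (?i \<otimes> Assoc C ?I a b)) ;; (?i \<otimes> LUnit C (a \<odot> b))"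
    using a b by (simp add: assoc exchange)
  also have "\<dots> = (Assoc C (?I \<odot> ?I) a b ;; Assoc C ?I ?I (a \<odot> b)) ;; (?i \<otimes> LUnit C (a \<odot> b))"
    by (simp only: pentagon[OF Unit_in Unit_in a b])
  also have "\<dots> = Assoc C (?I \<odot> ?I) a b ;; (RUnit C ?I \<otimes> (Idn C a \<otimes> Idn C b))"
    using a b by (simp add: assoc triangle TenA_Idn)
  also have "\<dots> = ((RUnit C ?I \<otimes> Idn C a) \<otimes> Idn C b) ;; Assoc C ?I a b"
    using a b by (simp add: Assoc_natural)
  also have "\<dots> = ((Assoc C ?I ?I a ;; (?i \<otimes> LUnit C a)) \<otimes> (Idn C b ;; Idn C b)) ;; Assoc C ?I a b"
    using a b by (simp add: triangle)
  also have "\<dots> = (Assoc C ?I ?I a \<otimes> Idn C b) ;; (((?i \<otimes> LUnit C a) \<otimes> Idn C b) ;; Assoc C ?I a b)"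
    using a b by (subst exchange[symmetric]) (simp_all add: assoc)
  also have "\<dots> = (Assoc C ?I ?I a \<otimes> Idn C b) ;; (Assoc C ?I (?I \<odot> a) b ;; (?i \<otimes> (LUnit C a \<otimes> Idn C b)))"
    using a b by (simp add: Assoc_natural)
  finally have "Assoc C ?I (?I \<odot> a) b ;; (?i \<otimes> (Assoc C ?I a b ;; LUnit C (a \<odot> b)))
      = Assoc C ?I (?I \<odot> a) b ;; (?i \<otimes> (LUnit C a \<otimes> Idn C b))"
    by (rule iso_cancel_left[rotated]) (use a b in \<open>simp_all add: TenA_iso\<close>)
  then have "?i \<otimes> (Assoc C ?I a b ;; LUnit C (a \<odot> b)) = ?i \<otimes> (LUnit C a \<otimes> Idn C b)"
    by (rule iso_cancel_left[rotated]) (use a b in \<open>simp_all add: TenA_iso\<close>)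
  then show ?thesis
    by (rule Unit_tensor_faithful) (use a b in simp_all)
qed

lemma LUnit_Unit: "LUnit C (Unit C) = RUnit C (Unit C)"
proof -
  let ?I = "Unit C" and ?i = "Idn C (Unit C)"
  \<comment> \<open>Naturality of \<open>LUnit\<close> at its own component
    \<open>LUnit C ?I\<close>, which is then cancelled.\<close>
  have "LUnit C (?I \<odot> ?I) = ?i \<otimes> LUnit C ?I"
    by (rule iso_cancel_right[of "LUnit C ?I"]) (simp_all add: LUnit_natural)
  then have "LUnit C ?I \<otimes> ?i = RUnit C ?I \<otimes> ?i"
    using Assoc_LUnit[of ?I ?I] triangle[of ?I ?I] by simp
  then show ?thesis by (rule tensor_Unit_faithful) simp_all
qed

text \<open>Under the unitors the hexagon at I, I, I collapses to
  \<open>RUnit I = Swap I I ;; LUnit I\<close>. Both unitors agree at I, so the symmetry there must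
  be the identity.\<close>

lemma Swap_Unit: "Swap C (Unit C) (Unit C) = Idn C (Unit C \<odot> Unit C)"
proof -
  let ?I = "Unit C" and ?i = "Idn C (Unit C)"
  have "(RUnit C ?I \<otimes> ?i) ;; Swap C ?I ?I = Assoc C ?I ?I ?I ;; ((?i \<otimes> LUnit C ?I) ;; Swap C ?I ?I)"
    by (simp flip: assoc triangle)
  also have "\<dots> = Assoc C ?I ?I ?I ;; (Swap C ?I (?I \<odot> ?I) ;; (LUnit C ?I \<otimes> ?i))"
    by (subst Swap_nat[of _ ?I ?I _ "?I \<odot> ?I" ?I]) (simp_all add: hom_def)
  also have "\<dots> = (Assoc C ?I ?I ?I ;; Swap C ?I (?I \<odot> ?I) ;; Assoc C ?I ?I ?I) ;; LUnit C (?I \<odot> ?I)"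
    by (simp add: assoc flip: Assoc_LUnit)
  also have "\<dots> = ((Swap C ?I ?I \<otimes> ?i) ;; Assoc C ?I ?I ?I ;; (?i \<otimes> Swap C ?I ?I)) ;; LUnit C (?I \<odot> ?I)"
    by (simp only: hexagon[OF Unit_in Unit_in Unit_in])
  also have "\<dots> = (Swap C ?I ?I \<otimes> ?i) ;; (Assoc C ?I ?I ?I ;; ((?i \<otimes> Swap C ?I ?I) ;; LUnit C (?I \<odot> ?I)))"
    by (simp add: assoc)
  also have "\<dots> = (Swap C ?I ?I \<otimes> ?i) ;; ((Assoc C ?I ?I ?I ;; LUnit C (?I \<odot> ?I)) ;; Swap C ?I ?I)"
    by (simp add: LUnit_natural assoc)
  also have "\<dots> = ((Swap C ?I ?I ;; LUnit C ?I) \<otimes> ?i) ;; Swap C ?I ?I"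
    by (simp add: Assoc_LUnit exchange flip: assoc)
  finally have "RUnit C ?I \<otimes> ?i = (Swap C ?I ?I ;; LUnit C ?I) \<otimes> ?i"
    by (rule iso_cancel_right[rotated]) simp_all
  then have "RUnit C ?I = Swap C ?I ?I ;; LUnit C ?I"
    by (rule tensor_Unit_faithful) simp_all
  then have "Swap C ?I ?I ;; LUnit C ?I = Idn C (?I \<odot> ?I) ;; LUnit C ?I"
    by (simp add: LUnit_Unit)
  then show ?thesis by (rule iso_cancel_right[rotated]) simp_all
qed

section \<open>The middle-four interchange\<close>

lemma mid4_simps [simp]:
  assumes "a \<in> Obj C" "b \<in> Obj C" "c \<in> Obj C" "d \<in> Obj C"
  shows "mid4 C a b c d \<in> Arr C" "Dom C (mid4 C a b c d) = (a \<odot> b) \<odot> (c \<odot> d)"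
    "Cod C (mid4 C a b c d) = (a \<odot> c) \<odot> (b \<odot> d)"
  using assms by (simp_all add: mid4_def)

text \<open>With I in both middle places the inner symmetry is \<open>Swap I I\<close>, and the
  associators cancel in pairs. Through this, \<open>delta_pr\<close> gets by with coherence at the
  unit.\<close>

lemma mid4_Unit: "\<lbrakk>a \<in> Obj C; b \<in> Obj C\<rbrakk> \<Longrightarrow> mid4 C a (Unit C) (Unit C) b = Idn C ((a \<odot> Unit C) \<odot> (Unit C \<odot> b))"
  by (simp add: mid4_def Swap_Unit TenA_Idn)

lemma mid4_natural:
  assumes "f \<in> hom C a a'" "g \<in> hom C b b'" "h \<in> hom C c c'" "k \<in> hom C d d'"
  shows "((f \<otimes> g) \<otimes> (h \<otimes> k)) ;; mid4 C a' b' c' d' = mid4 C a b c d ;; ((f \<otimes> h) \<otimes> (g \<otimes> k))"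
proof -
  have ob: "a \<in> Obj C" "b \<in> Obj C" "c \<in> Obj C" "d \<in> Obj C" "a' \<in> Obj C" "b' \<in> Obj C" "c' \<in> Obj C" "d' \<in> Obj C"
    using assms hom_obj by auto
  have ar: "f \<in> Arr C" "g \<in> Arr C" "h \<in> Arr C" "k \<in> Arr C" "Dom C f = a" "Cod C f = a'" "Dom C g = b" "Cod C g = b'"
     "Dom C h = c" "Cod C h = c'" "Dom C k = d" "Cod C k = d'"
    using assms by (auto simp: hom_def)
  \<comment> \<open>The inner part of \<open>mid4\<close>, which exchanges the second and third
    factor; its naturality is shown alone and then wrapped in the two outer associators.\<close>
  define m where "m b c d = inverse_of C (Assoc C b c d) ;; (Swap C b c \<otimes> Idn C d) ;; Assoc C c b d" for b c d
  have m [simp]: "m b c d \<in> Arr C" "Dom C (m b c d) = b \<odot> (c \<odot> d)" "Cod C (m b c d) = c \<odot> (b \<odot> d)"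
    if "b \<in> Obj C" "c \<in> Obj C" "d \<in> Obj C" for b c d
    using that by (simp_all add: m_def)
  have inv: "(f \<otimes> (g \<otimes> h)) ;; inverse_of C (Assoc C a' b' c') = inverse_of C (Assoc C a b c) ;; ((f \<otimes> g) \<otimes> h)"
    if "f \<in> Arr C" "g \<in> Arr C" "h \<in> Arr C" "Dom C f = a" "Dom C g = b" "Dom C h = c" "Cod C f = a'" "Cod C g = b'" "Cod C h = c'"
    for f g h a b c a' b' c'
    by (rule inverse_natural) (use that Assoc_natural Dom_in Cod_in in auto)
  have sw: "(g \<otimes> h) ;; Swap C b' c' = Swap C b c ;; (h \<otimes> g)"
    by (rule Swap_nat) (use assms in auto)
  have M: "(g \<otimes> (h \<otimes> k)) ;; m b' c' d' = m b c d ;; (h \<otimes> (g \<otimes> k))"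
  proof -
    have "(g \<otimes> (h \<otimes> k)) ;; m b' c' d'
        = ((g \<otimes> (h \<otimes> k)) ;; inverse_of C (Assoc C b' c' d')) ;; ((Swap C b' c' \<otimes> Idn C d') ;; Assoc C c' b' d')"
      using ar ob by (simp add: m_def assoc)
    also have "\<dots> = inverse_of C (Assoc C b c d) ;; (((g \<otimes> h) ;; Swap C b' c') \<otimes> k) ;; Assoc C c' b' d'"
      using ar ob by (simp add: inv assoc exchange_assoc)
    also have "\<dots> = inverse_of C (Assoc C b c d) ;; ((Swap C b c ;; (h \<otimes> g)) \<otimes> (Idn C d ;; k)) ;; Assoc C c' b' d'"
      using ar ob by (simp add: sw)
    also have "\<dots> = inverse_of C (Assoc C b c d) ;; ((Swap C b c \<otimes> Idn C d) ;; (((h \<otimes> g) \<otimes> k) ;; Assoc C c' b' d'))"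
      using ar ob by (subst exchange[symmetric]) (simp_all add: assoc)
    also have "\<dots> = m b c d ;; (h \<otimes> (g \<otimes> k))"
      using ar ob by (simp add: m_def assoc Assoc_natural)
    finally show ?thesis .
  qed
  have mid: "mid4 C a b c d = Assoc C a b (c \<odot> d) ;; ((Idn C a \<otimes> m b c d) ;; inverse_of C (Assoc C a c (b \<odot> d)))"
    if "a \<in> Obj C" "b \<in> Obj C" "c \<in> Obj C" "d \<in> Obj C" for a b c d
    using that by (simp add: mid4_def m_def assoc)
  have "((f \<otimes> g) \<otimes> (h \<otimes> k)) ;; mid4 C a' b' c' d'
     = (((f \<otimes> g) \<otimes> (h \<otimes> k)) ;; Assoc C a' b' (c' \<odot> d')) ;; ((Idn C a' \<otimes> m b' c' d') ;; inverse_of C (Assoc C a' c' (b' \<odot> d')))"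
    using ar ob by (simp add: mid assoc)
  also have "\<dots> = Assoc C a b (c \<odot> d) ;; ((f \<otimes> ((g \<otimes> (h \<otimes> k)) ;; m b' c' d')) ;; inverse_of C (Assoc C a' c' (b' \<odot> d')))"
    using ar ob by (simp add: Assoc_natural assoc exchange_assoc)
  also have "\<dots> = Assoc C a b (c \<odot> d) ;; (((Idn C a ;; f) \<otimes> (m b c d ;; (h \<otimes> (g \<otimes> k)))) ;; inverse_of C (Assoc C a' c' (b' \<odot> d')))"
    using ar ob by (simp add: M)
  also have "\<dots> = Assoc C a b (c \<odot> d) ;; ((Idn C a \<otimes> m b c d) ;; ((f \<otimes> (h \<otimes> (g \<otimes> k))) ;; inverse_of C (Assoc C a' c' (b' \<odot> d'))))"
    using ar ob by (subst exchange[symmetric]) (simp_all add: assoc)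
  also have "\<dots> = mid4 C a b c d ;; ((f \<otimes> h) \<otimes> (g \<otimes> k))"
    using ar ob by (simp add: inv mid assoc)
  finally show ?thesis .
qed

lemma tpow_Obj [simp]: "c \<in> Obj C \<Longrightarrow> tpow C c n \<in> Obj C"
proof (induction n)
  case (Suc n)
  then show ?case by (cases n) auto
qed simp

lemma left_adjoint_TenA:
  assumes "left_adjoint f" "left_adjoint f'"
  shows "left_adjoint (f \<otimes> f')"
proof -
  obtain g g' where adj: "ladj f g" "ladj f' g'" using assms by (auto simp: left_adjoint_def)
  define a b a' b' where [simp]: "a = Dom C f" "b = Cod C f" "a' = Dom C f'" "b' = Cod C f'"
  have f: "f \<in> Arr C" "g \<in> Arr C" "Dom C g = b" "Cod C g = a"
    and f': "f' \<in> Arr C" "g' \<in> Arr C" "Dom C g' = b'" "Cod C g' = a'"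
    and le: "Idn C a \<sqsubseteq> f ;; g" "g ;; f \<sqsubseteq> Idn C b" "Idn C a' \<sqsubseteq> f' ;; g'" "g' ;; f' \<sqsubseteq> Idn C b'"
    using adj by (auto simp: ladj_def hom_def)
  have ob: "a \<in> Obj C" "b \<in> Obj C" "a' \<in> Obj C" "b' \<in> Obj C" using f f' Dom_in Cod_in by auto
  have "Idn C a \<otimes> Idn C a' \<sqsubseteq> (f ;; g) \<otimes> (f' ;; g')"
    by (rule TenA_mono[of _ a a _ _ a' a']) (use f f' ob le in \<open>auto simp: hom_def\<close>)
  moreover have "(g ;; f) \<otimes> (g' ;; f') \<sqsubseteq> Idn C b \<otimes> Idn C b'"
    by (rule TenA_mono[of _ b b _ _ b' b']) (use f f' ob le in \<open>auto simp: hom_def\<close>)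
  ultimately have "ladj (f \<otimes> f') (g \<otimes> g')"
    using f f' ob by (simp add: ladj_def hom_def TenA_Idn exchange)
  then show ?thesis by (auto simp: left_adjoint_def)
qed

end

section \<open>Calculus of cospans\<close>

text \<open>Keeps \<open>1\<close> in \<open>W_up n 1\<close> from turning into
  \<open>Suc 0\<close>, so that cospans with one output have one normal form. Where the recursion of
  \<open>tpow\<close> needs \<open>Suc\<close>, the equation is supplied by hand.\<close>

declare One_nat_def [simp del]

section \<open>The preorder on cospans and its classes\<close>

lemma cospan_le_refl: "w \<in> cospans \<Longrightarrow> cospan_le w w"
  unfolding cospan_le_def by (auto intro!: bexI[of _ "\<lambda>x. x"])

lemma cospan_le_trans:
  assumes "cospan_le x y" "cospan_le y z"
  shows "cospan_le x z"
proof -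
  obtain h h' where h: "h \<in> apex y \<rightarrow> apex x" "\<And>i. i \<in> {1..csrc x} \<Longrightarrow> h (lleg y i) = lleg x i"
      "\<And>i. i \<in> {1..ctgt x} \<Longrightarrow> h (rleg y i) = rleg x i"
    and h': "h' \<in> apex z \<rightarrow> apex y" "\<And>i. i \<in> {1..csrc y} \<Longrightarrow> h' (lleg z i) = lleg y i"
      "\<And>i. i \<in> {1..ctgt y} \<Longrightarrow> h' (rleg z i) = rleg y i"
    and e: "csrc x = csrc y" "ctgt x = ctgt y" "csrc y = csrc z" "ctgt y = ctgt z"
    using assms unfolding cospan_le_def by blast
  then show ?thesis unfolding cospan_le_def
    by (auto intro!: bexI[of _ "h \<circ> h'"])
qed

lemma cospan_le_ends: "cospan_le x y \<Longrightarrow> csrc x = csrc y \<and> ctgt x = ctgt y"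
  by (simp add: cospan_le_def)

lemma equiv_cospan_eq: "equiv cospans cospan_eq"
  by (rule equivI) (auto simp: cospan_eq_def refl_on_def sym_def trans_def
      intro: cospan_le_refl cospan_le_trans)

lemma mem_wclass: "x \<in> wclass w \<longleftrightarrow> w \<in> cospans \<and> x \<in> cospans \<and> cospan_le w x \<and> cospan_le x w"
  by (auto simp: wclass_def cospan_eq_def)

text \<open>Leg-preserving maps between the apexes in both directions suffice; because homs are
  poset reflections, the apexes may fail to be in bijection.\<close>

lemma wclass_eqI: "\<lbrakk>x \<in> cospans; y \<in> cospans; cospan_le x y; cospan_le y x\<rbrakk> \<Longrightarrow> wclass x = wclass y"
  unfolding wclass_def by (rule equiv_class_eq[OF equiv_cospan_eq]) (simp add: cospan_eq_def)

lemma wclass_Leq: "\<lbrakk>x \<in> cospans; y \<in> cospans\<rbrakk> \<Longrightarrow> Leq W (wclass x) (wclass y) \<longleftrightarrow> cospan_le x y"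
  using cospan_le_refl cospan_le_trans by (simp add: W_def Bex_def mem_wclass) blast

lemma hom_W: "A \<in> hom W m n \<longleftrightarrow> (\<exists>w \<in> cospans. csrc w = m \<and> ctgt w = n \<and> A = wclass w)"
proof -
  have "csrc ` wclass w = {csrc w}" "ctgt ` wclass w = {ctgt w}" if "w \<in> cospans" for w
  proof -
    have "w \<in> wclass w" using that cospan_le_refl by (simp add: mem_wclass)
    moreover have "csrc x = csrc w" "ctgt x = ctgt w" if "x \<in> wclass w" for x
      using that by (auto simp: mem_wclass dest: cospan_le_ends)
    ultimately show "csrc ` wclass w = {csrc w}" "ctgt ` wclass w = {ctgt w}" by blast+
  qed
  then have "Dom W (wclass w) = csrc w \<and> Cod W (wclass w) = ctgt w" if "w \<in> cospans" for w
    using that by (simp add: W_def)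
  moreover have "Arr W = wclass ` cospans"
    by (auto simp: W_def quotient_def wclass_def)
  ultimately show ?thesis by (auto simp: hom_def)
qed

section \<open>Composition and tensor on classes of cospans\<close>

lemma comp_cospans:
  assumes "is_cospan_comp x y q" "x \<in> cospans" "y \<in> cospans"
  shows "q \<in> cospans"
  using assms unfolding is_cospan_comp_def is_pushout_def cospans_def
  by (auto simp: Pi_iff)

text \<open>The order reverses apex maps: the maps from the primed apexes to the unprimed ones form
  a cocone on the primed pushout, and the induced map is the required comparison
  \<open>u\<close>.\<close>

lemma comp_mono:
  assumes "is_cospan_comp x y q" "is_cospan_comp x' y' q'" "x \<in> cospans" "y \<in> cospans"
    "x' \<in> cospans" "y' \<in> cospans" and le: "cospan_le x x'" "cospan_le y y'"
  shows "cospan_le q q'"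
proof -
  obtain i j where c: "ctgt x = csrc y" "csrc q = csrc x" "ctgt q = ctgt y"
    and po: "is_pushout {1..ctgt x} (rleg x) (lleg y) (apex x) (apex y) (apex q) i j"
    and legs: "\<And>k. k \<in> {1..csrc q} \<Longrightarrow> lleg q k = i (lleg x k)" "\<And>k. k \<in> {1..ctgt q} \<Longrightarrow> rleg q k = j (rleg y k)"
    using assms(1) unfolding is_cospan_comp_def by blast
  obtain i' j' where c': "ctgt x' = csrc y'" "csrc q' = csrc x'" "ctgt q' = ctgt y'"
    and po': "is_pushout {1..ctgt x'} (rleg x') (lleg y') (apex x') (apex y') (apex q') i' j'"
    and legs': "\<And>k. k \<in> {1..csrc q'} \<Longrightarrow> lleg q' k = i' (lleg x' k)" "\<And>k. k \<in> {1..ctgt q'} \<Longrightarrow> rleg q' k = j' (rleg y' k)"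
    using assms(2) unfolding is_cospan_comp_def by blast
  obtain h where h: "h \<in> apex x' \<rightarrow> apex x" "\<And>k. k \<in> {1..csrc x} \<Longrightarrow> h (lleg x' k) = lleg x k"
      "\<And>k. k \<in> {1..ctgt x} \<Longrightarrow> h (rleg x' k) = rleg x k" "csrc x = csrc x'" "ctgt x = ctgt x'"
    using le(1) unfolding cospan_le_def by blast
  obtain g where g: "g \<in> apex y' \<rightarrow> apex y" "\<And>k. k \<in> {1..csrc y} \<Longrightarrow> g (lleg y' k) = lleg y k"
      "\<And>k. k \<in> {1..ctgt y} \<Longrightarrow> g (rleg y' k) = rleg y k" "csrc y = csrc y'" "ctgt y = ctgt y'"
    using le(2) unfolding cospan_le_def by blast
  have fin: "finite (apex q)" and ij: "i \<in> apex x \<rightarrow> apex q" "j \<in> apex y \<rightarrow> apex q"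
    and comm: "\<And>k. k \<in> {1..ctgt x} \<Longrightarrow> i (rleg x k) = j (lleg y k)"
    using po unfolding is_pushout_def by simp_all
  have univ: "\<exists>!u. u \<in> apex q' \<rightarrow>\<^sub>E Z \<and> (\<forall>s \<in> apex x'. u (i' s) = f s) \<and> (\<forall>t \<in> apex y'. u (j' t) = f' t)"
    if "finite Z" "f \<in> apex x' \<rightarrow> Z" "f' \<in> apex y' \<rightarrow> Z" "\<forall>k \<in> {1..ctgt x'}. f (rleg x' k) = f' (lleg y' k)" for Z :: "nat set" and f f'
    using po'[unfolded is_pushout_def] that by simp
  have "\<exists>!u. u \<in> apex q' \<rightarrow>\<^sub>E apex q \<and> (\<forall>s \<in> apex x'. u (i' s) = i (h s)) \<and> (\<forall>t \<in> apex y'. u (j' t) = j (g t))"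
  proof (rule univ)
    show "\<forall>k \<in> {1..ctgt x'}. i (h (rleg x' k)) = j (g (lleg y' k))"
      using h(3,5) g(2) c comm by simp
  qed (use fin ij h g in auto)
  then obtain u where u: "u \<in> apex q' \<rightarrow>\<^sub>E apex q" "\<And>s. s \<in> apex x' \<Longrightarrow> u (i' s) = i (h s)" "\<And>t. t \<in> apex y' \<Longrightarrow> u (j' t) = j (g t)"
    by blast
  have "u (lleg q' k) = lleg q k" if "k \<in> {1..csrc q}" for k
    using that c c' legs legs' h u assms(5) by (simp add: cospans_def Pi_iff)
  moreover have "u (rleg q' k) = rleg q k" if "k \<in> {1..ctgt q}" for k
    using that c c' legs legs' g u assms(6) by (simp add: cospans_def Pi_iff)
  ultimately show ?thesis
    using u(1) c c' h(4) g(5) unfolding cospan_le_def by (intro conjI bexI[of _ u]) (auto simp: PiE_def)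
qed

text \<open>By \<open>comp_mono\<close> in both directions all classes in the union defining
  \<open>Cmp\<close> coincide, so a single explicit pushout computes a composite.\<close>

lemma wclass_Cmp:
  assumes "is_cospan_comp x y q" "x \<in> cospans" "y \<in> cospans"
  shows "wclass x ;;\<^bsub>W\<^esub> wclass y = wclass q"
proof -
  have "wclass q' = wclass q" if "x' \<in> wclass x" "y' \<in> wclass y" "is_cospan_comp x' y' q'" for x' y' q'
  proof (rule wclass_eqI)
    show "cospan_le q' q" "cospan_le q q'"
      using comp_mono assms that by (auto simp: mem_wclass)
  qed (use that comp_cospans assms in \<open>auto simp: mem_wclass\<close>)
  moreover have "x \<in> wclass x" "y \<in> wclass y" using assms cospan_le_refl by (auto simp: mem_wclass)
  ultimately have "(\<Union>x' \<in> wclass x. \<Union>y' \<in> wclass y. \<Union>q' \<in> {q'. is_cospan_comp x' y' q'}. wclass q') = wclass q"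
    using assms(1) by blast
  then show ?thesis by (simp add: W_def)
qed

lemma ten_cospans: "\<lbrakk>x \<in> cospans; y \<in> cospans\<rbrakk> \<Longrightarrow> cospan_ten x y \<in> cospans"
  by (force simp: cospans_def cospan_ten_def Pi_iff)

lemma ten_mono:
  assumes "x \<in> cospans" "y \<in> cospans" "x' \<in> cospans" "y' \<in> cospans" "cospan_le x x'" "cospan_le y y'"
  shows "cospan_le (cospan_ten x y) (cospan_ten x' y')"
proof -
  obtain h where h: "h \<in> apex x' \<rightarrow> apex x" "\<And>k. k \<in> {1..csrc x} \<Longrightarrow> h (lleg x' k) = lleg x k"
      "\<And>k. k \<in> {1..ctgt x} \<Longrightarrow> h (rleg x' k) = rleg x k" "csrc x = csrc x'" "ctgt x = ctgt x'"
    using assms(5) unfolding cospan_le_def by blast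
  obtain g where g: "g \<in> apex y' \<rightarrow> apex y" "\<And>k. k \<in> {1..csrc y} \<Longrightarrow> g (lleg y' k) = lleg y k"
      "\<And>k. k \<in> {1..ctgt y} \<Longrightarrow> g (rleg y' k) = rleg y k" "csrc y = csrc y'" "ctgt y = ctgt y'"
    using assms(6) unfolding cospan_le_def by blast
  have gl: "g (lleg y' (i - csrc x)) = lleg y (i - csrc x)" if "\<not> i \<le> csrc x" "i \<le> csrc x + csrc y" for i
    by (rule g(2)) (use that in auto)
  have gr: "g (rleg y' (i - ctgt x)) = rleg y (i - ctgt x)" if "\<not> i \<le> ctgt x" "i \<le> ctgt x + ctgt y" for i
    by (rule g(3)) (use that in auto)
  \<comment> \<open>\<open>sum_encode\<close> codes the disjoint union inside the naturals; the
    comparison map decodes, acts by \<open>h\<close> and \<open>g\<close> on the summands, and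
    encodes again.\<close>
  show ?thesis unfolding cospan_le_def
  proof (intro conjI bexI[of _ "\<lambda>n. sum_encode (map_sum h g (sum_decode n))"] ballI)
    show "(\<lambda>n. sum_encode (map_sum h g (sum_decode n))) \<in> apex (cospan_ten x' y') \<rightarrow> apex (cospan_ten x y)"
      using h(1) g(1) by (auto simp: cospan_ten_def)
    show "sum_encode (map_sum h g (sum_decode (lleg (cospan_ten x' y') i))) = lleg (cospan_ten x y) i"
      if "i \<in> {1..csrc (cospan_ten x y)}" for i
      using that h(2)[of i] h(4) gl[of i] g(4) by (auto simp: cospan_ten_def)
    show "sum_encode (map_sum h g (sum_decode (rleg (cospan_ten x' y') i))) = rleg (cospan_ten x y) i"
      if "i \<in> {1..ctgt (cospan_ten x y)}" for i
      using that h(3)[of i] h(5) gr[of i] g(5) by (auto simp: cospan_ten_def)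
  qed (use h g in \<open>simp_all add: cospan_ten_def\<close>)
qed

lemma wclass_TenA:
  assumes "x \<in> cospans" "y \<in> cospans"
  shows "wclass x \<otimes>\<^bsub>W\<^esub> wclass y = wclass (cospan_ten x y)"
proof -
  have "wclass (cospan_ten x' y') = wclass (cospan_ten x y)" if "x' \<in> wclass x" "y' \<in> wclass y" for x' y'
    by (rule wclass_eqI) (use that assms ten_cospans ten_mono in \<open>auto simp: mem_wclass\<close>)
  moreover have "x \<in> wclass x" "y \<in> wclass y" using assms cospan_le_refl by (auto simp: mem_wclass)
  ultimately have "(\<Union>x' \<in> wclass x. \<Union>y' \<in> wclass y. wclass (cospan_ten x' y')) = wclass (cospan_ten x y)"
    by blast
  then show ?thesis by (simp add: W_def)
qed

text \<open>
  A function \<open>f\<close> from \<open>{1..m}\<close> to \<open>{1..k}\<close> gives \<open>W_up k m f : k \<rightarrow> m\<close> with right adjoint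
  \<open>W_dn m k f : m \<rightarrow> k\<close>; note the reversal of direction in the left adjoint.
\<close>

definition up :: "nat \<Rightarrow> nat \<Rightarrow> (nat \<Rightarrow> nat) \<Rightarrow> cospan" where
  "up k m f = \<lparr>csrc = k, ctgt = m, apex = {1..k}, lleg = \<lambda>i. i, rleg = f\<rparr>"

definition dn :: "nat \<Rightarrow> nat \<Rightarrow> (nat \<Rightarrow> nat) \<Rightarrow> cospan" where
  "dn m k f = \<lparr>csrc = m, ctgt = k, apex = {1..k}, lleg = f, rleg = \<lambda>i. i\<rparr>"

abbreviation W_up :: "nat \<Rightarrow> nat \<Rightarrow> (nat \<Rightarrow> nat) \<Rightarrow> wmor" where
  "W_up k m f \<equiv> wclass (up k m f)"

abbreviation W_dn :: "nat \<Rightarrow> nat \<Rightarrow> (nat \<Rightarrow> nat) \<Rightarrow> wmor" where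
  "W_dn m k f \<equiv> wclass (dn m k f)"

lemma up_dn_cospans [simp]:
  "f \<in> {1..m} \<rightarrow> {1..k} \<Longrightarrow> up k m f \<in> cospans" "f \<in> {1..m} \<rightarrow> {1..k} \<Longrightarrow> dn m k f \<in> cospans"
  by (auto simp: cospans_def up_def dn_def)

lemma up_dn_simps [simp]:
  "csrc (up k m f) = k" "ctgt (up k m f) = m" "apex (up k m f) = {1..k}" "lleg (up k m f) = (\<lambda>i. i)" "rleg (up k m f) = f"
  "csrc (dn m k f) = m" "ctgt (dn m k f) = k" "apex (dn m k f) = {1..k}" "lleg (dn m k f) = f" "rleg (dn m k f) = (\<lambda>i. i)"
  by (simp_all add: up_def dn_def)

lemma W_up_hom: "f \<in> {1..m} \<rightarrow> {1..k} \<Longrightarrow> W_up k m f \<in> hom W k m"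
  unfolding hom_W by (rule bexI[of _ "up k m f"]) auto

lemma W_dn_hom: "f \<in> {1..m} \<rightarrow> {1..k} \<Longrightarrow> W_dn m k f \<in> hom W m k"
  unfolding hom_W by (rule bexI[of _ "dn m k f"]) auto

text \<open>The identity of the apex compares both cospans, since legs count only on their range.
  Tensoring produces legs defined by cases, which are simplified this way.\<close>

lemma W_up_cong:
  assumes "f \<in> {1..m} \<rightarrow> {1..k}" "\<And>i. i \<in> {1..m} \<Longrightarrow> f i = g i"
  shows "W_up k m f = W_up k m g"
proof (rule wclass_eqI)
  show "cospan_le (up k m f) (up k m g)" "cospan_le (up k m g) (up k m f)"
    using assms by (auto simp: cospan_le_def up_def intro!: bexI[of _ "\<lambda>x. x"])
  have "g \<in> {1..m} \<rightarrow> {1..k}" using assms by (auto simp: Pi_iff)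
  then show "up k m g \<in> cospans" by simp
qed (use assms in simp)

text \<open>The right leg has empty domain, hence the arbitrary \<open>f\<close>. In this shape
  \<open>W_eps\<close> falls under the results on \<open>W_up\<close>, in particular left
  adjointness.\<close>

lemma W_eps_up: "W_eps = W_up 1 0 f"
  unfolding W_eps_def
proof (rule wclass_eqI)
  show "cospan_le \<lparr>csrc = 1, ctgt = 0, apex = {1}, lleg = \<lambda>_. 1, rleg = \<lambda>_. 1\<rparr> (up 1 0 f)"
    "cospan_le (up 1 0 f) \<lparr>csrc = 1, ctgt = 0, apex = {1}, lleg = \<lambda>_. 1, rleg = \<lambda>_. 1\<rparr>"
    by (auto simp: cospan_le_def up_def intro!: bexI[of _ "\<lambda>x. x"])
qed (auto simp: cospans_def up_def)

lemma W_delta_up: "W_delta = W_up 1 2 (\<lambda>_. 1)"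
  unfolding W_delta_def
proof (rule wclass_eqI)
  show "cospan_le \<lparr>csrc = 1, ctgt = 2, apex = {1}, lleg = \<lambda>_. 1, rleg = \<lambda>_. 1\<rparr> (up 1 2 (\<lambda>_. 1))"
    "cospan_le (up 1 2 (\<lambda>_. 1)) \<lparr>csrc = 1, ctgt = 2, apex = {1}, lleg = \<lambda>_. 1, rleg = \<lambda>_. 1\<rparr>"
    by (auto simp: cospan_le_def up_def intro!: bexI[of _ "\<lambda>x. x"])
qed (auto simp: cospans_def up_def)

lemma Idn_W: "Idn W n = W_up n n (\<lambda>i. i)"
  by (simp add: W_def W_idn_def up_def)

text \<open>Pushing out along an identity leg changes nothing: the apex of \<open>x\<close> is the
  pushout, with injections the identity and \<open>rleg x\<close>, so only the right leg is
  affected.\<close>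

lemma Cmp_up:
  assumes "x \<in> cospans" "ctgt x = m" "g \<in> {1..n} \<rightarrow> {1..m}"
  shows "wclass x ;;\<^bsub>W\<^esub> W_up m n g =
    wclass \<lparr>csrc = csrc x, ctgt = n, apex = apex x, lleg = lleg x, rleg = \<lambda>i. rleg x (g i)\<rparr>"
proof (rule wclass_Cmp)
  have "is_pushout {1..m} (rleg x) (\<lambda>i. i) (apex x) {1..m} (apex x) (\<lambda>i. i) (rleg x)"
    unfolding is_pushout_def
  proof (intro conjI allI impI)
    fix Z :: "nat set" and f g
    assume *: "finite Z \<and> f \<in> apex x \<rightarrow> Z \<and> g \<in> {1..m} \<rightarrow> Z \<and> (\<forall>k \<in> {1..m}. f (rleg x k) = g k)"
    \<comment> \<open>Uniqueness in \<open>is_pushout\<close> is among functions extensional on the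
      apex, so the mediating map is \<open>f\<close> restricted to it.\<close>
    show "\<exists>!u. u \<in> apex x \<rightarrow>\<^sub>E Z \<and> (\<forall>s \<in> apex x. u s = f s) \<and> (\<forall>t \<in> {1..m}. u (rleg x t) = g t)"
    proof (rule ex1I[of _ "restrict f (apex x)"])
      show "restrict f (apex x) \<in> apex x \<rightarrow>\<^sub>E Z \<and> (\<forall>s \<in> apex x. restrict f (apex x) s = f s) \<and>
          (\<forall>t \<in> {1..m}. restrict f (apex x) (rleg x t) = g t)"
        using * assms by (auto simp: cospans_def Pi_iff)
    next
      fix u assume "u \<in> apex x \<rightarrow>\<^sub>E Z \<and> (\<forall>s \<in> apex x. u s = f s) \<and> (\<forall>t \<in> {1..m}. u (rleg x t) = g t)"
      then show "u = restrict f (apex x)"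
        by (intro ext) (auto simp: restrict_def PiE_iff extensional_def)
    qed
  qed (use assms in \<open>auto simp: cospans_def\<close>)
  then show "is_cospan_comp x (up m n g) \<lparr>csrc = csrc x, ctgt = n, apex = apex x, lleg = lleg x, rleg = \<lambda>i. rleg x (g i)\<rparr>"
    unfolding is_cospan_comp_def using assms(2)
    by (intro conjI exI[of _ "\<lambda>i. i"] exI[of _ "rleg x"]) (auto simp: up_def)
qed (use assms in auto)

lemma up_up:
  assumes "f \<in> {1..m} \<rightarrow> {1..k}" "g \<in> {1..n} \<rightarrow> {1..m}"
  shows "W_up k m f ;;\<^bsub>W\<^esub> W_up m n g = W_up k n (\<lambda>i. f (g i))"
  using Cmp_up[of "up k m f" m g n] assms up_dn_cospans(1)[OF assms(1)] by (simp add: up_def)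

text \<open>The finite apex is relabelled by \<open>{1..k}\<close> through a bijection
  \<open>b\<close>. Its left leg then defines a \<open>dn\<close>, its right leg an
  \<open>up\<close>, and \<open>b\<close> and its inverse are the two comparison maps.\<close>

lemma dn_up_eq:
  assumes "A \<in> hom W m n"
  shows "\<exists>k f g. f \<in> {1..m} \<rightarrow> {1..k} \<and> g \<in> {1..n} \<rightarrow> {1..k} \<and> A = W_dn m k f ;;\<^bsub>W\<^esub> W_up k n g"
proof -
  obtain w where w: "w \<in> cospans" "csrc w = m" "ctgt w = n" "A = wclass w" using assms by (auto simp: hom_W)
  define k where "k = card (apex w)"
  have fin: "finite (apex w)" using w by (simp add: cospans_def)
  then obtain b where b: "bij_betw b (apex w) {1..k}"
    using ex_bij_betw_finite_nat ex_bij_betw_nat_finite_1 bij_betw_inv unfolding k_def by metis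
  let ?c = "inv_into (apex w) b"
  have c: "?c \<in> {1..k} \<rightarrow> apex w" "\<And>x. x \<in> apex w \<Longrightarrow> ?c (b x) = x" "b \<in> apex w \<rightarrow> {1..k}"
    using b by (auto simp: bij_betw_def inv_into_into)
  have f: "(\<lambda>i. b (lleg w i)) \<in> {1..m} \<rightarrow> {1..k}" and g: "(\<lambda>i. b (rleg w i)) \<in> {1..n} \<rightarrow> {1..k}"
    using w c by (auto simp: cospans_def Pi_iff)
  have eq: "W_dn m k (\<lambda>i. b (lleg w i)) ;;\<^bsub>W\<^esub> W_up k n (\<lambda>i. b (rleg w i)) =
      wclass \<lparr>csrc = m, ctgt = n, apex = {1..k}, lleg = \<lambda>i. b (lleg w i), rleg = \<lambda>i. b (rleg w i)\<rparr>" (is "_ = wclass ?v")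
    using Cmp_up[OF up_dn_cospans(2)[OF f] _ g] by (simp add: dn_def)
  have "A = wclass ?v" unfolding w(4)
  proof (rule wclass_eqI)
    show "?v \<in> cospans" using f g by (auto simp: cospans_def)
    have l: "lleg w i \<in> apex w" if "i \<in> {1..m}" for i using w that by (auto simp: cospans_def Pi_iff)
    have r: "rleg w i \<in> apex w" if "i \<in> {1..n}" for i using w that by (auto simp: cospans_def Pi_iff)
    show "cospan_le w ?v" unfolding cospan_le_def
      by (intro conjI bexI[of _ ?c]) (use w c l r in auto)
    show "cospan_le ?v w" unfolding cospan_le_def
      by (intro conjI bexI[of _ b]) (use w c in auto)
  qed (use w in auto)
  then show ?thesis using f g eq by metis
qed

text \<open>Counit of the adjunction between \<open>W_up\<close> and \<open>W_dn\<close>: the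
  composite is the cospan with both legs \<open>f\<close>, and \<open>f\<close> itself is the
  comparison map out of the apex of the identity.\<close>

lemma dn_up_le:
  assumes f: "f \<in> {1..m} \<rightarrow> {1..k}"
  shows "W_dn m k f ;;\<^bsub>W\<^esub> W_up k m f \<in> hom W m m" "Leq W (W_dn m k f ;;\<^bsub>W\<^esub> W_up k m f) (Idn W m)"
proof -
  let ?v = "\<lparr>csrc = m, ctgt = m, apex = {1..k}, lleg = f, rleg = f\<rparr>"
  have v: "?v \<in> cospans" using f by (auto simp: cospans_def)
  have eq: "W_dn m k f ;;\<^bsub>W\<^esub> W_up k m f = wclass ?v"
    using Cmp_up[OF up_dn_cospans(2)[OF f] _ f] by (simp add: dn_def)
  have "cospan_le ?v (up m m (\<lambda>i. i))" unfolding cospan_le_def up_def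
    by (intro conjI bexI[of _ f]) (use f in auto)
  then show "Leq W (W_dn m k f ;;\<^bsub>W\<^esub> W_up k m f) (Idn W m)"
    unfolding eq Idn_W using v by (subst wclass_Leq) auto
  show "W_dn m k f ;;\<^bsub>W\<^esub> W_up k m f \<in> hom W m m"
    unfolding eq hom_W using v by force
qed

text \<open>The pushout of \<open>f\<close> along itself consists of two copies of \<open>{1..k}\<close>, glued along the image of \<open>f\<close>.\<close>

lemma up_dn_le:
  assumes f: "f \<in> {1..m} \<rightarrow> {1..k}"
  shows "W_up k m f ;;\<^bsub>W\<^esub> W_dn m k f \<in> hom W k k" "Leq W (Idn W k) (W_up k m f ;;\<^bsub>W\<^esub> W_dn m k f)"
proof -
  let ?R = "f ` {1..m}"
  let ?j = "\<lambda>s. if s \<in> ?R then s else k + s"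
  let ?v = "\<lparr>csrc = k, ctgt = k, apex = {1..k} \<union> ?j ` {1..k}, lleg = \<lambda>i. i, rleg = ?j\<rparr>"
  have R: "?R \<subseteq> {1..k}" using f by auto
  have v: "?v \<in> cospans" by (auto simp: cospans_def)
  have po: "is_pushout {1..m} f f {1..k} {1..k} (apex ?v) (\<lambda>i. i) ?j"
    unfolding is_pushout_def
  proof (intro conjI allI impI)
    fix Z :: "nat set" and p q
    assume *: "finite Z \<and> p \<in> {1..k} \<rightarrow> Z \<and> q \<in> {1..k} \<rightarrow> Z \<and> (\<forall>i \<in> {1..m}. p (f i) = q (f i))"
    \<comment> \<open>Points of the second copy have the form \<open>k + s\<close> with
      \<open>s \<ge> 1\<close>, so \<open>s \<le> k\<close> tells the copies apart. Glued points lie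
      in the first copy, where \<open>p\<close> and \<open>q\<close> agree.\<close>
    let ?u = "\<lambda>s \<in> apex ?v. if s \<le> k then p s else q (s - k)"
    show "\<exists>!u. u \<in> apex ?v \<rightarrow>\<^sub>E Z \<and> (\<forall>s \<in> {1..k}. u s = p s) \<and> (\<forall>t \<in> {1..k}. u (?j t) = q t)"
    proof (rule ex1I[of _ ?u])
      have "?u s \<in> Z" if "s \<in> apex ?v" for s
      proof (cases "s \<le> k")
        case True
        then have "s \<in> {1..k}" using that by auto
        then show ?thesis using * True by auto
      next
        case False
        then have "s - k \<in> {1..k}" using that by (auto split: if_splits)
        then have "q (s - k) \<in> Z" using * by blast
        then show ?thesis using False that by simp
      qed
      then have "?u \<in> apex ?v \<rightarrow>\<^sub>E Z" by (auto simp: PiE_iff simp del: restrict_apply)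
      moreover have "?u s = p s" if "s \<in> {1..k}" for s using that by auto
      moreover have "?u (?j t) = q t" if "t \<in> {1..k}" for t
        using that * by auto
      ultimately show "?u \<in> apex ?v \<rightarrow>\<^sub>E Z \<and> (\<forall>s \<in> {1..k}. ?u s = p s) \<and> (\<forall>t \<in> {1..k}. ?u (?j t) = q t)" by blast
    next
      fix u assume u: "u \<in> apex ?v \<rightarrow>\<^sub>E Z \<and> (\<forall>s \<in> {1..k}. u s = p s) \<and> (\<forall>t \<in> {1..k}. u (?j t) = q t)"
      show "u = ?u"
      proof (rule extensionalityI[of _ "apex ?v"])
        fix s assume s: "s \<in> apex ?v"
        show "u s = ?u s"
        proof (cases "s \<in> {1..k}")
          case True
          then show ?thesis using u by simp
        next
          case False
          have "s \<in> {1..k} \<union> ?j ` {1..k}" using s by (simp only: cospan.simps)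
          then obtain t where t: "t \<in> {1..k}" "s = ?j t" using False by blast
          then have "u s = q t" using u by blast
          then show ?thesis using t False by (auto split: if_splits)
        qed
      qed (use u in \<open>auto simp: PiE_iff\<close>)
    qed
  qed auto
  then have comp: "is_cospan_comp (up k m f) (dn m k f) ?v"
    unfolding is_cospan_comp_def
    by (intro conjI exI[of _ "\<lambda>i. i"] exI[of _ ?j]) (auto simp: up_def dn_def)
  have eq: "W_up k m f ;;\<^bsub>W\<^esub> W_dn m k f = wclass ?v"
    by (rule wclass_Cmp[OF comp]) (use f in auto)
  \<comment> \<open>The codiagonal is the comparison map: it folds the second copy back onto the
    first.\<close>
  have "cospan_le (up k k (\<lambda>i. i)) ?v" unfolding cospan_le_def up_def
    by (intro conjI bexI[of _ "\<lambda>s. if s \<le> k then s else s - k"]) (use R in auto)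
  then show "Leq W (Idn W k) (W_up k m f ;;\<^bsub>W\<^esub> W_dn m k f)"
    unfolding eq Idn_W using v by (subst wclass_Leq) auto
  show "W_up k m f ;;\<^bsub>W\<^esub> W_dn m k f \<in> hom W k k"
    unfolding eq hom_W using v by force
qed

text \<open>The coded disjoint union of apexes is identified with \<open>{1..k + k'}\<close> by
  keeping the left summand and shifting the right one by \<open>k\<close>; this and its inverse are
  the comparison maps.\<close>

lemma up_TenA:
  assumes "f \<in> {1..m} \<rightarrow> {1..k}" "f' \<in> {1..m'} \<rightarrow> {1..k'}"
  shows "W_up k m f \<otimes>\<^bsub>W\<^esub> W_up k' m' f' = W_up (k + k') (m + m') (\<lambda>i. if i \<le> m then f i else k + f' (i - m))"
proof -
  let ?g = "\<lambda>i. if i \<le> m then f i else k + f' (i - m)"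
  have g: "?g \<in> {1..m + m'} \<rightarrow> {1..k + k'}"
  proof
    fix i assume i: "i \<in> {1..m + m'}"
    show "?g i \<in> {1..k + k'}"
    proof (cases "i \<le> m")
      case True
      then have "f i \<in> {1..k}" using assms(1) i by auto
      then show ?thesis using True by auto
    next
      case False
      then have "i - m \<in> {1..m'}" using i by auto
      then have "f' (i - m) \<in> {1..k'}" using assms(2) by blast
      then show ?thesis using False by auto
    qed
  qed
  have "W_up k m f \<otimes>\<^bsub>W\<^esub> W_up k' m' f' = wclass (cospan_ten (up k m f) (up k' m' f'))"
    using assms by (simp add: wclass_TenA)
  also have "\<dots> = W_up (k + k') (m + m') ?g"
  proof (rule wclass_eqI)
    show "cospan_le (cospan_ten (up k m f) (up k' m' f')) (up (k + k') (m + m') ?g)"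
      unfolding cospan_le_def
    proof (intro conjI ballI bexI[of _ "\<lambda>n. sum_encode (if n \<le> k then Inl n else Inr (n - k))"])
      show "(\<lambda>n. sum_encode (if n \<le> k then Inl n else Inr (n - k))) \<in>
          apex (up (k + k') (m + m') ?g) \<rightarrow> apex (cospan_ten (up k m f) (up k' m' f'))"
        by (auto simp: cospan_ten_def intro!: imageI) arith+
      have fk: "f i \<le> k" if "1 \<le> i" "i \<le> m" for i using assms(1) that by auto
      have f'k: "1 \<le> f' (i - m)" if "m < i" "i \<le> m + m'" for i
      proof -
        have "i - m \<in> {1..m'}" using that by auto
        then have "f' (i - m) \<in> {1..k'}" using assms(2) by blast
        then show ?thesis by simp
      qed
      show "sum_encode (if rleg (up (k + k') (m + m') ?g) j \<le> k then Inl (rleg (up (k + k') (m + m') ?g) j)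
           else Inr (rleg (up (k + k') (m + m') ?g) j - k)) =
         rleg (cospan_ten (up k m f) (up k' m' f')) j"
        if "j \<in> {1..ctgt (cospan_ten (up k m f) (up k' m' f'))}" for j
        using that fk[of j] f'k[of j] by (auto simp: cospan_ten_def)
    qed (auto simp: cospan_ten_def)
    show "cospan_le (up (k + k') (m + m') ?g) (cospan_ten (up k m f) (up k' m' f'))"
      unfolding cospan_le_def
      by (intro conjI bexI[of _ "\<lambda>n. case_sum (\<lambda>s. s) (\<lambda>s. k + s) (sum_decode n)"])
        (auto simp: cospan_ten_def)
  qed (use assms g in \<open>auto simp: ten_cospans\<close>)
  finally show ?thesis .
qed

section \<open>Supplies\<close>

lemma tpow_1 [simp]: "tpow C c 1 = c" "tpow C c 2 = c \<odot>\<^bsub>C\<^esub> c"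
  by (simp_all add: One_nat_def numeral_2_eq_2)

lemma W_eps_hom: "W_eps \<in> hom W 1 0"
  unfolding W_eps_up[of "\<lambda>i. i"] by (rule W_up_hom) simp

lemma W_delta_hom: "W_delta \<in> hom W 1 2"
  unfolding W_delta_up by (rule W_up_hom) simp

context supplies_W
begin

lemma Supply_hom: "\<lbrakk>c \<in> Obj C; w \<in> hom W m n\<rbrakk> \<Longrightarrow> Supply C c w \<in> hom C (tpow C c m) (tpow C c n)"
  using strong_smpofunctor.FA_in[OF supply_strong, of c w m n] by (simp add: supply_fun_def)

lemma Supply_Idn: "c \<in> Obj C \<Longrightarrow> Supply C c (Idn W n) = Idn C (tpow C c n)"
  using strong_smpofunctor.FA_Idn[OF supply_strong, of c n] by (simp add: supply_fun_def W_def)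

lemma Supply_Cmp: "\<lbrakk>c \<in> Obj C; v \<in> hom W l m; w \<in> hom W m n\<rbrakk>
    \<Longrightarrow> Supply C c (v ;;\<^bsub>W\<^esub> w) = Supply C c v ;; Supply C c w"
  using strong_smpofunctor.FA_Cmp[OF supply_strong, of c v l m w n] by (simp add: supply_fun_def)

lemma Supply_mono: "\<lbrakk>c \<in> Obj C; v \<in> hom W m n; w \<in> hom W m n; Leq W v w\<rbrakk> \<Longrightarrow> Supply C c v \<sqsubseteq> Supply C c w"
  using strong_smpofunctor.FA_mono[OF supply_strong, of c m n] by (simp add: supply_fun_def monotone_on_def)

lemma Supply_TenA: "\<lbrakk>c \<in> Obj C; v \<in> hom W m n; w \<in> hom W m' n'\<rbrakk>
    \<Longrightarrow> (Supply C c v \<otimes> Supply C c w) ;; tpow_add C c n n' = tpow_add C c m m' ;; Supply C c (v \<otimes>\<^bsub>W\<^esub> w)"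
  using strong_smpofunctor.FM_nat[OF supply_strong, of c v m n w m' n'] by (simp add: supply_fun_def)

lemma Supply_simps:
  assumes "c \<in> Obj C" "w \<in> hom W m n"
  shows "Supply C c w \<in> Arr C" "Dom C (Supply C c w) = tpow C c m" "Cod C (Supply C c w) = tpow C c n"
  using Supply_hom[OF assms] by (simp_all add: hom_def)

abbreviation eps :: "'o \<Rightarrow> 'a" where "eps c \<equiv> Supply C c W_eps"
abbreviation delta :: "'o \<Rightarrow> 'a" where "delta c \<equiv> Supply C c W_delta"

lemma eps_simps [simp]: "c \<in> Obj C \<Longrightarrow> eps c \<in> Arr C" "c \<in> Obj C \<Longrightarrow> Dom C (eps c) = c"
    "c \<in> Obj C \<Longrightarrow> Cod C (eps c) = Unit C"
  using Supply_simps[OF _ W_eps_hom, of c] by simp_all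

lemma delta_simps [simp]: "c \<in> Obj C \<Longrightarrow> delta c \<in> Arr C" "c \<in> Obj C \<Longrightarrow> Dom C (delta c) = c"
    "c \<in> Obj C \<Longrightarrow> Cod C (delta c) = c \<odot> c"
  using Supply_simps[OF _ W_delta_hom, of c] by simp_all

lemma eps_Unit: "eps (Unit C) = Idn C (Unit C)"
  using supply_Unit[OF W_eps_hom] by (simp add: One_nat_def)

text \<open>At arity 2 \<open>tpow_unit\<close> is the inverse unitor, followed only by identities,
  while at arity 1 it is an identity.\<close>

lemma delta_Unit: "delta (Unit C) = inverse_of C (LUnit C (Unit C))"
  using supply_Unit[OF W_delta_hom] by (simp add: numeral_2_eq_2 One_nat_def TenA_Idn)

text \<open>The adjunction lives in \<open>W\<close>, with unit \<open>up_dn_le\<close> and counit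
  \<open>dn_up_le\<close>; the po-functor given by the supply transports it.\<close>

lemma ladj_Supply_up:
  assumes c: "c \<in> Obj C" and f: "f \<in> {1..m} \<rightarrow> {1..k}"
  shows "ladj (Supply C c (W_up k m f)) (Supply C c (W_dn m k f))"
proof -
  note u = W_up_hom[OF f] and d = W_dn_hom[OF f]
  have id: "Idn W n \<in> hom W n n" for n
    unfolding Idn_W by (rule W_up_hom) simp
  have "Idn C (tpow C c k) \<sqsubseteq> Supply C c (W_up k m f) ;; Supply C c (W_dn m k f)"
    using Supply_mono[OF c id up_dn_le(1)[OF f] up_dn_le(2)[OF f]] by (simp add: Supply_Idn c Supply_Cmp[OF c u d])
  moreover have "Supply C c (W_dn m k f) ;; Supply C c (W_up k m f) \<sqsubseteq> Idn C (tpow C c m)"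
    using Supply_mono[OF c dn_up_le(1)[OF f] id dn_up_le(2)[OF f]] by (simp add: Supply_Idn c Supply_Cmp[OF c d u])
  ultimately show ?thesis
    by (simp add: ladj_def hom_def Supply_simps[OF c u] Supply_simps[OF c d])
qed

lemma left_adjoint_Supply_up: "\<lbrakk>c \<in> Obj C; f \<in> {1..m} \<rightarrow> {1..k}\<rbrakk> \<Longrightarrow> left_adjoint (Supply C c (W_up k m f))"
  unfolding left_adjoint_def using ladj_Supply_up by blast

lemma left_adjoint_eps: "c \<in> Obj C \<Longrightarrow> left_adjoint (eps c)"
  unfolding W_eps_up[of "\<lambda>i. i"] by (rule left_adjoint_Supply_up) auto

section \<open>Projections of a tensor product\<close>

text \<open>Discard one factor, then absorb the unit. These are the product projections for the
  cartesian structure that appears on left adjoints in the prerelational case.\<close>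

definition pr1 :: "'o \<Rightarrow> 'o \<Rightarrow> 'a" where "pr1 y z = (Idn C y \<otimes> eps z) ;; RUnit C y"
definition pr2 :: "'o \<Rightarrow> 'o \<Rightarrow> 'a" where "pr2 y z = (eps y \<otimes> Idn C z) ;; LUnit C z"

lemma pr_simps [simp]:
  assumes "y \<in> Obj C" "z \<in> Obj C"
  shows "pr1 y z \<in> Arr C" "Dom C (pr1 y z) = y \<odot> z" "Cod C (pr1 y z) = y"
    "pr2 y z \<in> Arr C" "Dom C (pr2 y z) = y \<odot> z" "Cod C (pr2 y z) = z"
  using assms by (simp_all add: pr1_def pr2_def)

lemma left_adjoint_pr: "\<lbrakk>y \<in> Obj C; z \<in> Obj C\<rbrakk> \<Longrightarrow> left_adjoint (pr1 y z)"
    "\<lbrakk>y \<in> Obj C; z \<in> Obj C\<rbrakk> \<Longrightarrow> left_adjoint (pr2 y z)"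
  unfolding pr1_def pr2_def
  by (intro left_adjoint_Cmp left_adjoint_TenA left_adjoint_eps; simp add: left_adjoint_iso)+

text \<open>Powers are bracketed to the left, so an earlier coordinate is read off the first
  \<open>n + 1\<close> factors while the last one is discarded. Of the strongators in the tensor
  rule, the source one is an identity and the target one is \<open>RUnit\<close>.\<close>

lemma proj_old:
  assumes c: "c \<in> Obj C" and i: "i \<in> {1..Suc n}"
  shows "Supply C c (W_up (Suc (Suc n)) 1 (\<lambda>_. i)) = (Supply C c (W_up (Suc n) 1 (\<lambda>_. i)) \<otimes> eps c) ;; RUnit C c"
proof -
  have p: "(\<lambda>_. i) \<in> {1..1::nat} \<rightarrow> {1..Suc n}" "(\<lambda>_. i) \<in> {1..1::nat} \<rightarrow> {1..Suc (Suc n)}" using i by auto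
  have "W_up (Suc n) 1 (\<lambda>_. i) \<otimes>\<^bsub>W\<^esub> W_eps = W_up (Suc (Suc n)) 1 (\<lambda>_. i)"
  proof -
    have e: "Suc n + 1 = Suc (Suc n)" by simp
    have "W_up (Suc n) 1 (\<lambda>_. i) \<otimes>\<^bsub>W\<^esub> W_eps = W_up (Suc n + 1) (1 + 0) (\<lambda>j. if j \<le> 1 then i else Suc n + (j - 1))"
      unfolding W_eps_up[of "\<lambda>i. i"] by (rule up_TenA[OF p(1)]) simp
    also have "\<dots> = W_up (Suc (Suc n)) 1 (\<lambda>_. i)"
      unfolding e using W_up_cong[OF p(2), of "\<lambda>j. if j \<le> 1 then i else Suc n + (j - 1)"] by simp
    finally show ?thesis .
  qed
  then show ?thesis
    using Supply_TenA[OF c W_up_hom[OF p(1)] W_eps_hom] Supply_simps[OF c W_up_hom[OF p(2)]]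
    by (simp add: One_nat_def)
qed

text \<open>The counterpart of \<open>proj_old\<close> for the last coordinate: the first
  \<open>n + 1\<close> factors are discarded at once, and the target strongator
  \<open>tpow_add c 0 1\<close> is \<open>LUnit\<close>.\<close>

lemma proj_new:
  assumes c: "c \<in> Obj C"
  shows "Supply C c (W_up (Suc (Suc n)) 1 (\<lambda>_. Suc (Suc n))) = (Supply C c (W_up (Suc n) 0 (\<lambda>i. i)) \<otimes> Idn C c) ;; LUnit C c"
proof -
  have p: "(\<lambda>_. Suc (Suc n)) \<in> {1..1::nat} \<rightarrow> {1..Suc (Suc n)}" "(\<lambda>i. i) \<in> {1..0} \<rightarrow> {1..Suc n}" by auto
  have id: "Idn W 1 \<in> hom W 1 1" unfolding Idn_W by (rule W_up_hom) simp
  have "W_up (Suc n) 0 (\<lambda>i. i) \<otimes>\<^bsub>W\<^esub> Idn W 1 = W_up (Suc (Suc n)) 1 (\<lambda>_. Suc (Suc n))"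
  proof -
    have e: "Suc n + 1 = Suc (Suc n)" by simp
    have "W_up (Suc n) 0 (\<lambda>i. i) \<otimes>\<^bsub>W\<^esub> Idn W 1 = W_up (Suc n + 1) (0 + 1) (\<lambda>j. if j \<le> 0 then j else Suc n + (j - 0))"
      unfolding Idn_W by (rule up_TenA[OF p(2)]) simp
    also have "\<dots> = W_up (Suc (Suc n)) 1 (\<lambda>_. Suc (Suc n))"
      unfolding e using W_up_cong[OF p(1), of "\<lambda>j. if j \<le> 0 then j else Suc n + (j - 0)"] by simp
    finally show ?thesis .
  qed
  then show ?thesis
    using Supply_TenA[OF c W_up_hom[OF p(2)] id] Supply_simps[OF c W_up_hom[OF p(1)]] c
    by (simp add: Supply_Idn) (simp add: One_nat_def)
qed

lemma proj_1: "c \<in> Obj C \<Longrightarrow> Supply C c (W_up 1 1 (\<lambda>_. 1)) = Idn C c"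
proof -
  have "W_up 1 1 (\<lambda>_. 1) = Idn W 1"
    unfolding Idn_W by (rule W_up_cong) auto
  then show "c \<in> Obj C \<Longrightarrow> ?thesis" using Supply_Idn[of c 1] by simp
qed

text \<open>In \<open>W\<close> both equations say that a function from a point to two points and
  back is the identity; \<open>proj_old\<close> and \<open>proj_new\<close> at \<open>n = 0\<close>
  recognise \<open>pr1\<close> and \<open>pr2\<close> as the supplied coordinates.\<close>

lemma counit:
  assumes c: "c \<in> Obj C"
  shows "delta c ;; pr1 c c = Idn C c" "delta c ;; pr2 c c = Idn C c"
proof -
  have p: "(\<lambda>_. i) \<in> {1..1::nat} \<rightarrow> {1..2}" if "i \<in> {1,2}" for i :: nat using that by auto
  have d: "(\<lambda>_. 1) \<in> {1..2} \<rightarrow> {1..1::nat}" by simp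
  have *: "delta c ;; Supply C c (W_up 2 1 (\<lambda>_. i)) = Idn C c" if "i \<in> {1,2}" for i
    using Supply_Cmp[OF c W_up_hom[OF d] W_up_hom[OF p[OF that]]] up_up[OF d p[OF that]] proj_1[OF c]
    by (simp add: W_delta_up)
  show "delta c ;; pr1 c c = Idn C c"
    using *[of 1] proj_old[OF c, of 1 0] proj_1[OF c] by (simp add: pr1_def numeral_2_eq_2 One_nat_def)
  show "delta c ;; pr2 c c = Idn C c"
    using *[of 2] proj_new[OF c, of 0] by (simp add: pr2_def numeral_2_eq_2 One_nat_def W_eps_up[of "\<lambda>i. i"])
qed

lemma delta_TenO:
  assumes "y \<in> Obj C" "z \<in> Obj C"
  shows "delta (y \<odot> z) = (delta y \<otimes> delta z) ;; mid4 C y y z z"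
  using supply_TenO[OF W_delta_hom, of y z] assms by (simp add: numeral_2_eq_2 One_nat_def TenA_Idn)

text \<open>\<open>delta\<close> of a tensor is the tensor of the \<open>delta\<close> maps followed
  by \<open>mid4\<close>. Naturality moves \<open>mid4\<close> past the discards, where it is
  trivial, and the counit laws for \<open>y\<close> and \<open>z\<close> remain.\<close>

lemma delta_pr:
  assumes y: "y \<in> Obj C" and z: "z \<in> Obj C"
  shows "delta (y \<odot> z) ;; (pr1 y z \<otimes> pr2 y z) = Idn C (y \<odot> z)"
proof -
  have "pr1 y z \<otimes> pr2 y z = ((Idn C y \<otimes> eps z) \<otimes> (eps y \<otimes> Idn C z)) ;; (RUnit C y \<otimes> LUnit C z)"
    using y z by (simp add: exchange pr1_def pr2_def)
  then have "delta (y \<odot> z) ;; (pr1 y z \<otimes> pr2 y z)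
      = (delta y \<otimes> delta z) ;; ((mid4 C y y z z ;; ((Idn C y \<otimes> eps z) \<otimes> (eps y \<otimes> Idn C z))) ;; (RUnit C y \<otimes> LUnit C z))"
    using y z by (simp add: delta_TenO assoc)
  also have "mid4 C y y z z ;; ((Idn C y \<otimes> eps z) \<otimes> (eps y \<otimes> Idn C z))
      = ((Idn C y \<otimes> eps y) \<otimes> (eps z \<otimes> Idn C z)) ;; mid4 C y (Unit C) (Unit C) z"
    by (rule mid4_natural[symmetric]) (use y z in \<open>simp_all add: hom_def\<close>)
  also have "\<dots> = (Idn C y \<otimes> eps y) \<otimes> (eps z \<otimes> Idn C z)"
    using y z by (simp add: mid4_Unit)
  also have "(delta y \<otimes> delta z) ;; (((Idn C y \<otimes> eps y) \<otimes> (eps z \<otimes> Idn C z)) ;; (RUnit C y \<otimes> LUnit C z))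
      = (delta y ;; pr1 y y) \<otimes> (delta z ;; pr2 z z)"
    using y z by (simp add: exchange pr1_def pr2_def)
  finally show ?thesis using y z by (simp add: counit TenA_Idn)
qed

text \<open>The discarded component has to commute with \<open>eps\<close>; the component that is
  kept slides past the unitor.\<close>

lemma pr1_natural:
  assumes "f \<in> hom C y y'" "g \<in> hom C z z'" "g ;; eps z' = eps z"
  shows "(f \<otimes> g) ;; pr1 y' z' = pr1 y z ;; f"
proof -
  have ob: "y \<in> Obj C" "y' \<in> Obj C" "z \<in> Obj C" "z' \<in> Obj C" using assms hom_obj by blast+
  have ar: "f \<in> Arr C" "g \<in> Arr C" "Dom C f = y" "Cod C f = y'" "Dom C g = z" "Cod C g = z'" using assms by (auto simp: hom_def)
  have "(f \<otimes> g) ;; pr1 y' z' = ((Idn C y ;; f) \<otimes> (eps z ;; Idn C (Unit C))) ;; RUnit C y'"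
    using ob ar assms(3) by (simp add: pr1_def exchange_assoc)
  also have "\<dots> = (Idn C y \<otimes> eps z) ;; ((f \<otimes> Idn C (Unit C)) ;; RUnit C y')"
    using ob ar by (subst exchange[symmetric]) (simp_all add: assoc)
  also have "\<dots> = pr1 y z ;; f"
    using ob ar by (simp add: RUnit_natural pr1_def assoc)
  finally show ?thesis .
qed

lemma pr2_natural:
  assumes "f \<in> hom C y y'" "g \<in> hom C z z'" "f ;; eps y' = eps y"
  shows "(f \<otimes> g) ;; pr2 y' z' = pr2 y z ;; g"
proof -
  have ob: "y \<in> Obj C" "y' \<in> Obj C" "z \<in> Obj C" "z' \<in> Obj C" using assms hom_obj by blast+
  have ar: "f \<in> Arr C" "g \<in> Arr C" "Dom C f = y" "Cod C f = y'" "Dom C g = z" "Cod C g = z'" using assms by (auto simp: hom_def)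
  have "(f \<otimes> g) ;; pr2 y' z' = ((eps y ;; Idn C (Unit C)) \<otimes> (Idn C z ;; g)) ;; LUnit C z'"
    using ob ar assms(3) by (simp add: pr2_def exchange_assoc)
  also have "\<dots> = (eps y \<otimes> Idn C z) ;; ((Idn C (Unit C) \<otimes> g) ;; LUnit C z')"
    using ob ar by (subst exchange[symmetric]) (simp_all add: assoc)
  also have "\<dots> = pr2 y z ;; g"
    using ob ar by (simp add: LUnit_natural pr2_def assoc)
  finally show ?thesis .
qed

end

section \<open>Left adjoints in prerelational po-categories\<close>

context prerelational
begin

text \<open>Lax naturality of \<open>eps\<close>, which is the identity at I. The identity is thus
  the top endomorphism of I, as the unit laxator must be to have a left adjoint.\<close>

lemma Unit_endo_le: "f \<in> hom C (Unit C) (Unit C) \<Longrightarrow> f \<sqsubseteq> Idn C (Unit C)"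
  using lax_eps[of f "Unit C" "Unit C"] by (simp add: eps_Unit hom_def)

text \<open>\<open>eps a \<le> f ;; g ;; eps a \<le> f ;; eps b\<close> by the unit of the
  adjunction and the axiom at the right adjoint \<open>g\<close>; the axiom at \<open>f\<close> is
  the converse.\<close>

lemma left_adjoint_eps_eq:
  assumes "left_adjoint f"
  shows "f ;; eps (Cod C f) = eps (Dom C f)"
proof -
  obtain g where adj: "ladj f g" using assms by (auto simp: left_adjoint_def)
  define a b where [simp]: "a = Dom C f" "b = Cod C f"
  have f: "f \<in> Arr C" "g \<in> Arr C" "Dom C g = b" "Cod C g = a" and le: "Idn C a \<sqsubseteq> f ;; g"
    using adj by (auto simp: ladj_def hom_def)
  have ob: "a \<in> Obj C" "b \<in> Obj C" using f Dom_in Cod_in by auto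
  have "Idn C a ;; eps a \<sqsubseteq> (f ;; g) ;; eps a"
    by (rule Cmp_mono_left[OF le, of a a _ "Unit C"]) (use f ob in \<open>auto simp: hom_def\<close>)
  then have 1: "eps a \<sqsubseteq> f ;; (g ;; eps a)" using f ob by (simp add: assoc)
  have 2: "f ;; (g ;; eps a) \<sqsubseteq> f ;; eps b"
    by (rule Cmp_mono_right[OF lax_eps[of g b a], of _ a b "Unit C"]) (use f ob in \<open>auto simp: hom_def\<close>)
  have 3: "f ;; eps b \<sqsubseteq> eps a"
    by (rule lax_eps) (use f in \<open>auto simp: hom_def\<close>)
  have "eps a \<sqsubseteq> f ;; eps b"
    by (rule Leq_trans[OF 1 2, of a "Unit C"]) (use f ob in \<open>auto simp: hom_def\<close>)
  with 3 show ?thesis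
    using Leq_antisym[OF 3, of a "Unit C"] f ob by (simp add: hom_def)
qed

text \<open>Makes I terminal among left adjoints; this is how arrows into I are identified from here
  on.\<close>

lemma left_adjoint_Unit: "\<lbrakk>left_adjoint f; Cod C f = Unit C\<rbrakk> \<Longrightarrow> f = eps (Dom C f)"
  using left_adjoint_eps_eq[of f] by (simp add: eps_Unit left_adjoint_Arr)

text \<open>\<open>delta a ;; (f \<otimes> f) \<le> f ;; g ;; delta a ;; (f \<otimes> f) \<le> f ;;
  delta b ;; (g ;; f \<otimes> g ;; f) \<le> f ;; delta b\<close>, by the unit, the axiom at
  \<open>g\<close> and the counit in both factors.\<close>

lemma left_adjoint_delta_eq:
  assumes "left_adjoint f"
  shows "f ;; delta (Cod C f) = delta (Dom C f) ;; (f \<otimes> f)"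
proof -
  obtain g where adj: "ladj f g" using assms by (auto simp: left_adjoint_def)
  define a b where [simp]: "a = Dom C f" "b = Cod C f"
  have f: "f \<in> Arr C" "g \<in> Arr C" "Dom C g = b" "Cod C g = a"
    and le: "Idn C a \<sqsubseteq> f ;; g" "g ;; f \<sqsubseteq> Idn C b"
    using adj by (auto simp: ladj_def hom_def)
  have ob: "a \<in> Obj C" "b \<in> Obj C" using f Dom_in Cod_in by auto
  let ?d = "delta a ;; (f \<otimes> f)"
  have "Idn C a ;; ?d \<sqsubseteq> (f ;; g) ;; ?d"
    by (rule Cmp_mono_left[OF le(1), of a a _ "b \<odot> b"]) (use f ob in \<open>auto simp: hom_def\<close>)
  then have 1: "?d \<sqsubseteq> f ;; ((g ;; delta a) ;; (f \<otimes> f))" using f ob by (simp add: assoc)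
  have "(g ;; delta a) ;; (f \<otimes> f) \<sqsubseteq> (delta b ;; (g \<otimes> g)) ;; (f \<otimes> f)"
    by (rule Cmp_mono_left[OF lax_delta[of g b a], of b "a \<odot> a" _ "b \<odot> b"]) (use f ob in \<open>auto simp: hom_def\<close>)
  moreover have "(delta b ;; (g \<otimes> g)) ;; (f \<otimes> f) = delta b ;; ((g ;; f) \<otimes> (g ;; f))"
    using f ob by (simp add: assoc exchange)
  moreover have "(g ;; f) \<otimes> (g ;; f) \<sqsubseteq> Idn C b \<otimes> Idn C b"
    by (rule TenA_mono[OF _ _ _ _ le(2) le(2), of b b b b]) (use f ob in \<open>auto simp: hom_def\<close>)
  then have "delta b ;; ((g ;; f) \<otimes> (g ;; f)) \<sqsubseteq> delta b ;; (Idn C b \<otimes> Idn C b)"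
    by (rule Cmp_mono_right[of _ _ _ b "b \<odot> b" "b \<odot> b"]) (use f ob in \<open>auto simp: hom_def\<close>)
  then have "delta b ;; ((g ;; f) \<otimes> (g ;; f)) \<sqsubseteq> delta b" using ob by (simp add: TenA_Idn)
  ultimately have "(g ;; delta a) ;; (f \<otimes> f) \<sqsubseteq> delta b"
    using Leq_trans[of "(g ;; delta a) ;; (f \<otimes> f)" "delta b ;; ((g ;; f) \<otimes> (g ;; f))" "delta b" b "b \<odot> b"] f ob
    by (simp add: hom_def)
  then have "f ;; ((g ;; delta a) ;; (f \<otimes> f)) \<sqsubseteq> f ;; delta b"
    by (rule Cmp_mono_right[of _ _ _ a b "b \<odot> b"]) (use f ob in \<open>auto simp: hom_def\<close>)
  then have "?d \<sqsubseteq> f ;; delta b"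
    by (rule Leq_trans[OF 1, of _ a "b \<odot> b"]) (use f ob in \<open>auto simp: hom_def\<close>)
  moreover have "f ;; delta b \<sqsubseteq> ?d"
    by (rule lax_delta) (use f in \<open>auto simp: hom_def\<close>)
  ultimately show ?thesis
    using Leq_antisym[of "f ;; delta b" ?d a "b \<odot> b"] f ob by (simp add: hom_def)
qed

text \<open>Inserting \<open>delta_pr\<close> after a left adjoint \<open>w\<close> and letting
  \<open>w\<close> pass \<open>delta\<close> strictly recovers \<open>w\<close> from its two
  projections.\<close>

lemma pair_ext:
  assumes "left_adjoint u" "left_adjoint v" "u \<in> hom C x (y \<odot> z)" "v \<in> hom C x (y \<odot> z)"
    "u ;; pr1 y z = v ;; pr1 y z" "u ;; pr2 y z = v ;; pr2 y z" "y \<in> Obj C" "z \<in> Obj C"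
  shows "u = v"
proof -
  have *: "w = delta x ;; ((w ;; pr1 y z) \<otimes> (w ;; pr2 y z))" if "left_adjoint w" "w \<in> hom C x (y \<odot> z)" for w
  proof -
    have w: "w \<in> Arr C" "Dom C w = x" "Cod C w = y \<odot> z" "x \<in> Obj C" using that hom_obj by (auto simp: hom_def)
    have "w = w ;; (delta (y \<odot> z) ;; (pr1 y z \<otimes> pr2 y z))"
      using w assms by (simp add: delta_pr)
    also have "\<dots> = (w ;; delta (y \<odot> z)) ;; (pr1 y z \<otimes> pr2 y z)"
      using w assms by (simp add: assoc)
    also have "\<dots> = delta x ;; ((w ;; pr1 y z) \<otimes> (w ;; pr2 y z))"
      using w assms left_adjoint_delta_eq[OF that(1)] by (simp add: assoc exchange)
    finally show ?thesis .
  qed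
  show ?thesis using *[OF assms(1,3)] *[OF assms(2,4)] assms(5,6) by simp
qed

text \<open>Recasts \<open>proj_old\<close> so that the last factor is projected away before the
  coordinate is taken, the shape in which inductions over powers proceed.\<close>

lemma proj_pr1:
  assumes "c \<in> Obj C" "i \<in> {1..Suc n}"
  shows "Supply C c (W_up (Suc (Suc n)) 1 (\<lambda>_. i)) = pr1 (tpow C c (Suc n)) c ;; Supply C c (W_up (Suc n) 1 (\<lambda>_. i))"
proof -
  have p: "(\<lambda>_. i) \<in> {1..1::nat} \<rightarrow> {1..Suc n}" using assms by auto
  define P where "P = Supply C c (W_up (Suc n) 1 (\<lambda>_. i))"
  have P: "P \<in> Arr C" "Dom C P = tpow C c (Suc n)" "Cod C P = c"
    using Supply_simps[OF assms(1) W_up_hom[OF p]] by (simp_all add: P_def del: tpow.simps)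
  have "(P \<otimes> Idn C c) ;; pr1 c c = pr1 (tpow C c (Suc n)) c ;; P"
    by (rule pr1_natural) (use P assms in \<open>simp_all add: hom_def del: tpow.simps\<close>)
  then show ?thesis using P assms
    by (simp add: proj_old pr1_def exchange_assoc flip: P_def del: tpow.simps)
qed

text \<open>Discarding the first \<open>n + 1\<close> factors is a left adjoint into I, hence it is
  \<open>eps\<close> of their whole tensor power.\<close>

lemma proj_pr2:
  assumes "c \<in> Obj C"
  shows "Supply C c (W_up (Suc (Suc n)) 1 (\<lambda>_. Suc (Suc n))) = pr2 (tpow C c (Suc n)) c"
proof -
  have p: "(\<lambda>i. i) \<in> {1..0} \<rightarrow> {1..Suc n}" by auto
  have "Supply C c (W_up (Suc n) 0 (\<lambda>i. i)) = eps (tpow C c (Suc n))"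
    using left_adjoint_Unit[OF left_adjoint_Supply_up[OF assms p]] Supply_simps[OF assms W_up_hom[OF p]] by simp
  then show ?thesis by (simp add: proj_new[OF assms] pr2_def)
qed

text \<open>\<open>pair_ext\<close> splits off the last factor: \<open>proj_pr2\<close> reads the
  last coordinate, \<open>proj_pr1\<close> passes the others to the induction hypothesis. Exponent 0
  is terminality of I, and for exponent 1 the coordinate is the identity.\<close>

lemma tpow_ext:
  assumes "c \<in> Obj C" "left_adjoint u" "left_adjoint v" "u \<in> hom C x (tpow C c n)" "v \<in> hom C x (tpow C c n)"
    "\<And>i. i \<in> {1..n} \<Longrightarrow> u ;; Supply C c (W_up n 1 (\<lambda>_. i)) = v ;; Supply C c (W_up n 1 (\<lambda>_. i))"
  shows "u = v"
  using assms
proof (induction n arbitrary: u v)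
  case 0
  then show ?case using left_adjoint_Unit[of u] left_adjoint_Unit[of v] by (simp add: hom_def)
next
  case (Suc n)
  show ?case
  proof (cases n)
    case 0
    then show ?thesis using Suc.prems(4,5) Suc.prems(6)[of 1] proj_1[OF assms(1)] by (simp add: hom_def flip: One_nat_def)
  next
    case (Suc m)
    let ?y = "tpow C c (Suc m)"
    note prems = Suc.prems[unfolded Suc]
    have y: "?y \<in> Obj C" using assms(1) by (rule tpow_Obj)
    have uv: "u \<in> hom C x (?y \<odot> c)" "v \<in> hom C x (?y \<odot> c)" using prems(4,5) by simp_all
    have la: "left_adjoint (w ;; pr1 ?y c)" "w ;; pr1 ?y c \<in> hom C x ?y"
      if "left_adjoint w" "w \<in> hom C x (?y \<odot> c)" for w
      using that y assms(1) by (auto simp: hom_def intro!: left_adjoint_Cmp left_adjoint_pr simp del: tpow.simps)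
    have "u ;; pr1 ?y c = v ;; pr1 ?y c"
    proof (rule Suc.IH[unfolded Suc, OF assms(1)])
      fix i assume i: "i \<in> {1..Suc m}"
      then have p: "(\<lambda>_. i) \<in> {1..1::nat} \<rightarrow> {1..Suc m}" by auto
      have "w ;; Supply C c (W_up (Suc (Suc m)) 1 (\<lambda>_. i)) = (w ;; pr1 ?y c) ;; Supply C c (W_up (Suc m) 1 (\<lambda>_. i))"
        if "w \<in> hom C x (?y \<odot> c)" for w
        using that y assms(1) Supply_simps[OF assms(1) W_up_hom[OF p]]
        by (simp add: proj_pr1[OF assms(1) i] hom_def assoc del: tpow.simps)
      then show "(u ;; pr1 ?y c) ;; Supply C c (W_up (Suc m) 1 (\<lambda>_. i)) = (v ;; pr1 ?y c) ;; Supply C c (W_up (Suc m) 1 (\<lambda>_. i))"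
        using uv prems(6)[of i] i by simp
    qed (use la uv prems in blast)+
    moreover have "u ;; pr2 ?y c = v ;; pr2 ?y c"
      using prems(6)[of "Suc (Suc m)"] by (simp add: proj_pr2[OF assms(1)] del: tpow.simps)
    ultimately show ?thesis
      using pair_ext[OF prems(2,3) uv] y assms(1) by blast
  qed
qed

end

section \<open>Strong functors and transformations\<close>

lemma tpow_fun_1: "tpow_fun C D F c 1 = Idn D (FO F c)"
  by (simp add: One_nat_def)

text \<open>\<open>strong_smpofunctor\<close> says nothing about its source and target; bundling the
  three makes the typing rules of both ends available.\<close>

locale sm_functor = strong_smpofunctor C D F + C: smpocat C + D: smpocat D
  for C :: "('o, 'a, 'z) smpocat_scheme" and D :: "('p, 'b, 'y) smpocat_scheme" (structure)
    and F :: "('o, 'a, 'p, 'b) smfun"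
begin

lemma FO_Obj [simp]: "a \<in> Obj C \<Longrightarrow> FO F a \<in> Obj D"
  by (rule FO_in)

lemma FA_simps [simp]:
  assumes "f \<in> Arr C"
  shows "FA F f \<in> Arr D" "Dom D (FA F f) = FO F (Dom C f)" "Cod D (FA F f) = FO F (Cod C f)"
  using FA_in[OF C.Arr_hom[OF assms]] by (simp_all add: hom_def)

lemma FU_simps [simp]: "FU F \<in> Arr D" "Dom D (FU F) = Unit D" "Cod D (FU F) = FO F (Unit C)" "iso D (FU F)"
  using FU_in FU_iso by (simp_all add: hom_def)

lemma FM_simps [simp]:
  assumes "a \<in> Obj C" "b \<in> Obj C"
  shows "FM F a b \<in> Arr D" "Dom D (FM F a b) = FO F a \<odot>\<^bsub>D\<^esub> FO F b"
    "Cod D (FM F a b) = FO F (a \<odot>\<^bsub>C\<^esub> b)" "iso D (FM F a b)"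
  using FM_in[OF assms] FM_iso[OF assms] by (simp_all add: hom_def)

lemma FA_comp: "\<lbrakk>f \<in> Arr C; g \<in> Arr C; Cod C f = Dom C g\<rbrakk> \<Longrightarrow> FA F (f ;;\<^bsub>C\<^esub> g) = FA F f ;;\<^bsub>D\<^esub> FA F g"
  by (rule FA_Cmp) (simp_all add: hom_def)

lemma FM_natural: "\<lbrakk>f \<in> Arr C; g \<in> Arr C; Dom C f = a; Dom C g = b; Cod C f = a'; Cod C g = b'\<rbrakk>
    \<Longrightarrow> (FA F f \<otimes>\<^bsub>D\<^esub> FA F g) ;;\<^bsub>D\<^esub> FM F a' b' = FM F a b ;;\<^bsub>D\<^esub> FA F (f \<otimes>\<^bsub>C\<^esub> g)"
  by (rule FM_nat) (simp_all add: hom_def)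

lemma FA_Leq: "\<lbrakk>f \<in> Arr C; g \<in> Arr C; Dom C f = Dom C g; Cod C f = Cod C g; Leq C f g\<rbrakk> \<Longrightarrow> Leq D (FA F f) (FA F g)"
  using FA_mono[of "Dom C f" "Cod C f"] by (simp add: monotone_on_def hom_def)

lemma FA_ladj:
  assumes "C.ladj f g"
  shows "D.ladj (FA F f) (FA F g)"
proof -
  have f: "f \<in> Arr C" "g \<in> Arr C" "Dom C g = Cod C f" "Cod C g = Dom C f"
    and le: "Leq C (Idn C (Dom C f)) (f ;;\<^bsub>C\<^esub> g)" "Leq C (g ;;\<^bsub>C\<^esub> f) (Idn C (Cod C f))"
    using assms by (auto simp: C.ladj_def hom_def)
  have "Leq D (FA F (Idn C (Dom C f))) (FA F (f ;;\<^bsub>C\<^esub> g))" "Leq D (FA F (g ;;\<^bsub>C\<^esub> f)) (FA F (Idn C (Cod C f)))"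
    using FA_Leq le f C.Dom_in C.Cod_in by simp_all
  then show ?thesis
    using f C.Dom_in C.Cod_in by (simp add: D.ladj_def hom_def FA_Idn FA_comp)
qed

lemma FA_left_adjoint: "C.left_adjoint f \<Longrightarrow> D.left_adjoint (FA F f)"
  unfolding C.left_adjoint_def D.left_adjoint_def using FA_ladj by blast

lemma FA_iso:
  assumes "iso C f"
  shows "iso D (FA F f)" "FA F (inverse_of C f) = inverse_of D (FA F f)"
proof -
  have "is_inverse D (FA F f) (FA F (inverse_of C f))"
    using assms C.iso_Arr[OF assms] C.Dom_in C.Cod_in
    by (simp add: is_inverse_def hom_def FA_Idn flip: FA_comp)
  then show "iso D (FA F f)" "FA F (inverse_of C f) = inverse_of D (FA F f)"
    using D.inverse_of_eq by (auto simp: iso_def)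
qed

text \<open>The left unit axiom at I, with one more \<open>FU F\<close> slid through
  \<open>LUnit\<close> and the unitors inverted. As \<open>delta\<close> at I is the inverse unitor,
  it expresses how \<open>F\<close> treats \<open>delta\<close> at the unit.\<close>

lemma FU_inverse_LUnit:
  "FU F ;;\<^bsub>D\<^esub> FA F (inverse_of C (LUnit C (Unit C))) =
    inverse_of D (LUnit D (Unit D)) ;;\<^bsub>D\<^esub> ((FU F \<otimes>\<^bsub>D\<^esub> FU F) ;;\<^bsub>D\<^esub> FM F (Unit C) (Unit C))"
proof -
  let ?J = "FO F (Unit C)"
  have "(FU F \<otimes>\<^bsub>D\<^esub> FU F) ;;\<^bsub>D\<^esub> FM F (Unit C) (Unit C) ;;\<^bsub>D\<^esub> FA F (LUnit C (Unit C))
     = ((Idn D (Unit D) ;;\<^bsub>D\<^esub> FU F) \<otimes>\<^bsub>D\<^esub> (FU F ;;\<^bsub>D\<^esub> Idn D ?J)) ;;\<^bsub>D\<^esub> FM F (Unit C) (Unit C) ;;\<^bsub>D\<^esub> FA F (LUnit C (Unit C))"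
    by simp
  also have "\<dots> = (Idn D (Unit D) \<otimes>\<^bsub>D\<^esub> FU F) ;;\<^bsub>D\<^esub>
      ((FU F \<otimes>\<^bsub>D\<^esub> Idn D ?J) ;;\<^bsub>D\<^esub> FM F (Unit C) (Unit C) ;;\<^bsub>D\<^esub> FA F (LUnit C (Unit C)))"
    by (subst D.exchange[symmetric]) (simp_all add: D.assoc)
  also have "\<dots> = LUnit D (Unit D) ;;\<^bsub>D\<^esub> FU F"
    by (simp add: FM_LUnit D.LUnit_natural)
  finally have *: "((FU F \<otimes>\<^bsub>D\<^esub> FU F) ;;\<^bsub>D\<^esub> FM F (Unit C) (Unit C)) ;;\<^bsub>D\<^esub> FA F (LUnit C (Unit C))
      = LUnit D (Unit D) ;;\<^bsub>D\<^esub> FU F" .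
  show ?thesis
    unfolding FA_iso(2)[OF C.Unitor_simps(4)[OF C.Unit_in]]
    by (rule D.inverse_natural[OF _ _ *]) (simp_all add: FA_iso)
qed

lemma tpow_fun_simps [simp]:
  assumes "c \<in> Obj C"
  shows "tpow_fun C D F c n \<in> Arr D" "Dom D (tpow_fun C D F c n) = tpow D (FO F c) n"
    "Cod D (tpow_fun C D F c n) = FO F (tpow C c n)" "iso D (tpow_fun C D F c n)"
proof -
  have "tpow_fun C D F c n \<in> Arr D \<and> Dom D (tpow_fun C D F c n) = tpow D (FO F c) n \<and>
    Cod D (tpow_fun C D F c n) = FO F (tpow C c n) \<and> iso D (tpow_fun C D F c n)"
  proof (induction n)
    case (Suc n)
    show ?case
    proof (cases n)
      case (Suc m)
      then show ?thesis using Suc.IH assms C.tpow_Obj[OF assms, of "Suc m"]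
        by (auto intro!: D.iso_Cmp D.TenA_iso)
    qed (use assms in simp)
  qed simp
  then show "tpow_fun C D F c n \<in> Arr D" "Dom D (tpow_fun C D F c n) = tpow D (FO F c) n"
    "Cod D (tpow_fun C D F c n) = FO F (tpow C c n)" "iso D (tpow_fun C D F c n)" by auto
qed

end

section \<open>Strong functors preserve the supply\<close>

locale prl_functor = sm_functor C D F + C: prerelational C + D: prerelational D
  for C :: "('o, 'a, 'z) scat_scheme" and D :: "('p, 'b, 'y) scat_scheme" (structure)
    and F :: "('o, 'a, 'p, 'b) smfun"
begin

text \<open>Corrected by the inverse of \<open>FU F\<close>, the image of \<open>eps c\<close> is a
  left adjoint into the unit of \<open>D\<close>, and there is only one.\<close>

lemma FA_eps:
  assumes "c \<in> Obj C"
  shows "FA F (C.eps c) = D.eps (FO F c) ;;\<^bsub>D\<^esub> FU F"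
proof -
  have "D.left_adjoint (FA F (C.eps c) ;;\<^bsub>D\<^esub> inverse_of D (FU F))"
    using assms by (intro D.left_adjoint_Cmp FA_left_adjoint C.left_adjoint_eps)
      (simp_all add: D.left_adjoint_iso D.iso_inverse_iso)
  from D.left_adjoint_Unit[OF this]
  have "(FA F (C.eps c) ;;\<^bsub>D\<^esub> inverse_of D (FU F)) ;;\<^bsub>D\<^esub> FU F = D.eps (FO F c) ;;\<^bsub>D\<^esub> FU F"
    using assms by simp
  then show ?thesis using assms by (simp add: D.assoc)
qed

text \<open>Naturality of the strongator brings \<open>F\<close> inside the tensor,
  \<open>FA_eps\<close> rewrites the discard there, and the right unit axiom absorbs the remaining
  \<open>FU F\<close>.\<close>

lemma FA_pr1:
  assumes y: "y \<in> Obj C" and z: "z \<in> Obj C"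
  shows "FM F y z ;;\<^bsub>D\<^esub> FA F (C.pr1 y z) = D.pr1 (FO F y) (FO F z)"
proof -
  have "FM F y z ;;\<^bsub>D\<^esub> FA F (C.pr1 y z) = (FM F y z ;;\<^bsub>D\<^esub> FA F (Idn C y \<otimes>\<^bsub>C\<^esub> C.eps z)) ;;\<^bsub>D\<^esub> FA F (RUnit C y)"
    using y z by (simp add: C.pr1_def FA_comp D.assoc)
  also have "\<dots> = (Idn D (FO F y) \<otimes>\<^bsub>D\<^esub> (D.eps (FO F z) ;;\<^bsub>D\<^esub> FU F)) ;;\<^bsub>D\<^esub> FM F y (Unit C) ;;\<^bsub>D\<^esub> FA F (RUnit C y)"
    using y z by (subst FM_natural[symmetric]) (simp_all add: FA_eps FA_Idn)
  also have "\<dots> = ((Idn D (FO F y) ;;\<^bsub>D\<^esub> Idn D (FO F y)) \<otimes>\<^bsub>D\<^esub> (D.eps (FO F z) ;;\<^bsub>D\<^esub> FU F)) ;;\<^bsub>D\<^esub> (FM F y (Unit C) ;;\<^bsub>D\<^esub> FA F (RUnit C y))"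
    using y z by (simp add: D.assoc)
  also have "\<dots> = (Idn D (FO F y) \<otimes>\<^bsub>D\<^esub> D.eps (FO F z)) ;;\<^bsub>D\<^esub> ((Idn D (FO F y) \<otimes>\<^bsub>D\<^esub> FU F) ;;\<^bsub>D\<^esub> FM F y (Unit C) ;;\<^bsub>D\<^esub> FA F (RUnit C y))"
    using y z by (subst D.exchange[symmetric]) (simp_all add: D.assoc)
  also have "\<dots> = D.pr1 (FO F y) (FO F z)"
    using y z by (simp add: FM_RUnit D.pr1_def)
  finally show ?thesis .
qed

lemma FA_pr2:
  assumes y: "y \<in> Obj C" and z: "z \<in> Obj C"
  shows "FM F y z ;;\<^bsub>D\<^esub> FA F (C.pr2 y z) = D.pr2 (FO F y) (FO F z)"
proof -
  have "FM F y z ;;\<^bsub>D\<^esub> FA F (C.pr2 y z) = (FM F y z ;;\<^bsub>D\<^esub> FA F (C.eps y \<otimes>\<^bsub>C\<^esub> Idn C z)) ;;\<^bsub>D\<^esub> FA F (LUnit C z)"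
    using y z by (simp add: C.pr2_def FA_comp D.assoc)
  also have "\<dots> = ((D.eps (FO F y) ;;\<^bsub>D\<^esub> FU F) \<otimes>\<^bsub>D\<^esub> Idn D (FO F z)) ;;\<^bsub>D\<^esub> FM F (Unit C) z ;;\<^bsub>D\<^esub> FA F (LUnit C z)"
    using y z by (subst FM_natural[symmetric]) (simp_all add: FA_eps FA_Idn)
  also have "\<dots> = ((D.eps (FO F y) ;;\<^bsub>D\<^esub> FU F) \<otimes>\<^bsub>D\<^esub> (Idn D (FO F z) ;;\<^bsub>D\<^esub> Idn D (FO F z))) ;;\<^bsub>D\<^esub> (FM F (Unit C) z ;;\<^bsub>D\<^esub> FA F (LUnit C z))"
    using y z by (simp add: D.assoc)
  also have "\<dots> = (D.eps (FO F y) \<otimes>\<^bsub>D\<^esub> Idn D (FO F z)) ;;\<^bsub>D\<^esub> ((FU F \<otimes>\<^bsub>D\<^esub> Idn D (FO F z)) ;;\<^bsub>D\<^esub> FM F (Unit C) z ;;\<^bsub>D\<^esub> FA F (LUnit C z))"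
    using y z by (subst D.exchange[symmetric]) (simp_all add: D.assoc)
  also have "\<dots> = D.pr2 (FO F y) (FO F z)"
    using y z by (simp add: FM_LUnit D.pr2_def)
  finally show ?thesis .
qed

text \<open>Powers and iterated strongators both grow at the last factor. The inductive step is
  therefore \<open>FA_pr1\<close> or \<open>FA_pr2\<close>, followed by naturality of the projection
  along the strongator already built.\<close>

lemma FA_proj:
  assumes c: "c \<in> Obj C" and "i \<in> {1..n}"
  shows "tpow_fun C D F c n ;;\<^bsub>D\<^esub> FA F (Supply C c (W_up n 1 (\<lambda>_. i))) = Supply D (FO F c) (W_up n 1 (\<lambda>_. i))"
  using assms(2)
proof (induction n arbitrary: i)
  case (Suc n)
  show ?case
  proof (cases n)
    case 0
    then have [simp]: "i = 1" using Suc.prems by auto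
    show ?thesis using 0 c C.proj_1[OF c] D.proj_1[OF FO_in[OF c]] by (simp add: FA_Idn tpow_fun_1 flip: One_nat_def)
  next
    case (Suc m)
    let ?y = "tpow C c (Suc m)" and ?t = "tpow_fun C D F c (Suc m)"
    have y: "?y \<in> Obj C" using c by (rule C.tpow_Obj)
    have t: "?t \<in> hom D (tpow D (FO F c) (Suc m)) (FO F ?y)" using c by (simp add: hom_def del: tpow.simps tpow_fun.simps)
    have t1: "(?t \<otimes>\<^bsub>D\<^esub> Idn D (FO F c)) ;;\<^bsub>D\<^esub> D.pr1 (FO F ?y) (FO F c) = D.pr1 (tpow D (FO F c) (Suc m)) (FO F c) ;;\<^bsub>D\<^esub> ?t"
      by (rule D.pr1_natural[OF t]) (use c in \<open>simp_all add: hom_def\<close>)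
    \<comment> \<open>The iterated strongator is an isomorphism, hence a left adjoint, and so
      commutes with \<open>eps\<close> as \<open>pr2_natural\<close> demands of the discarded
      component.\<close>
    have "?t ;;\<^bsub>D\<^esub> D.eps (Cod D ?t) = D.eps (Dom D ?t)"
      using D.left_adjoint_eps_eq[OF D.left_adjoint_iso[of ?t]] c by (simp del: tpow.simps tpow_fun.simps)
    then have t2: "(?t \<otimes>\<^bsub>D\<^esub> Idn D (FO F c)) ;;\<^bsub>D\<^esub> D.pr2 (FO F ?y) (FO F c) = D.pr2 (tpow D (FO F c) (Suc m)) (FO F c) ;;\<^bsub>D\<^esub> Idn D (FO F c)"
      by (intro D.pr2_natural[OF t]) (use c in \<open>simp_all add: hom_def del: tpow.simps tpow_fun.simps\<close>)
    show ?thesis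
    proof (cases "i = Suc (Suc m)")
      case True
      have "tpow_fun C D F c (Suc (Suc m)) ;;\<^bsub>D\<^esub> FA F (C.pr2 ?y c)
          = (?t \<otimes>\<^bsub>D\<^esub> Idn D (FO F c)) ;;\<^bsub>D\<^esub> (FM F ?y c ;;\<^bsub>D\<^esub> FA F (C.pr2 ?y c))"
        using c y by (simp add: D.assoc del: tpow.simps tpow_fun.simps(2))
      also have "\<dots> = D.pr2 (tpow D (FO F c) (Suc m)) (FO F c)"
        unfolding FA_pr2[OF y c] t2 using c by simp
      finally show ?thesis
        unfolding Suc True using c by (simp add: C.proj_pr2 D.proj_pr2 del: tpow.simps tpow_fun.simps)
    next
      case False
      then have i: "i \<in> {1..Suc m}" using Suc.prems Suc by auto
      then have p: "(\<lambda>_. i) \<in> {1..1::nat} \<rightarrow> {1..Suc m}" by auto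
      define P where "P = Supply C c (W_up (Suc m) 1 (\<lambda>_. i))"
      have P: "P \<in> Arr C" "Dom C P = ?y" "Cod C P = c"
        using C.Supply_simps[OF c W_up_hom[OF p]] by (simp_all add: P_def del: tpow.simps)
      have "tpow_fun C D F c (Suc (Suc m)) ;;\<^bsub>D\<^esub> FA F (C.pr1 ?y c ;;\<^bsub>C\<^esub> P)
          = ((?t \<otimes>\<^bsub>D\<^esub> Idn D (FO F c)) ;;\<^bsub>D\<^esub> (FM F ?y c ;;\<^bsub>D\<^esub> FA F (C.pr1 ?y c))) ;;\<^bsub>D\<^esub> FA F P"
        using c y P by (simp add: D.assoc FA_comp del: tpow.simps tpow_fun.simps(2))
      also have "\<dots> = (D.pr1 (tpow D (FO F c) (Suc m)) (FO F c) ;;\<^bsub>D\<^esub> ?t) ;;\<^bsub>D\<^esub> FA F P"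
        unfolding FA_pr1[OF y c] t1 ..
      also have "\<dots> = D.pr1 (tpow D (FO F c) (Suc m)) (FO F c) ;;\<^bsub>D\<^esub> (?t ;;\<^bsub>D\<^esub> FA F P)"
        using c y P by (simp add: D.assoc del: tpow.simps tpow_fun.simps)
      also have "?t ;;\<^bsub>D\<^esub> FA F P = Supply D (FO F c) (W_up (Suc m) 1 (\<lambda>_. i))"
        using Suc.IH[unfolded Suc, OF i] by (simp add: P_def del: tpow.simps tpow_fun.simps)
      finally show ?thesis
        unfolding Suc C.proj_pr1[OF c i] D.proj_pr1[OF FO_in[OF c] i] P_def .
    qed
  qed
qed simp

text \<open>Both sides are left adjoints into a tensor power, so \<open>tpow_ext\<close> compares
  coordinates: coordinate \<open>i\<close> of \<open>W_up k m f\<close> is coordinate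
  \<open>f i\<close>, and \<open>FA_proj\<close> preserves those.\<close>

lemma FA_up:
  assumes c: "c \<in> Obj C" and f: "f \<in> {1..m} \<rightarrow> {1..k}"
  shows "Supply D (FO F c) (W_up k m f) =
    tpow_fun C D F c k ;;\<^bsub>D\<^esub> (FA F (Supply C c (W_up k m f)) ;;\<^bsub>D\<^esub> inverse_of D (tpow_fun C D F c m))"
proof (rule D.tpow_ext[of "FO F c"])
  note u = W_up_hom[OF f]
  show "D.left_adjoint (Supply D (FO F c) (W_up k m f))"
    using c f by (simp add: D.left_adjoint_Supply_up)
  show "D.left_adjoint (tpow_fun C D F c k ;;\<^bsub>D\<^esub> (FA F (Supply C c (W_up k m f)) ;;\<^bsub>D\<^esub> inverse_of D (tpow_fun C D F c m)))"
    using c f C.Supply_simps[OF c u]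
    by (intro D.left_adjoint_Cmp FA_left_adjoint C.left_adjoint_Supply_up)
      (simp_all add: D.left_adjoint_iso D.iso_inverse_iso)
  fix i assume i: "i \<in> {1..m}"
  then have p: "(\<lambda>_. i) \<in> {1..1::nat} \<rightarrow> {1..m}" and fi: "f i \<in> {1..k}" using f by auto
  have up: "Supply D d (W_up k m f) ;;\<^bsub>D\<^esub> Supply D d (W_up m 1 (\<lambda>_. i)) = Supply D d (W_up k 1 (\<lambda>_. f i))" if "d \<in> Obj D" for d
    using D.Supply_Cmp[OF that u W_up_hom[OF p]] up_up[OF f p] by simp
  have upC: "Supply C c (W_up k m f) ;;\<^bsub>C\<^esub> Supply C c (W_up m 1 (\<lambda>_. i)) = Supply C c (W_up k 1 (\<lambda>_. f i))"
    using C.Supply_Cmp[OF c u W_up_hom[OF p]] up_up[OF f p] by simp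
  have "(tpow_fun C D F c k ;;\<^bsub>D\<^esub> (FA F (Supply C c (W_up k m f)) ;;\<^bsub>D\<^esub> inverse_of D (tpow_fun C D F c m))) ;;\<^bsub>D\<^esub>
      Supply D (FO F c) (W_up m 1 (\<lambda>_. i))
    = tpow_fun C D F c k ;;\<^bsub>D\<^esub> (FA F (Supply C c (W_up k m f)) ;;\<^bsub>D\<^esub> FA F (Supply C c (W_up m 1 (\<lambda>_. i))))"
    using c C.Supply_simps[OF c u] C.Supply_simps[OF c W_up_hom[OF p]]
    by (simp add: D.assoc flip: FA_proj[OF c i])
  also have "\<dots> = Supply D (FO F c) (W_up k 1 (\<lambda>_. f i))"
    using C.Supply_simps[OF c u] C.Supply_simps[OF c W_up_hom[OF p]] FA_proj[OF c fi]
    by (simp add: upC flip: FA_comp)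
  finally show "Supply D (FO F c) (W_up k m f) ;;\<^bsub>D\<^esub> Supply D (FO F c) (W_up m 1 (\<lambda>_. i)) =
    (tpow_fun C D F c k ;;\<^bsub>D\<^esub> (FA F (Supply C c (W_up k m f)) ;;\<^bsub>D\<^esub> inverse_of D (tpow_fun C D F c m))) ;;\<^bsub>D\<^esub>
      Supply D (FO F c) (W_up m 1 (\<lambda>_. i))"
    using up[OF FO_in[OF c]] by simp
qed (use c D.Supply_simps[OF FO_in[OF c] W_up_hom[OF f]] C.Supply_simps[OF c W_up_hom[OF f]] in \<open>simp_all add: hom_def\<close>)

text \<open>Right adjoints are unique, so preservation of \<open>W_dn\<close> follows from that of \<open>W_up\<close>.\<close>

lemma FA_dn:
  assumes c: "c \<in> Obj C" and f: "f \<in> {1..m} \<rightarrow> {1..k}"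
  shows "Supply D (FO F c) (W_dn m k f) =
    tpow_fun C D F c m ;;\<^bsub>D\<^esub> (FA F (Supply C c (W_dn m k f)) ;;\<^bsub>D\<^esub> inverse_of D (tpow_fun C D F c k))"
proof (rule D.ladj_right_unique)
  let ?k = "tpow_fun C D F c k" and ?m = "tpow_fun C D F c m"
  note u = C.Supply_simps[OF c W_up_hom[OF f]] and d = C.Supply_simps[OF c W_dn_hom[OF f]]
  show "D.ladj (Supply D (FO F c) (W_up k m f)) (Supply D (FO F c) (W_dn m k f))"
    using c f by (simp add: D.ladj_Supply_up)
  \<comment> \<open>The adjoint of the composite with an inverted strongator is needed, and the
    right adjoint of that inverse is the strongator itself.\<close>
  have inv: "D.ladj (inverse_of D ?m) ?m"
  proof -
    have "is_inverse D (inverse_of D ?m) ?m" using c by (simp add: is_inverse_def hom_def)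
    then show ?thesis using D.ladj_iso[of "inverse_of D ?m"] D.inverse_of_eq c by (metis iso_def)
  qed
  have adj: "D.ladj (FA F (Supply C c (W_up k m f)) ;;\<^bsub>D\<^esub> inverse_of D ?m) (?m ;;\<^bsub>D\<^esub> FA F (Supply C c (W_dn m k f)))"
    by (rule D.ladj_Cmp[OF FA_ladj[OF C.ladj_Supply_up[OF c f]] inv]) (use c u in simp)
  have "D.ladj (?k ;;\<^bsub>D\<^esub> (FA F (Supply C c (W_up k m f)) ;;\<^bsub>D\<^esub> inverse_of D ?m))
     ((?m ;;\<^bsub>D\<^esub> FA F (Supply C c (W_dn m k f))) ;;\<^bsub>D\<^esub> inverse_of D ?k)"
    by (rule D.ladj_Cmp[OF D.ladj_iso adj]) (use c u in simp_all)
  then show "D.ladj (Supply D (FO F c) (W_up k m f))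
      (?m ;;\<^bsub>D\<^esub> (FA F (Supply C c (W_dn m k f)) ;;\<^bsub>D\<^esub> inverse_of D ?k))"
    unfolding FA_up[OF c f] using c d by (simp add: D.assoc)
qed

text \<open>Any \<open>w\<close> factors as a \<open>W_dn\<close> followed by a \<open>W_up\<close>
  through some \<open>k\<close>; on composing \<open>FA_dn\<close> with \<open>FA_up\<close> the
  strongator at \<open>k\<close> meets its inverse.\<close>

theorem preserves_supply: "preserves_supply C D F"
  unfolding preserves_supply_def
proof (intro ballI allI)
  fix c m n w assume c: "c \<in> Obj C" and w: "w \<in> hom W m n"
  obtain k f g where f: "f \<in> {1..m} \<rightarrow> {1..k}" and g: "g \<in> {1..n} \<rightarrow> {1..k}"
    and w: "w = W_dn m k f ;;\<^bsub>W\<^esub> W_up k n g"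
    using dn_up_eq[OF w] by blast
  note d = C.Supply_simps[OF c W_dn_hom[OF f]] and u = C.Supply_simps[OF c W_up_hom[OF g]]
  have "Supply D (FO F c) w ;;\<^bsub>D\<^esub> tpow_fun C D F c n =
     tpow_fun C D F c m ;;\<^bsub>D\<^esub> (FA F (Supply C c (W_dn m k f)) ;;\<^bsub>D\<^esub> FA F (Supply C c (W_up k n g)))"
    using c d u by (simp add: w D.Supply_Cmp[OF FO_in[OF c] W_dn_hom[OF f] W_up_hom[OF g]] FA_up[OF c g] FA_dn[OF c f] D.assoc)
  also have "\<dots> = tpow_fun C D F c m ;;\<^bsub>D\<^esub> FA F (Supply C c w)"
    using c d u by (simp add: w C.Supply_Cmp[OF c W_dn_hom[OF f] W_up_hom[OF g]] FA_comp)
  finally show "Supply D (FO F c) w ;;\<^bsub>D\<^esub> tpow_fun C D F c n = tpow_fun C D F c m ;;\<^bsub>D\<^esub> FA F (Supply C c w)" .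
qed

end

section \<open>Left adjoint oplax transformations\<close>

text \<open>Formulated over symmetric monoidal po-categories, so that it also serves the bases of
  regular calculi, which may fail to be prerelational.\<close>

locale oplax_adjoint = F: sm_functor C D F + G: sm_functor C D G
  for C :: "('o, 'a, 'z) smpocat_scheme" and D :: "('p, 'b, 'y) smpocat_scheme" (structure)
    and F G :: "('o, 'a, 'p, 'b) smfun" +
  fixes \<alpha> :: "'o \<Rightarrow> 'b"
  assumes adj: "left_adjoint_oplax C D F G \<alpha>"
begin

lemma comp_simps [simp]:
  assumes "c \<in> Obj C"
  shows "\<alpha> c \<in> Arr D" "Dom D (\<alpha> c) = FO F c" "Cod D (\<alpha> c) = FO G c"
  using adj assms by (simp_all add: left_adjoint_oplax_def oplax_natural_def hom_def)

lemma comp_left_adjoint: "c \<in> Obj C \<Longrightarrow> F.D.left_adjoint (\<alpha> c)"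
  using adj unfolding left_adjoint_oplax_def oplax_natural_def F.D.left_adjoint_def F.D.ladj_def hom_def
  by fastforce

lemma oplax: "\<lbrakk>f \<in> Arr C; Dom C f = c; Cod C f = c'\<rbrakk> \<Longrightarrow> FA F f ;;\<^bsub>D\<^esub> \<alpha> c' \<sqsubseteq>\<^bsub>D\<^esub> \<alpha> c ;;\<^bsub>D\<^esub> FA G f"
  using adj unfolding left_adjoint_oplax_def oplax_natural_def hom_def by auto

text \<open>Oplaxness at the right adjoint \<open>g\<close> of \<open>f\<close> gives the converse
  inequality: insert the unit of \<open>FA F f\<close>, move \<open>\<alpha>\<close> past
  \<open>FA F g\<close>, and cancel by the counit of \<open>FA G f\<close>.\<close>

lemma natural:
  assumes f: "F.C.left_adjoint f" and [simp]: "Dom C f = c" "Cod C f = c'"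
  shows "FA F f ;;\<^bsub>D\<^esub> \<alpha> c' = \<alpha> c ;;\<^bsub>D\<^esub> FA G f"
proof (rule F.D.Leq_antisym)
  obtain g where "F.C.ladj f g" using f by (auto simp: F.C.left_adjoint_def)
  then have "F.D.ladj (FA F f) (FA F g)" "F.D.ladj (FA G f) (FA G g)"
    and fg: "f \<in> Arr C" "g \<in> Arr C" "Dom C g = c'" "Cod C g = c"
    using F.FA_ladj G.FA_ladj by (auto simp: F.C.ladj_def hom_def)
  then have le: "Leq D (Idn D (FO F c)) (FA F f ;;\<^bsub>D\<^esub> FA F g)" "Leq D (FA G g ;;\<^bsub>D\<^esub> FA G f) (Idn D (FO G c'))"
    by (simp_all add: F.D.ladj_def)
  have ob: "c \<in> Obj C" "c' \<in> Obj C" using fg F.C.Dom_in F.C.Cod_in by auto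
  note ty = fg ob
  show "FA F f ;;\<^bsub>D\<^esub> \<alpha> c' \<sqsubseteq>\<^bsub>D\<^esub> \<alpha> c ;;\<^bsub>D\<^esub> FA G f" using oplax fg by simp
  show h: "FA F f ;;\<^bsub>D\<^esub> \<alpha> c' \<in> hom D (FO F c) (FO G c')" "\<alpha> c ;;\<^bsub>D\<^esub> FA G f \<in> hom D (FO F c) (FO G c')"
    using ty by (simp_all add: hom_def)
  have "Leq D (Idn D (FO F c) ;;\<^bsub>D\<^esub> (\<alpha> c ;;\<^bsub>D\<^esub> FA G f)) ((FA F f ;;\<^bsub>D\<^esub> FA F g) ;;\<^bsub>D\<^esub> (\<alpha> c ;;\<^bsub>D\<^esub> FA G f))"
    by (rule F.D.Cmp_mono_left[OF le(1) _ _ h(2)]) (use ty in \<open>simp_all add: hom_def\<close>)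
  then have 1: "Leq D (\<alpha> c ;;\<^bsub>D\<^esub> FA G f) (FA F f ;;\<^bsub>D\<^esub> ((FA F g ;;\<^bsub>D\<^esub> \<alpha> c) ;;\<^bsub>D\<^esub> FA G f))"
    using ty by (simp add: F.D.assoc)
  have 2: "Leq D ((FA F g ;;\<^bsub>D\<^esub> \<alpha> c) ;;\<^bsub>D\<^esub> FA G f) ((\<alpha> c' ;;\<^bsub>D\<^esub> FA G g) ;;\<^bsub>D\<^esub> FA G f)"
    by (rule F.D.Cmp_mono_left[of _ _ "FO F c'" "FO G c" _ "FO G c'"]) (use ty oplax in \<open>simp_all add: hom_def\<close>)
  have 3: "Leq D (\<alpha> c' ;;\<^bsub>D\<^esub> (FA G g ;;\<^bsub>D\<^esub> FA G f)) (\<alpha> c' ;;\<^bsub>D\<^esub> Idn D (FO G c'))"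
    by (rule F.D.Cmp_mono_right[OF le(2), of _ "FO F c'" "FO G c'" "FO G c'"]) (use ty in \<open>simp_all add: hom_def\<close>)
  have "Leq D ((FA F g ;;\<^bsub>D\<^esub> \<alpha> c) ;;\<^bsub>D\<^esub> FA G f) (\<alpha> c')"
    by (rule F.D.Leq_trans[OF 2, of _ "FO F c'" "FO G c'"]) (use ty 3 in \<open>simp_all add: hom_def F.D.assoc\<close>)
  then have "Leq D (FA F f ;;\<^bsub>D\<^esub> ((FA F g ;;\<^bsub>D\<^esub> \<alpha> c) ;;\<^bsub>D\<^esub> FA G f)) (FA F f ;;\<^bsub>D\<^esub> \<alpha> c')"
    by (rule F.D.Cmp_mono_right[of _ _ _ "FO F c" "FO F c'" "FO G c'"]) (use ty in \<open>simp_all add: hom_def\<close>)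
  then show "Leq D (\<alpha> c ;;\<^bsub>D\<^esub> FA G f) (FA F f ;;\<^bsub>D\<^esub> \<alpha> c')"
    by (rule F.D.Leq_trans[OF 1, of _ "FO F c" "FO G c'"]) (use ty in \<open>simp_all add: hom_def\<close>)
qed

end

text \<open>Each equation becomes a comparison of left adjoints once the strongator of
  \<open>G\<close> is inverted: the unit equation by terminality of I, the binary one by
  \<open>pair_ext\<close>. Strict naturality of \<open>\<alpha>\<close> at the projections lets
  \<open>FA_pr1\<close> and \<open>FA_pr2\<close> for \<open>F\<close> and \<open>G\<close>
  meet.\<close>

lemma oplax_adjoint_monoidal:
  assumes "oplax_adjoint C D F G \<alpha>" "prerelational C" "prerelational D"
  shows "monoidal_transformation C D F G \<alpha>"
proof -
  interpret oplax_adjoint C D F G \<alpha> by fact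
  interpret F: prl_functor C D F by (intro prl_functor.intro F.sm_functor_axioms assms)
  interpret G: prl_functor C D G by (intro prl_functor.intro G.sm_functor_axioms assms)
  let ?I = "Unit C"
  have "FU F ;;\<^bsub>D\<^esub> \<alpha> ?I = FU G"
  proof -
    let ?w = "(FU F ;;\<^bsub>D\<^esub> \<alpha> ?I) ;;\<^bsub>D\<^esub> inverse_of D (FU G)"
    have "F.D.left_adjoint ?w"
      by (intro F.D.left_adjoint_Cmp comp_left_adjoint) (simp_all add: F.D.left_adjoint_iso F.D.iso_inverse_iso)
    from F.D.left_adjoint_Unit[OF this] have "?w ;;\<^bsub>D\<^esub> FU G = Idn D (Unit D) ;;\<^bsub>D\<^esub> FU G"
      by (simp add: F.D.eps_Unit)
    then show ?thesis by (simp add: F.D.assoc)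
  qed
  moreover have "FM F c d ;;\<^bsub>D\<^esub> \<alpha> (c \<odot>\<^bsub>C\<^esub> d) = (\<alpha> c \<otimes>\<^bsub>D\<^esub> \<alpha> d) ;;\<^bsub>D\<^esub> FM G c d" if c: "c \<in> Obj C" and d: "d \<in> Obj C" for c d
  proof -
    \<comment> \<open>Inverting the strongator of \<open>G\<close> makes the target a literal
      tensor, the form that \<open>pair_ext\<close> requires.\<close>
    let ?u = "(FM F c d ;;\<^bsub>D\<^esub> \<alpha> (c \<odot>\<^bsub>C\<^esub> d)) ;;\<^bsub>D\<^esub> inverse_of D (FM G c d)"
    let ?v = "\<alpha> c \<otimes>\<^bsub>D\<^esub> \<alpha> d"
    have "?u = ?v"
    proof (rule F.D.pair_ext)
      show "F.D.left_adjoint ?u"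
        using c d by (intro F.D.left_adjoint_Cmp comp_left_adjoint) (simp_all add: F.D.left_adjoint_iso F.D.iso_inverse_iso)
      show "F.D.left_adjoint ?v"
        using c d by (intro F.D.left_adjoint_TenA comp_left_adjoint)
      show "?u \<in> hom D (FO F c \<odot>\<^bsub>D\<^esub> FO F d) (FO G c \<odot>\<^bsub>D\<^esub> FO G d)" "?v \<in> hom D (FO F c \<odot>\<^bsub>D\<^esub> FO F d) (FO G c \<odot>\<^bsub>D\<^esub> FO G d)"
        using c d by (simp_all add: hom_def)
      have eps: "\<alpha> c ;;\<^bsub>D\<^esub> F.D.eps (FO G c) = F.D.eps (FO F c)" if "c \<in> Obj C" for c
        using F.D.left_adjoint_eps_eq[OF comp_left_adjoint[OF that]] that by simp
      have "?u ;;\<^bsub>D\<^esub> F.D.pr1 (FO G c) (FO G d) = FM F c d ;;\<^bsub>D\<^esub> (\<alpha> (c \<odot>\<^bsub>C\<^esub> d) ;;\<^bsub>D\<^esub> FA G (F.C.pr1 c d))"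
        using c d by (simp add: F.D.assoc flip: G.FA_pr1)
      also have "\<dots> = (FM F c d ;;\<^bsub>D\<^esub> FA F (F.C.pr1 c d)) ;;\<^bsub>D\<^esub> \<alpha> c"
        using c d by (simp add: F.D.assoc F.C.left_adjoint_pr flip: natural)
      also have "\<dots> = ?v ;;\<^bsub>D\<^esub> F.D.pr1 (FO G c) (FO G d)"
        unfolding F.FA_pr1[OF c d]
        by (rule F.D.pr1_natural[symmetric]) (use c d eps in \<open>simp_all add: hom_def\<close>)
      finally show "?u ;;\<^bsub>D\<^esub> F.D.pr1 (FO G c) (FO G d) = ?v ;;\<^bsub>D\<^esub> F.D.pr1 (FO G c) (FO G d)" .
      have "?u ;;\<^bsub>D\<^esub> F.D.pr2 (FO G c) (FO G d) = FM F c d ;;\<^bsub>D\<^esub> (\<alpha> (c \<odot>\<^bsub>C\<^esub> d) ;;\<^bsub>D\<^esub> FA G (F.C.pr2 c d))"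
        using c d by (simp add: F.D.assoc flip: G.FA_pr2)
      also have "\<dots> = (FM F c d ;;\<^bsub>D\<^esub> FA F (F.C.pr2 c d)) ;;\<^bsub>D\<^esub> \<alpha> d"
        using c d by (simp add: F.D.assoc F.C.left_adjoint_pr flip: natural)
      also have "\<dots> = ?v ;;\<^bsub>D\<^esub> F.D.pr2 (FO G c) (FO G d)"
        unfolding F.FA_pr2[OF c d]
        by (rule F.D.pr2_natural[symmetric]) (use c d eps in \<open>simp_all add: hom_def\<close>)
      finally show "?u ;;\<^bsub>D\<^esub> F.D.pr2 (FO G c) (FO G d) = ?v ;;\<^bsub>D\<^esub> F.D.pr2 (FO G c) (FO G d)" .
    qed (use c d in simp_all)
    then have "?u ;;\<^bsub>D\<^esub> FM G c d = ?v ;;\<^bsub>D\<^esub> FM G c d" by simp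
    then show ?thesis using c d by (simp add: F.D.assoc)
  qed
  ultimately show ?thesis by (simp add: monoidal_transformation_def)
qed

section \<open>The 2-categories\<close>

lemma sm_functor_iff: "sm_functor C D F \<longleftrightarrow> strong_smpofunctor C D F \<and> smpocat C \<and> smpocat D"
  by (auto simp: sm_functor_def)

section \<open>Identities and composites of strong functors\<close>

lemma id_smfun_simps [simp]:
  "c \<in> Obj C \<Longrightarrow> FO (id_smfun C) c = c" "f \<in> Arr C \<Longrightarrow> FA (id_smfun C) f = f" "FU (id_smfun C) = Idn C (Unit C)"
  "\<lbrakk>c \<in> Obj C; d \<in> Obj C\<rbrakk> \<Longrightarrow> FM (id_smfun C) c d = Idn C (c \<odot>\<^bsub>C\<^esub> d)"
  by (simp_all add: id_smfun_def)

lemma comp_smfun_simps [simp]: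
  "c \<in> Obj C \<Longrightarrow> FO (comp_smfun C E F G) c = FO G (FO F c)"
  "f \<in> Arr C \<Longrightarrow> FA (comp_smfun C E F G) f = FA G (FA F f)"
  "FU (comp_smfun C E F G) = FU G ;;\<^bsub>E\<^esub> FA G (FU F)"
  "\<lbrakk>c \<in> Obj C; d \<in> Obj C\<rbrakk> \<Longrightarrow> FM (comp_smfun C E F G) c d = FM G (FO F c) (FO F d) ;;\<^bsub>E\<^esub> FA G (FM F c d)"
  by (simp_all add: comp_smfun_def)

lemma ext_id_smfun: "ext_smfun C (id_smfun C)"
  by (simp add: ext_smfun_def id_smfun_def)

lemma ext_comp_smfun: "ext_smfun C (comp_smfun C E F G)"
  by (simp add: ext_smfun_def comp_smfun_def)

text \<open>Outside the carriers extensional functors take the default value, so agreement on the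
  carriers is equality of records, as strict 2-category laws require.\<close>

lemma smfun_eqI:
  assumes "ext_smfun C F" "ext_smfun C G" "\<And>c. c \<in> Obj C \<Longrightarrow> FO F c = FO G c" "\<And>f. f \<in> Arr C \<Longrightarrow> FA F f = FA G f"
    "FU F = FU G" "\<And>c d. \<lbrakk>c \<in> Obj C; d \<in> Obj C\<rbrakk> \<Longrightarrow> FM F c d = FM G c d"
  shows "F = G"
proof (rule smfun.equality)
  show "FO F = FO G" by (rule extensionalityI[of _ "Obj C"]) (use assms in \<open>auto simp: ext_smfun_def\<close>)
  show "FA F = FA G" by (rule extensionalityI[of _ "Arr C"]) (use assms in \<open>auto simp: ext_smfun_def\<close>)
  show "FM F = FM G"
  proof (rule extensionalityI[of _ "Obj C"])
    fix c assume c: "c \<in> Obj C"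
    show "FM F c = FM G c" by (rule extensionalityI[of _ "Obj C"]) (use assms c in \<open>auto simp: ext_smfun_def\<close>)
  qed (use assms in \<open>auto simp: ext_smfun_def\<close>)
qed (use assms in auto)

lemma sm_functor_id:
  assumes "smpocat C"
  shows "sm_functor C C (id_smfun C)"
proof -
  interpret smpocat C by fact
  have "strong_smpofunctor C C (id_smfun C)"
    by unfold_locales (auto simp: hom_iff monotone_on_def TenA_Idn Dom_in Cod_in)
  then show ?thesis using assms by (simp add: sm_functor_iff)
qed

text \<open>For the associativity and unit axioms, padding with images of identities splits the
  composite strongator. Naturality moves the strongator of \<open>G\<close> outwards, the axiom of
  \<open>F\<close> applies inside \<open>FA G\<close>, and then the axiom of
  \<open>G\<close>.\<close>

lemma sm_functor_comp:
  assumes "sm_functor C D F" "sm_functor D E G"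
  shows "sm_functor C E (comp_smfun C E F G)"
proof -
  interpret F: sm_functor C D F by fact
  interpret G: sm_functor D E G by fact
  have "strong_smpofunctor C E (comp_smfun C E F G)"
  proof
    fix f g a b a' b' assume f: "f \<in> hom C a a'" and g: "g \<in> hom C b b'"
    have ty: "f \<in> Arr C" "Dom C f = a" "Cod C f = a'" "g \<in> Arr C" "Dom C g = b" "Cod C g = b'"
       "a \<in> Obj C" "b \<in> Obj C" "a' \<in> Obj C" "b' \<in> Obj C"
      using f g F.C.hom_obj by (auto simp: hom_def)
    let ?H = "comp_smfun C E F G"
    have "(FA ?H f \<otimes>\<^bsub>E\<^esub> FA ?H g) ;;\<^bsub>E\<^esub> FM ?H a' b'
      = ((FA G (FA F f) \<otimes>\<^bsub>E\<^esub> FA G (FA F g)) ;;\<^bsub>E\<^esub> FM G (FO F a') (FO F b')) ;;\<^bsub>E\<^esub> FA G (FM F a' b')"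
      using ty by (simp add: G.D.assoc)
    also have "\<dots> = FM G (FO F a) (FO F b) ;;\<^bsub>E\<^esub> FA G ((FA F f \<otimes>\<^bsub>D\<^esub> FA F g) ;;\<^bsub>D\<^esub> FM F a' b')"
      using ty by (simp add: G.D.assoc G.FM_natural G.FA_comp)
    also have "\<dots> = FM ?H a b ;;\<^bsub>E\<^esub> FA ?H (f \<otimes>\<^bsub>C\<^esub> g)"
      using ty by (simp add: G.D.assoc F.FM_natural G.FA_comp)
    finally show "(FA ?H f \<otimes>\<^bsub>E\<^esub> FA ?H g) ;;\<^bsub>E\<^esub> FM ?H a' b' = FM ?H a b ;;\<^bsub>E\<^esub> FA ?H (f \<otimes>\<^bsub>C\<^esub> g)" .
  next
    fix a b c assume ob: "a \<in> Obj C" "b \<in> Obj C" "c \<in> Obj C"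
    let ?H = "comp_smfun C E F G"
    let ?i = "Idn E (FO G (FO F c))" and ?j = "Idn E (FO G (FO F a))"
    have "(FM ?H a b \<otimes>\<^bsub>E\<^esub> Idn E (FO ?H c)) ;;\<^bsub>E\<^esub> FM ?H (a \<odot>\<^bsub>C\<^esub> b) c ;;\<^bsub>E\<^esub> FA ?H (Assoc C a b c)
      = ((FM G (FO F a) (FO F b) ;;\<^bsub>E\<^esub> FA G (FM F a b)) \<otimes>\<^bsub>E\<^esub> (?i ;;\<^bsub>E\<^esub> FA G (Idn D (FO F c)))) ;;\<^bsub>E\<^esub>
        (FM G (FO F (a \<odot>\<^bsub>C\<^esub> b)) (FO F c) ;;\<^bsub>E\<^esub> FA G (FM F (a \<odot>\<^bsub>C\<^esub> b) c ;;\<^bsub>D\<^esub> FA F (Assoc C a b c)))"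
      using ob by (simp add: G.D.assoc G.FA_Idn G.FA_comp)
    also have "\<dots> = (FM G (FO F a) (FO F b) \<otimes>\<^bsub>E\<^esub> ?i) ;;\<^bsub>E\<^esub>
        (((FA G (FM F a b) \<otimes>\<^bsub>E\<^esub> FA G (Idn D (FO F c))) ;;\<^bsub>E\<^esub>
        FM G (FO F (a \<odot>\<^bsub>C\<^esub> b)) (FO F c)) ;;\<^bsub>E\<^esub> FA G (FM F (a \<odot>\<^bsub>C\<^esub> b) c ;;\<^bsub>D\<^esub> FA F (Assoc C a b c)))"
      using ob by (subst G.D.exchange[symmetric]) (simp_all add: G.D.assoc)
    also have "\<dots> = (FM G (FO F a) (FO F b) \<otimes>\<^bsub>E\<^esub> ?i) ;;\<^bsub>E\<^esub> (FM G (FO F a \<odot>\<^bsub>D\<^esub> FO F b) (FO F c) ;;\<^bsub>E\<^esub>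
        FA G ((FM F a b \<otimes>\<^bsub>D\<^esub> Idn D (FO F c)) ;;\<^bsub>D\<^esub> FM F (a \<odot>\<^bsub>C\<^esub> b) c ;;\<^bsub>D\<^esub> FA F (Assoc C a b c)))"
      using ob by (subst G.FM_natural[OF _ _ refl refl]) (simp_all add: G.D.assoc F.D.assoc G.FA_comp)
    also have "\<dots> = ((FM G (FO F a) (FO F b) \<otimes>\<^bsub>E\<^esub> ?i) ;;\<^bsub>E\<^esub> FM G (FO F a \<odot>\<^bsub>D\<^esub> FO F b) (FO F c) ;;\<^bsub>E\<^esub>
        FA G (Assoc D (FO F a) (FO F b) (FO F c))) ;;\<^bsub>E\<^esub>
        (FA G (Idn D (FO F a) \<otimes>\<^bsub>D\<^esub> FM F b c) ;;\<^bsub>E\<^esub> FA G (FM F a (b \<odot>\<^bsub>C\<^esub> c)))"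
      using ob by (subst F.FM_Assoc) (simp_all add: G.D.assoc F.D.assoc G.FA_comp)
    also have "\<dots> = Assoc E (FO G (FO F a)) (FO G (FO F b)) (FO G (FO F c)) ;;\<^bsub>E\<^esub> ((?j \<otimes>\<^bsub>E\<^esub> FM G (FO F b) (FO F c)) ;;\<^bsub>E\<^esub>
        ((FM G (FO F a) (FO F b \<odot>\<^bsub>D\<^esub> FO F c) ;;\<^bsub>E\<^esub>
        FA G (Idn D (FO F a) \<otimes>\<^bsub>D\<^esub> FM F b c)) ;;\<^bsub>E\<^esub> FA G (FM F a (b \<odot>\<^bsub>C\<^esub> c))))"
      using ob by (subst G.FM_Assoc) (simp_all add: G.D.assoc)
    also have "\<dots> = Assoc E (FO G (FO F a)) (FO G (FO F b)) (FO G (FO F c)) ;;\<^bsub>E\<^esub> (((?j ;;\<^bsub>E\<^esub> ?j) \<otimes>\<^bsub>E\<^esub>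
        (FM G (FO F b) (FO F c) ;;\<^bsub>E\<^esub> FA G (FM F b c))) ;;\<^bsub>E\<^esub>
        (FM G (FO F a) (FO F (b \<odot>\<^bsub>C\<^esub> c)) ;;\<^bsub>E\<^esub> FA G (FM F a (b \<odot>\<^bsub>C\<^esub> c))))"
      using ob by (subst G.FM_natural[OF _ _ _ _ refl refl, symmetric]) (simp_all add: G.D.assoc G.FA_Idn G.D.exchange_assoc)
    also have "\<dots> = Assoc E (FO ?H a) (FO ?H b) (FO ?H c) ;;\<^bsub>E\<^esub> (Idn E (FO ?H a) \<otimes>\<^bsub>E\<^esub> FM ?H b c) ;;\<^bsub>E\<^esub> FM ?H a (b \<odot>\<^bsub>C\<^esub> c)"
      using ob by (simp add: G.D.assoc)
    finally show "(FM ?H a b \<otimes>\<^bsub>E\<^esub> Idn E (FO ?H c)) ;;\<^bsub>E\<^esub> FM ?H (a \<odot>\<^bsub>C\<^esub> b) c ;;\<^bsub>E\<^esub> FA ?H (Assoc C a b c)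
      = Assoc E (FO ?H a) (FO ?H b) (FO ?H c) ;;\<^bsub>E\<^esub> (Idn E (FO ?H a) \<otimes>\<^bsub>E\<^esub> FM ?H b c) ;;\<^bsub>E\<^esub> FM ?H a (b \<odot>\<^bsub>C\<^esub> c)" .
  next
    fix a assume a: "a \<in> Obj C"
    let ?H = "comp_smfun C E F G"
    let ?i = "Idn E (FO G (FO F a))"
    have "(FU ?H \<otimes>\<^bsub>E\<^esub> Idn E (FO ?H a)) ;;\<^bsub>E\<^esub> FM ?H (Unit C) a ;;\<^bsub>E\<^esub> FA ?H (LUnit C a)
      = ((FU G ;;\<^bsub>E\<^esub> FA G (FU F)) \<otimes>\<^bsub>E\<^esub> (?i ;;\<^bsub>E\<^esub> FA G (Idn D (FO F a)))) ;;\<^bsub>E\<^esub>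
        (FM G (FO F (Unit C)) (FO F a) ;;\<^bsub>E\<^esub> FA G (FM F (Unit C) a ;;\<^bsub>D\<^esub> FA F (LUnit C a)))"
      using a by (simp add: G.D.assoc G.FA_Idn G.FA_comp)
    also have "\<dots> = (FU G \<otimes>\<^bsub>E\<^esub> ?i) ;;\<^bsub>E\<^esub> (((FA G (FU F) \<otimes>\<^bsub>E\<^esub> FA G (Idn D (FO F a))) ;;\<^bsub>E\<^esub>
        FM G (FO F (Unit C)) (FO F a)) ;;\<^bsub>E\<^esub> FA G (FM F (Unit C) a ;;\<^bsub>D\<^esub> FA F (LUnit C a)))"
      using a by (subst G.D.exchange[symmetric]) (simp_all add: G.D.assoc)
    also have "\<dots> = (FU G \<otimes>\<^bsub>E\<^esub> ?i) ;;\<^bsub>E\<^esub> (FM G (Unit D) (FO F a) ;;\<^bsub>E\<^esub>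
        FA G ((FU F \<otimes>\<^bsub>D\<^esub> Idn D (FO F a)) ;;\<^bsub>D\<^esub> FM F (Unit C) a ;;\<^bsub>D\<^esub> FA F (LUnit C a)))"
      using a by (subst G.FM_natural[OF _ _ refl refl]) (simp_all add: G.D.assoc F.D.assoc G.FA_comp)
    also have "\<dots> = LUnit E (FO ?H a)"
      using a by (simp add: F.FM_LUnit G.FM_LUnit flip: G.D.assoc)
    finally show "(FU ?H \<otimes>\<^bsub>E\<^esub> Idn E (FO ?H a)) ;;\<^bsub>E\<^esub> FM ?H (Unit C) a ;;\<^bsub>E\<^esub> FA ?H (LUnit C a) = LUnit E (FO ?H a)" .
    have "(Idn E (FO ?H a) \<otimes>\<^bsub>E\<^esub> FU ?H) ;;\<^bsub>E\<^esub> FM ?H a (Unit C) ;;\<^bsub>E\<^esub> FA ?H (RUnit C a)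
      = ((?i ;;\<^bsub>E\<^esub> FA G (Idn D (FO F a))) \<otimes>\<^bsub>E\<^esub> (FU G ;;\<^bsub>E\<^esub> FA G (FU F))) ;;\<^bsub>E\<^esub>
        (FM G (FO F a) (FO F (Unit C)) ;;\<^bsub>E\<^esub> FA G (FM F a (Unit C) ;;\<^bsub>D\<^esub> FA F (RUnit C a)))"
      using a by (simp add: G.D.assoc G.FA_Idn G.FA_comp)
    also have "\<dots> = (?i \<otimes>\<^bsub>E\<^esub> FU G) ;;\<^bsub>E\<^esub> (((FA G (Idn D (FO F a)) \<otimes>\<^bsub>E\<^esub> FA G (FU F)) ;;\<^bsub>E\<^esub>
        FM G (FO F a) (FO F (Unit C))) ;;\<^bsub>E\<^esub> FA G (FM F a (Unit C) ;;\<^bsub>D\<^esub> FA F (RUnit C a)))"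
      using a by (subst G.D.exchange[symmetric]) (simp_all add: G.D.assoc)
    also have "\<dots> = (?i \<otimes>\<^bsub>E\<^esub> FU G) ;;\<^bsub>E\<^esub> (FM G (FO F a) (Unit D) ;;\<^bsub>E\<^esub>
        FA G ((Idn D (FO F a) \<otimes>\<^bsub>D\<^esub> FU F) ;;\<^bsub>D\<^esub> FM F a (Unit C) ;;\<^bsub>D\<^esub> FA F (RUnit C a)))"
      using a by (subst G.FM_natural[OF _ _ refl refl]) (simp_all add: G.D.assoc F.D.assoc G.FA_comp)
    also have "\<dots> = RUnit E (FO ?H a)"
      using a by (simp add: F.FM_RUnit G.FM_RUnit flip: G.D.assoc)
    finally show "(Idn E (FO ?H a) \<otimes>\<^bsub>E\<^esub> FU ?H) ;;\<^bsub>E\<^esub> FM ?H a (Unit C) ;;\<^bsub>E\<^esub> FA ?H (RUnit C a) = RUnit E (FO ?H a)" .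
  next
    fix a b assume ob: "a \<in> Obj C" "b \<in> Obj C"
    let ?H = "comp_smfun C E F G"
    have "FM ?H a b ;;\<^bsub>E\<^esub> FA ?H (Swap C a b) = FM G (FO F a) (FO F b) ;;\<^bsub>E\<^esub> FA G (FM F a b ;;\<^bsub>D\<^esub> FA F (Swap C a b))"
      using ob by (simp add: G.D.assoc G.FA_comp)
    also have "\<dots> = (FM G (FO F a) (FO F b) ;;\<^bsub>E\<^esub> FA G (Swap D (FO F a) (FO F b))) ;;\<^bsub>E\<^esub> FA G (FM F b a)"
      using ob by (simp add: F.FM_Swap G.D.assoc G.FA_comp)
    also have "\<dots> = Swap E (FO ?H a) (FO ?H b) ;;\<^bsub>E\<^esub> FM ?H b a"
      using ob by (simp add: G.FM_Swap G.D.assoc)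
    finally show "FM ?H a b ;;\<^bsub>E\<^esub> FA ?H (Swap C a b) = Swap E (FO ?H a) (FO ?H b) ;;\<^bsub>E\<^esub> FM ?H b a" .
  qed (auto simp: hom_def monotone_on_def F.FA_Idn G.FA_Idn F.FA_comp G.FA_comp F.FA_Leq G.FA_Leq
      F.C.Dom_in F.C.Cod_in intro!: G.D.iso_Cmp G.FA_iso)
  then show ?thesis using F.C.smpocat_axioms G.D.smpocat_axioms by (simp add: sm_functor_iff)
qed

lemma comp_smfun_id_left: "\<lbrakk>sm_functor C D F; ext_smfun C F\<rbrakk> \<Longrightarrow> comp_smfun C D (id_smfun C) F = F"
proof -
  assume "sm_functor C D F" "ext_smfun C F"
  interpret sm_functor C D F by fact
  show ?thesis
    by (rule smfun_eqI[OF ext_comp_smfun \<open>ext_smfun C F\<close>]) (simp_all add: FA_Idn)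
qed

lemma comp_smfun_id_right: "\<lbrakk>sm_functor C D F; ext_smfun C F\<rbrakk> \<Longrightarrow> comp_smfun C D F (id_smfun D) = F"
proof -
  assume "sm_functor C D F" "ext_smfun C F"
  interpret sm_functor C D F by fact
  show ?thesis
    by (rule smfun_eqI[OF ext_comp_smfun \<open>ext_smfun C F\<close>]) simp_all
qed

lemma comp_smfun_assoc:
  assumes "sm_functor A B F" "sm_functor B C G" "sm_functor C D H"
  shows "comp_smfun A D (comp_smfun A C F G) H = comp_smfun A D F (comp_smfun B D G H)"
proof -
  interpret F: sm_functor A B F by fact
  interpret G: sm_functor B C G by fact
  interpret H: sm_functor C D H by fact
  show ?thesis
    by (rule smfun_eqI[OF ext_comp_smfun ext_comp_smfun]) (simp_all add: H.FA_comp H.D.assoc)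
qed

section \<open>Vertical and horizontal composites of transformations\<close>

lemma left_adjoint_oplaxI:
  assumes "sm_functor C D F" "sm_functor C D G"
    "\<And>c. c \<in> Obj C \<Longrightarrow> \<alpha> c \<in> hom D (FO F c) (FO G c)" "\<And>c. c \<in> Obj C \<Longrightarrow> \<beta> c \<in> hom D (FO G c) (FO F c)"
    "\<And>c d f. f \<in> hom C c d \<Longrightarrow> FA F f ;;\<^bsub>D\<^esub> \<alpha> d \<sqsubseteq>\<^bsub>D\<^esub> \<alpha> c ;;\<^bsub>D\<^esub> FA G f"
    "\<And>c d f. f \<in> hom C c d \<Longrightarrow> FA G f ;;\<^bsub>D\<^esub> \<beta> d \<sqsubseteq>\<^bsub>D\<^esub> \<beta> c ;;\<^bsub>D\<^esub> FA F f"
    "\<And>c. c \<in> Obj C \<Longrightarrow> pocat.ladj D (\<alpha> c) (\<beta> c)"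
  shows "oplax_adjoint C D F G \<alpha>"
proof -
  interpret F: sm_functor C D F by fact
  interpret G: sm_functor C D G by fact
  show ?thesis
  proof
    show "left_adjoint_oplax C D F G \<alpha>"
      unfolding left_adjoint_oplax_def oplax_natural_def
      using assms(3-7) by (auto simp: hom_def F.D.ladj_def intro!: exI[of _ \<beta>])
  qed
qed

lemma (in oplax_adjoint) right_adjoint:
  "\<exists>\<beta>. (\<forall>c \<in> Obj C. \<beta> c \<in> hom D (FO G c) (FO F c)) \<and>
    (\<forall>c d f. f \<in> hom C c d \<longrightarrow> FA G f ;;\<^bsub>D\<^esub> \<beta> d \<sqsubseteq>\<^bsub>D\<^esub> \<beta> c ;;\<^bsub>D\<^esub> FA F f) \<and>
    (\<forall>c \<in> Obj C. F.D.ladj (\<alpha> c) (\<beta> c))"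
proof -
  obtain \<beta> where \<beta>: "oplax_natural C D G F \<beta>"
      "\<forall>c \<in> Obj C. Idn D (FO F c) \<sqsubseteq>\<^bsub>D\<^esub> \<alpha> c ;;\<^bsub>D\<^esub> \<beta> c \<and> \<beta> c ;;\<^bsub>D\<^esub> \<alpha> c \<sqsubseteq>\<^bsub>D\<^esub> Idn D (FO G c)"
    using adj unfolding left_adjoint_oplax_def by blast
  then have "\<forall>c \<in> Obj C. F.D.ladj (\<alpha> c) (\<beta> c)"
    by (simp add: F.D.ladj_def oplax_natural_def)
  with \<beta>(1) show ?thesis unfolding oplax_natural_def by blast
qed

lemma oplax_adjoint_id:
  assumes "sm_functor C D F"
  shows "oplax_adjoint C D F F (id_trans C D F)"
proof -
  interpret sm_functor C D F by fact
  have "D.ladj (Idn D a) (Idn D a)" if "a \<in> Obj D" for a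
    using D.ladj_iso[of "Idn D a"] that by simp
  then show ?thesis
    by (intro left_adjoint_oplaxI[where \<beta> = "id_trans C D F"] assms)
      (auto simp: id_trans_def hom_def C.Dom_in C.Cod_in)
qed

text \<open>Two oplax squares are pasted along their common side \<open>g\<close>. Vertical and
  horizontal composites, and likewise their right adjoints, are instances.\<close>

lemma (in pocat) oplax_paste:
  assumes "f ;; s \<sqsubseteq> r ;; g" "g ;; s' \<sqsubseteq> r' ;; h"
    "f \<in> hom C a b" "s \<in> hom C b b'" "r \<in> hom C a a'" "g \<in> hom C a' b'" "s' \<in> hom C b' b''" "r' \<in> hom C a' a''" "h \<in> hom C a'' b''"
  shows "f ;; (s ;; s') \<sqsubseteq> (r ;; r') ;; h"
proof -
  have ty: "f \<in> Arr C" "s \<in> Arr C" "r \<in> Arr C" "g \<in> Arr C" "s' \<in> Arr C" "r' \<in> Arr C" "h \<in> Arr C"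
    "Dom C f = a" "Cod C f = b" "Dom C s = b" "Cod C s = b'" "Dom C r = a" "Cod C r = a'" "Dom C g = a'" "Cod C g = b'"
    "Dom C s' = b'" "Cod C s' = b''" "Dom C r' = a'" "Cod C r' = a''" "Dom C h = a''" "Cod C h = b''"
    using assms by (auto simp: hom_def)
  have 1: "(f ;; s) ;; s' \<sqsubseteq> (r ;; g) ;; s'"
    by (rule Cmp_mono_left[OF assms(1), of a b' _ b'']) (use ty in \<open>simp_all add: hom_def\<close>)
  have 2: "r ;; (g ;; s') \<sqsubseteq> r ;; (r' ;; h)"
    by (rule Cmp_mono_right[OF assms(2), of _ a a' b'']) (use ty in \<open>simp_all add: hom_def\<close>)
  show ?thesis
    by (rule Leq_trans[of _ "r ;; (g ;; s')" _ a b'']) (use 1 2 ty in \<open>simp_all add: hom_def assoc\<close>)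
qed

lemma oplax_adjoint_vcomp:
  assumes "oplax_adjoint C D F G \<alpha>" "oplax_adjoint C D G H \<beta>"
  shows "oplax_adjoint C D F H (vcomp_trans C D \<alpha> \<beta>)"
proof -
  interpret \<alpha>: oplax_adjoint C D F G \<alpha> by fact
  interpret \<beta>: oplax_adjoint C D G H \<beta> by fact
  obtain \<alpha>' where \<alpha>': "\<And>c. c \<in> Obj C \<Longrightarrow> \<alpha>' c \<in> hom D (FO G c) (FO F c)"
    "\<And>c d f. f \<in> hom C c d \<Longrightarrow> FA G f ;;\<^bsub>D\<^esub> \<alpha>' d \<sqsubseteq>\<^bsub>D\<^esub> \<alpha>' c ;;\<^bsub>D\<^esub> FA F f"
    "\<And>c. c \<in> Obj C \<Longrightarrow> \<alpha>.F.D.ladj (\<alpha> c) (\<alpha>' c)" using \<alpha>.right_adjoint by blast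
  obtain \<beta>' where \<beta>': "\<And>c. c \<in> Obj C \<Longrightarrow> \<beta>' c \<in> hom D (FO H c) (FO G c)"
    "\<And>c d f. f \<in> hom C c d \<Longrightarrow> FA H f ;;\<^bsub>D\<^esub> \<beta>' d \<sqsubseteq>\<^bsub>D\<^esub> \<beta>' c ;;\<^bsub>D\<^esub> FA G f"
    "\<And>c. c \<in> Obj C \<Longrightarrow> \<alpha>.F.D.ladj (\<beta> c) (\<beta>' c)" using \<beta>.right_adjoint by blast
  \<comment> \<open>Right adjoints compose in the reverse order, which gives the witness.\<close>
  show ?thesis
  proof (rule left_adjoint_oplaxI[where \<beta> = "\<lambda>c. \<beta>' c ;;\<^bsub>D\<^esub> \<alpha>' c"])
    fix c assume c: "c \<in> Obj C"
    show "vcomp_trans C D \<alpha> \<beta> c \<in> hom D (FO F c) (FO H c)" using c by (simp add: vcomp_trans_def hom_def)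
    show "\<beta>' c ;;\<^bsub>D\<^esub> \<alpha>' c \<in> hom D (FO H c) (FO F c)" by (rule \<alpha>.F.D.Cmp_in[OF \<beta>'(1)[OF c] \<alpha>'(1)[OF c]])
    show "\<alpha>.F.D.ladj (vcomp_trans C D \<alpha> \<beta> c) (\<beta>' c ;;\<^bsub>D\<^esub> \<alpha>' c)"
      using c \<alpha>.F.D.ladj_Cmp[OF \<alpha>'(3) \<beta>'(3)] by (simp add: vcomp_trans_def)
  next
    fix c d f assume f: "f \<in> hom C c d"
    then have ty: "c \<in> Obj C" "d \<in> Obj C" "f \<in> Arr C" "Dom C f = c" "Cod C f = d" using \<alpha>.F.C.hom_obj by (auto simp: hom_def)
    show "FA F f ;;\<^bsub>D\<^esub> vcomp_trans C D \<alpha> \<beta> d \<sqsubseteq>\<^bsub>D\<^esub> vcomp_trans C D \<alpha> \<beta> c ;;\<^bsub>D\<^esub> FA H f"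
      unfolding vcomp_trans_def using ty
      by (simp, intro \<alpha>.F.D.oplax_paste[OF \<alpha>.oplax \<beta>.oplax]) (auto simp: hom_def)
    show "FA H f ;;\<^bsub>D\<^esub> (\<beta>' d ;;\<^bsub>D\<^esub> \<alpha>' d) \<sqsubseteq>\<^bsub>D\<^esub> (\<beta>' c ;;\<^bsub>D\<^esub> \<alpha>' c) ;;\<^bsub>D\<^esub> FA F f"
      by (rule \<alpha>.F.D.oplax_paste[OF \<beta>'(2)[OF f] \<alpha>'(2)[OF f]]) (use ty \<alpha>' \<beta>' in \<open>auto simp: hom_def\<close>)
  qed (fact \<alpha>.F.sm_functor_axioms \<beta>.G.sm_functor_axioms)+
qed

lemma oplax_adjoint_hcomp:
  assumes "oplax_adjoint C D F G \<alpha>" "oplax_adjoint D E F' G' \<beta>"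
  shows "oplax_adjoint C E (comp_smfun C E F F') (comp_smfun C E G G') (hcomp_trans C E G F' \<alpha> \<beta>)"
proof -
  interpret \<alpha>: oplax_adjoint C D F G \<alpha> by fact
  interpret \<beta>: oplax_adjoint D E F' G' \<beta> by fact
  obtain \<alpha>' where \<alpha>': "\<And>c. c \<in> Obj C \<Longrightarrow> \<alpha>' c \<in> hom D (FO G c) (FO F c)"
    "\<And>c d f. f \<in> hom C c d \<Longrightarrow> FA G f ;;\<^bsub>D\<^esub> \<alpha>' d \<sqsubseteq>\<^bsub>D\<^esub> \<alpha>' c ;;\<^bsub>D\<^esub> FA F f"
    "\<And>c. c \<in> Obj C \<Longrightarrow> \<alpha>.F.D.ladj (\<alpha> c) (\<alpha>' c)" using \<alpha>.right_adjoint by blast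
  obtain \<beta>' where \<beta>': "\<And>c. c \<in> Obj D \<Longrightarrow> \<beta>' c \<in> hom E (FO G' c) (FO F' c)"
    "\<And>c d f. f \<in> hom D c d \<Longrightarrow> FA G' f ;;\<^bsub>E\<^esub> \<beta>' d \<sqsubseteq>\<^bsub>E\<^esub> \<beta>' c ;;\<^bsub>E\<^esub> FA F' f"
    "\<And>c. c \<in> Obj D \<Longrightarrow> \<beta>.F.D.ladj (\<beta> c) (\<beta>' c)" using \<beta>.right_adjoint by blast
  \<comment> \<open>At \<open>c\<close> the composite is \<open>FA F' (\<alpha> c)\<close> followed
    by \<open>\<beta> (FO G c)\<close>; the witness composes the two right adjoints backwards, the
    first one mapped by \<open>F'\<close>.\<close>
  show ?thesis
  proof (rule left_adjoint_oplaxI[where \<beta> = "\<lambda>c. \<beta>' (FO G c) ;;\<^bsub>E\<^esub> FA F' (\<alpha>' c)"])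
    fix c assume c: "c \<in> Obj C"
    have a: "\<alpha>' c \<in> Arr D" "Dom D (\<alpha>' c) = FO G c" "Cod D (\<alpha>' c) = FO F c" using \<alpha>'(1)[OF c] by (auto simp: hom_def)
    have b: "\<beta>' (FO G c) \<in> Arr E" "Dom E (\<beta>' (FO G c)) = FO G' (FO G c)" "Cod E (\<beta>' (FO G c)) = FO F' (FO G c)"
      using \<beta>'(1)[of "FO G c"] c by (auto simp: hom_def)
    show "hcomp_trans C E G F' \<alpha> \<beta> c \<in> hom E (FO (comp_smfun C E F F') c) (FO (comp_smfun C E G G') c)"
      using c by (simp add: hcomp_trans_def hom_def)
    show "\<beta>' (FO G c) ;;\<^bsub>E\<^esub> FA F' (\<alpha>' c) \<in> hom E (FO (comp_smfun C E G G') c) (FO (comp_smfun C E F F') c)"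
      using a b c by (simp add: hom_def)
    show "\<beta>.F.D.ladj (hcomp_trans C E G F' \<alpha> \<beta> c) (\<beta>' (FO G c) ;;\<^bsub>E\<^esub> FA F' (\<alpha>' c))"
      using c \<beta>.F.D.ladj_Cmp[OF \<beta>.F.FA_ladj[OF \<alpha>'(3)] \<beta>'(3)] by (simp add: hcomp_trans_def)
  next
    fix c d f assume f: "f \<in> hom C c d"
    then have ty: "c \<in> Obj C" "d \<in> Obj C" "f \<in> Arr C" "Dom C f = c" "Cod C f = d" using \<alpha>.F.C.hom_obj by (auto simp: hom_def)
    have a: "\<alpha>' c \<in> Arr D" "Dom D (\<alpha>' c) = FO G c" "Cod D (\<alpha>' c) = FO F c"
       "\<alpha>' d \<in> Arr D" "Dom D (\<alpha>' d) = FO G d" "Cod D (\<alpha>' d) = FO F d" using \<alpha>'(1) ty by (auto simp: hom_def)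
    have 1: "FA F' (FA F f) ;;\<^bsub>E\<^esub> FA F' (\<alpha> d) \<sqsubseteq>\<^bsub>E\<^esub> FA F' (\<alpha> c) ;;\<^bsub>E\<^esub> FA F' (FA G f)"
      using \<beta>.F.FA_Leq[OF _ _ _ _ \<alpha>.oplax[OF ty(3-5)]] ty by (simp add: \<beta>.F.FA_comp)
    have 2: "FA F' (FA G f) ;;\<^bsub>E\<^esub> \<beta> (FO G d) \<sqsubseteq>\<^bsub>E\<^esub> \<beta> (FO G c) ;;\<^bsub>E\<^esub> FA G' (FA G f)"
      by (rule \<beta>.oplax) (use ty in simp_all)
    have "FA F' (FA F f) ;;\<^bsub>E\<^esub> (FA F' (\<alpha> d) ;;\<^bsub>E\<^esub> \<beta> (FO G d)) \<sqsubseteq>\<^bsub>E\<^esub> (FA F' (\<alpha> c) ;;\<^bsub>E\<^esub> \<beta> (FO G c)) ;;\<^bsub>E\<^esub> FA G' (FA G f)"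
      by (rule \<beta>.F.D.oplax_paste[OF 1 2]) (use ty in \<open>auto simp: hom_def\<close>)
    then show "FA (comp_smfun C E F F') f ;;\<^bsub>E\<^esub> hcomp_trans C E G F' \<alpha> \<beta> d
        \<sqsubseteq>\<^bsub>E\<^esub> hcomp_trans C E G F' \<alpha> \<beta> c ;;\<^bsub>E\<^esub> FA (comp_smfun C E G G') f"
      using ty by (simp add: hcomp_trans_def)
    have 3: "FA G' (FA G f) ;;\<^bsub>E\<^esub> \<beta>' (FO G d) \<sqsubseteq>\<^bsub>E\<^esub> \<beta>' (FO G c) ;;\<^bsub>E\<^esub> FA F' (FA G f)"
      by (rule \<beta>'(2)) (use ty in \<open>simp add: hom_def\<close>)
    have 4: "FA F' (FA G f) ;;\<^bsub>E\<^esub> FA F' (\<alpha>' d) \<sqsubseteq>\<^bsub>E\<^esub> FA F' (\<alpha>' c) ;;\<^bsub>E\<^esub> FA F' (FA F f)"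
      using \<beta>.F.FA_Leq[OF _ _ _ _ \<alpha>'(2)[OF f]] ty a by (simp add: \<beta>.F.FA_comp)
    have "FA G' (FA G f) ;;\<^bsub>E\<^esub> (\<beta>' (FO G d) ;;\<^bsub>E\<^esub> FA F' (\<alpha>' d)) \<sqsubseteq>\<^bsub>E\<^esub> (\<beta>' (FO G c) ;;\<^bsub>E\<^esub> FA F' (\<alpha>' c)) ;;\<^bsub>E\<^esub> FA F' (FA F f)"
      by (rule \<beta>.F.D.oplax_paste[OF 3 4]) (use ty a \<beta>' in \<open>simp_all add: hom_def\<close>)
    then show "FA (comp_smfun C E G G') f ;;\<^bsub>E\<^esub> (\<beta>' (FO G d) ;;\<^bsub>E\<^esub> FA F' (\<alpha>' d))
        \<sqsubseteq>\<^bsub>E\<^esub> (\<beta>' (FO G c) ;;\<^bsub>E\<^esub> FA F' (\<alpha>' c)) ;;\<^bsub>E\<^esub> FA (comp_smfun C E F F') f"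
      using ty by simp
  qed (fact sm_functor_comp[OF \<alpha>.F.sm_functor_axioms \<beta>.F.sm_functor_axioms]
      sm_functor_comp[OF \<alpha>.G.sm_functor_axioms \<beta>.G.sm_functor_axioms])+
qed

lemma trans_extensional [simp]:
  "id_trans C D F \<in> extensional (Obj C)" "vcomp_trans C D \<alpha> \<beta> \<in> extensional (Obj C)"
  "hcomp_trans C E G F' \<alpha> \<alpha>' \<in> extensional (Obj C)"
  by (simp_all add: id_trans_def vcomp_trans_def hcomp_trans_def)

lemma vcomp_id:
  assumes "oplax_adjoint C D F G \<alpha>" "\<alpha> \<in> extensional (Obj C)"
  shows "vcomp_trans C D (id_trans C D F) \<alpha> = \<alpha>" "vcomp_trans C D \<alpha> (id_trans C D G) = \<alpha>"
proof -
  interpret oplax_adjoint C D F G \<alpha> by fact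
  show "vcomp_trans C D (id_trans C D F) \<alpha> = \<alpha>" "vcomp_trans C D \<alpha> (id_trans C D G) = \<alpha>"
    by (rule extensionalityI[of _ "Obj C"]; use assms in \<open>simp add: vcomp_trans_def id_trans_def\<close>)+
qed

lemma vcomp_assoc:
  assumes "oplax_adjoint C D F G \<alpha>" "oplax_adjoint C D G H \<beta>" "oplax_adjoint C D H L \<gamma>"
  shows "vcomp_trans C D (vcomp_trans C D \<alpha> \<beta>) \<gamma> = vcomp_trans C D \<alpha> (vcomp_trans C D \<beta> \<gamma>)"
proof -
  interpret \<alpha>: oplax_adjoint C D F G \<alpha> by fact
  interpret \<beta>: oplax_adjoint C D G H \<beta> by fact
  interpret \<gamma>: oplax_adjoint C D H L \<gamma> by fact
  show ?thesis
    by (rule extensionalityI[of _ "Obj C"]) (simp_all add: vcomp_trans_def \<alpha>.F.D.assoc)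
qed

lemma hcomp_id:
  assumes "oplax_adjoint C D F G \<alpha>" "\<alpha> \<in> extensional (Obj C)"
  shows "hcomp_trans C D (id_smfun C) F (id_trans C C (id_smfun C)) \<alpha> = \<alpha>"
    "hcomp_trans C D G (id_smfun D) \<alpha> (id_trans D D (id_smfun D)) = \<alpha>"
proof -
  interpret oplax_adjoint C D F G \<alpha> by fact
  show "hcomp_trans C D (id_smfun C) F (id_trans C C (id_smfun C)) \<alpha> = \<alpha>"
    "hcomp_trans C D G (id_smfun D) \<alpha> (id_trans D D (id_smfun D)) = \<alpha>"
    by (rule extensionalityI[of _ "Obj C"]; use assms in \<open>simp add: hcomp_trans_def id_trans_def F.FA_Idn\<close>)+
qed

lemma hcomp_assoc:
  assumes "oplax_adjoint A B F G \<alpha>" "oplax_adjoint B C F' G' \<alpha>'" "oplax_adjoint C D F'' G'' \<alpha>''"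
  shows "hcomp_trans A D (comp_smfun A C G G') F'' (hcomp_trans A C G F' \<alpha> \<alpha>') \<alpha>'' =
    hcomp_trans A D G (comp_smfun B D F' F'') \<alpha> (hcomp_trans B D G' F'' \<alpha>' \<alpha>'')"
proof -
  interpret \<alpha>: oplax_adjoint A B F G \<alpha> by fact
  interpret \<alpha>': oplax_adjoint B C F' G' \<alpha>' by fact
  interpret \<alpha>'': oplax_adjoint C D F'' G'' \<alpha>'' by fact
  show ?thesis
    by (rule extensionalityI[of _ "Obj A"]) (simp_all add: hcomp_trans_def \<alpha>''.F.D.assoc \<alpha>''.F.FA_comp)
qed

lemma hcomp_id_id:
  assumes "sm_functor C D F" "sm_functor D E G"
  shows "hcomp_trans C E F G (id_trans C D F) (id_trans D E G) = id_trans C E (comp_smfun C E F G)"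
proof -
  interpret F: sm_functor C D F by fact
  interpret G: sm_functor D E G by fact
  show ?thesis
    by (rule extensionalityI[of _ "Obj C"]) (simp_all add: hcomp_trans_def id_trans_def G.FA_Idn)
qed

text \<open>The two sides differ by the naturality square of \<open>\<alpha>'\<close> at
  \<open>\<beta> c\<close>. It commutes strictly because \<open>\<beta> c\<close> is a left adjoint;
  oplaxness alone would give an inequality.\<close>

lemma interchange_trans:
  assumes "oplax_adjoint C D F G \<alpha>" "oplax_adjoint C D G H \<beta>" "oplax_adjoint D E F' G' \<alpha>'" "oplax_adjoint D E G' H' \<beta>'"
  shows "hcomp_trans C E H F' (vcomp_trans C D \<alpha> \<beta>) (vcomp_trans D E \<alpha>' \<beta>') =
    vcomp_trans C E (hcomp_trans C E G F' \<alpha> \<alpha>') (hcomp_trans C E H G' \<beta> \<beta>')"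
proof -
  interpret \<alpha>: oplax_adjoint C D F G \<alpha> by fact
  interpret \<beta>: oplax_adjoint C D G H \<beta> by fact
  interpret \<alpha>': oplax_adjoint D E F' G' \<alpha>' by fact
  interpret \<beta>': oplax_adjoint D E G' H' \<beta>' by fact
  show ?thesis
  proof (rule extensionalityI[of _ "Obj C"])
    fix c assume c: "c \<in> Obj C"
    have "hcomp_trans C E H F' (vcomp_trans C D \<alpha> \<beta>) (vcomp_trans D E \<alpha>' \<beta>') c
      = FA F' (\<alpha> c) ;;\<^bsub>E\<^esub> ((FA F' (\<beta> c) ;;\<^bsub>E\<^esub> \<alpha>' (FO H c)) ;;\<^bsub>E\<^esub> \<beta>' (FO H c))"
      using c by (simp add: hcomp_trans_def vcomp_trans_def \<alpha>'.F.D.assoc \<alpha>'.F.FA_comp)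
    also have "FA F' (\<beta> c) ;;\<^bsub>E\<^esub> \<alpha>' (FO H c) = \<alpha>' (FO G c) ;;\<^bsub>E\<^esub> FA G' (\<beta> c)"
      by (rule \<alpha>'.natural) (use c \<beta>.comp_left_adjoint in simp_all)
    finally show "hcomp_trans C E H F' (vcomp_trans C D \<alpha> \<beta>) (vcomp_trans D E \<alpha>' \<beta>') c
      = vcomp_trans C E (hcomp_trans C E G F' \<alpha> \<alpha>') (hcomp_trans C E H G' \<beta> \<beta>') c"
      using c by (simp add: hcomp_trans_def vcomp_trans_def \<alpha>'.F.D.assoc)
  qed simp_all
qed

section \<open>The 2-category of prerelational po-categories\<close>

lemma PrlPoCat_simps:
  "R \<in> Ob PrlPoCat \<longleftrightarrow> prerelational R"
  "\<lbrakk>R \<in> Ob PrlPoCat; R' \<in> Ob PrlPoCat\<rbrakk> \<Longrightarrow> F \<in> H1 PrlPoCat R R' \<longleftrightarrow> sm_functor R R' F \<and> ext_smfun R F"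
  "\<lbrakk>R \<in> Ob PrlPoCat; R' \<in> Ob PrlPoCat; F \<in> H1 PrlPoCat R R'; G \<in> H1 PrlPoCat R R'\<rbrakk> \<Longrightarrow>
     \<alpha> \<in> H2 PrlPoCat R R' F G \<longleftrightarrow> \<alpha> \<in> extensional (Obj R) \<and> oplax_adjoint R R' F G \<alpha>"
  by (auto simp: PrlPoCat_def sm_functor_iff oplax_adjoint_def oplax_adjoint_axioms_def prerelational_def supplies_W_def)

lemma sm_functor_id_prl: "R \<in> Ob PrlPoCat \<Longrightarrow> sm_functor R R (id_smfun R)"
  by (rule sm_functor_id) (simp add: PrlPoCat_simps(1) prerelational_def supplies_W_def)

lemma PrlPoCat_H2I:
  "\<lbrakk>\<alpha> \<in> extensional (Obj R); oplax_adjoint R R' F G \<alpha>\<rbrakk> \<Longrightarrow> \<alpha> \<in> H2 PrlPoCat R R' F G"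
  by (auto simp: PrlPoCat_def oplax_adjoint_def oplax_adjoint_axioms_def)

lemma PrlPoCat_ops:
  "I1 PrlPoCat = id_smfun" "C1 PrlPoCat R R' R'' F G = comp_smfun R R'' F G" "I2 PrlPoCat = id_trans"
  "VC PrlPoCat R R' F G H \<alpha> \<beta> = vcomp_trans R R' \<alpha> \<beta>"
  "HC PrlPoCat R R' R'' F G F' G' \<alpha> \<alpha>' = hcomp_trans R R'' G F' \<alpha> \<alpha>'"
  by (simp_all add: PrlPoCat_def)

lemma two_category_PrlPoCat:
  "two_category (PrlPoCat :: (('o, 'a) scat, ('o, 'a, 'o, 'a) smfun, 'o \<Rightarrow> 'a) twocat)" (is "two_category ?K")
  by (unfold_locales, unfold PrlPoCat_ops)
  (auto simp: PrlPoCat_simps(2,3) ext_id_smfun ext_comp_smfun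
    intro: PrlPoCat_H2I oplax_adjoint_id oplax_adjoint_vcomp oplax_adjoint_hcomp sm_functor_id_prl sm_functor_comp
    comp_smfun_id_left comp_smfun_id_right comp_smfun_assoc vcomp_id vcomp_assoc hcomp_id hcomp_assoc hcomp_id_id interchange_trans)

section \<open>The 2-category of regular calculi\<close>

lemma tpow_fun_id:
  assumes "smpocat C" "c \<in> Obj C"
  shows "tpow_fun C C (id_smfun C) c n = Idn C (tpow C c n)"
proof -
  interpret smpocat C by fact
  show ?thesis
  proof (induction n)
    case (Suc n)
    then show ?case using assms(2) tpow_Obj[of c n] by (cases n) (simp_all add: TenA_Idn)
  qed simp
qed

lemma preserves_supply_id:
  assumes "supplies_W C"
  shows "preserves_supply C C (id_smfun C)"
proof -
  interpret supplies_W C by fact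
  show ?thesis
    using Supply_simps by (auto simp: preserves_supply_def tpow_fun_id[OF smpocat_axioms])
qed

text \<open>In the inductive step the newest strongator of \<open>G\<close> is slid by naturality
  past the image of the iterated strongator of \<open>F\<close>.\<close>

lemma tpow_fun_comp:
  assumes "sm_functor C D F" "sm_functor D E G" and c: "c \<in> Obj C"
  shows "tpow_fun C E (comp_smfun C E F G) c n = tpow_fun D E G (FO F c) n ;;\<^bsub>E\<^esub> FA G (tpow_fun C D F c n)"
proof -
  interpret F: sm_functor C D F by fact
  interpret G: sm_functor D E G by fact
  show ?thesis
  proof (induction n)
    case (Suc n)
    show ?case
    proof (cases n)
      case 0
      then show ?thesis using c by (simp add: G.FA_Idn)
    next
      case (Suc m)
      let ?T = "tpow_fun D E G (FO F c) (Suc m)" and ?t = "tpow_fun C D F c (Suc m)"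
      let ?y = "tpow C c (Suc m)" and ?z = "tpow D (FO F c) (Suc m)" and ?i = "Idn E (FO G (FO F c))"
      have ob: "?y \<in> Obj C" "?z \<in> Obj D" "FO F c \<in> Obj D" by (simp_all only: F.C.tpow_Obj[OF c] F.D.tpow_Obj[OF F.FO_in[OF c]] F.FO_in[OF c])
      have T: "?T \<in> Arr E" "Dom E ?T = tpow E (FO G (FO F c)) (Suc m)" "Cod E ?T = FO G ?z"
        and t: "?t \<in> Arr D" "Dom D ?t = ?z" "Cod D ?t = FO F ?y"
        by (simp_all only: F.tpow_fun_simps[OF c] G.tpow_fun_simps[OF F.FO_in[OF c]])
      have "tpow_fun C E (comp_smfun C E F G) c (Suc (Suc m))
        = ((?T ;;\<^bsub>E\<^esub> FA G ?t) \<otimes>\<^bsub>E\<^esub> (?i ;;\<^bsub>E\<^esub> FA G (Idn D (FO F c)))) ;;\<^bsub>E\<^esub> (FM G (FO F ?y) (FO F c) ;;\<^bsub>E\<^esub> FA G (FM F ?y c))"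
        using Suc.IH[unfolded Suc] c ob by (simp add: G.FA_Idn del: tpow_fun.simps(2) tpow.simps)
      also have "\<dots> = (?T \<otimes>\<^bsub>E\<^esub> ?i) ;;\<^bsub>E\<^esub> (((FA G ?t \<otimes>\<^bsub>E\<^esub> FA G (Idn D (FO F c))) ;;\<^bsub>E\<^esub> FM G (FO F ?y) (FO F c)) ;;\<^bsub>E\<^esub> FA G (FM F ?y c))"
        using c ob T t by (subst G.D.exchange[symmetric]) (simp_all add: G.D.assoc del: tpow_fun.simps tpow.simps)
      also have "(FA G ?t \<otimes>\<^bsub>E\<^esub> FA G (Idn D (FO F c))) ;;\<^bsub>E\<^esub> FM G (FO F ?y) (FO F c) = FM G ?z (FO F c) ;;\<^bsub>E\<^esub> FA G (?t \<otimes>\<^bsub>D\<^esub> Idn D (FO F c))"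
        by (rule G.FM_natural) (use c ob t in \<open>simp_all del: tpow_fun.simps tpow.simps\<close>)
      also have "(?T \<otimes>\<^bsub>E\<^esub> ?i) ;;\<^bsub>E\<^esub> ((FM G ?z (FO F c) ;;\<^bsub>E\<^esub> FA G (?t \<otimes>\<^bsub>D\<^esub> Idn D (FO F c))) ;;\<^bsub>E\<^esub> FA G (FM F ?y c))
        = tpow_fun D E G (FO F c) (Suc (Suc m)) ;;\<^bsub>E\<^esub> FA G (tpow_fun C D F c (Suc (Suc m)))"
        using c ob T t by (simp add: G.D.assoc G.FA_comp del: tpow_fun.simps(2) tpow.simps)
      finally show ?thesis unfolding Suc .
    qed
  qed simp
qed

lemma preserves_supply_comp:
  assumes "sm_functor C D F" "sm_functor D E G" "supplies_W C" "supplies_W D"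
    "supplies_W E" "preserves_supply C D F" "preserves_supply D E G"
  shows "preserves_supply C E (comp_smfun C E F G)"
  unfolding preserves_supply_def
proof (intro ballI allI)
  interpret F: sm_functor C D F by fact
  interpret G: sm_functor D E G by fact
  interpret C: supplies_W C by fact
  interpret D: supplies_W D by fact
  interpret E: supplies_W E by fact
  fix c m n w assume c: "c \<in> Obj C" and w: "w \<in> hom W m n"
  have F: "Supply D (FO F c) w ;;\<^bsub>D\<^esub> tpow_fun C D F c n = tpow_fun C D F c m ;;\<^bsub>D\<^esub> FA F (Supply C c w)"
    using assms(6) c w unfolding preserves_supply_def by blast
  have G: "Supply E (FO G (FO F c)) w ;;\<^bsub>E\<^esub> tpow_fun D E G (FO F c) n = tpow_fun D E G (FO F c) m ;;\<^bsub>E\<^esub> FA G (Supply D (FO F c) w)"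
    using assms(7) c w F.FO_in unfolding preserves_supply_def by blast
  note ty = c C.Supply_simps[OF c w] D.Supply_simps[OF F.FO_in[OF c] w] E.Supply_simps[OF G.FO_in[OF F.FO_in[OF c]] w]
  have "Supply E (FO (comp_smfun C E F G) c) w ;;\<^bsub>E\<^esub> tpow_fun C E (comp_smfun C E F G) c n
    = (Supply E (FO G (FO F c)) w ;;\<^bsub>E\<^esub> tpow_fun D E G (FO F c) n) ;;\<^bsub>E\<^esub> FA G (tpow_fun C D F c n)"
    using ty by (simp add: tpow_fun_comp[OF assms(1,2)] G.D.assoc)
  also have "\<dots> = tpow_fun D E G (FO F c) m ;;\<^bsub>E\<^esub> FA G (Supply D (FO F c) w ;;\<^bsub>D\<^esub> tpow_fun C D F c n)"
    using ty by (simp add: G G.D.assoc G.FA_comp)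
  also have "\<dots> = tpow_fun C E (comp_smfun C E F G) c m ;;\<^bsub>E\<^esub> FA (comp_smfun C E F G) (Supply C c w)"
    using ty by (simp add: F G.D.assoc G.FA_comp tpow_fun_comp[OF assms(1,2)])
  finally show "Supply E (FO (comp_smfun C E F G) c) w ;;\<^bsub>E\<^esub> tpow_fun C E (comp_smfun C E F G) c n
    = tpow_fun C E (comp_smfun C E F G) c m ;;\<^bsub>E\<^esub> FA (comp_smfun C E F G) (Supply C c w)" .
qed

lemma monoidal_id:
  assumes "sm_functor C D F"
  shows "monoidal_transformation C D F F (id_trans C D F)"
proof -
  interpret sm_functor C D F by fact
  show ?thesis by (simp add: monoidal_transformation_def id_trans_def D.TenA_Idn)
qed

lemma monoidal_vcomp:
  assumes "oplax_adjoint C D F G \<alpha>" "oplax_adjoint C D G H \<beta>"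
    "monoidal_transformation C D F G \<alpha>" "monoidal_transformation C D G H \<beta>"
  shows "monoidal_transformation C D F H (vcomp_trans C D \<alpha> \<beta>)"
  unfolding monoidal_transformation_def
proof (intro conjI ballI)
  interpret \<alpha>: oplax_adjoint C D F G \<alpha> by fact
  interpret \<beta>: oplax_adjoint C D G H \<beta> by fact
  have U: "FU F ;;\<^bsub>D\<^esub> \<alpha> (Unit C) = FU G" "FU G ;;\<^bsub>D\<^esub> \<beta> (Unit C) = FU H"
    using assms(3,4) by (simp_all add: monoidal_transformation_def)
  then show "FU F ;;\<^bsub>D\<^esub> vcomp_trans C D \<alpha> \<beta> (Unit C) = FU H"
    by (simp add: vcomp_trans_def flip: \<alpha>.F.D.assoc)
  fix c d assume c: "c \<in> Obj C" and d: "d \<in> Obj C"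
  have 1: "FM F c d ;;\<^bsub>D\<^esub> \<alpha> (c \<odot>\<^bsub>C\<^esub> d) = (\<alpha> c \<otimes>\<^bsub>D\<^esub> \<alpha> d) ;;\<^bsub>D\<^esub> FM G c d"
    and 2: "FM G c d ;;\<^bsub>D\<^esub> \<beta> (c \<odot>\<^bsub>C\<^esub> d) = (\<beta> c \<otimes>\<^bsub>D\<^esub> \<beta> d) ;;\<^bsub>D\<^esub> FM H c d"
    using assms(3,4) c d by (simp_all add: monoidal_transformation_def)
  have "FM F c d ;;\<^bsub>D\<^esub> vcomp_trans C D \<alpha> \<beta> (c \<odot>\<^bsub>C\<^esub> d) = (FM F c d ;;\<^bsub>D\<^esub> \<alpha> (c \<odot>\<^bsub>C\<^esub> d)) ;;\<^bsub>D\<^esub> \<beta> (c \<odot>\<^bsub>C\<^esub> d)"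
    using c d by (simp add: vcomp_trans_def \<alpha>.F.D.assoc)
  also have "\<dots> = (\<alpha> c \<otimes>\<^bsub>D\<^esub> \<alpha> d) ;;\<^bsub>D\<^esub> ((\<beta> c \<otimes>\<^bsub>D\<^esub> \<beta> d) ;;\<^bsub>D\<^esub> FM H c d)"
    unfolding 1 using c d by (simp add: \<alpha>.F.D.assoc 2)
  also have "\<dots> = (vcomp_trans C D \<alpha> \<beta> c \<otimes>\<^bsub>D\<^esub> vcomp_trans C D \<alpha> \<beta> d) ;;\<^bsub>D\<^esub> FM H c d"
    using c d by (simp add: vcomp_trans_def \<alpha>.F.D.exchange_assoc)
  finally show "FM F c d ;;\<^bsub>D\<^esub> vcomp_trans C D \<alpha> \<beta> (c \<odot>\<^bsub>C\<^esub> d) = (vcomp_trans C D \<alpha> \<beta> c \<otimes>\<^bsub>D\<^esub> vcomp_trans C D \<alpha> \<beta> d) ;;\<^bsub>D\<^esub> FM H c d" .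
qed

lemma monoidal_hcomp:
  assumes "oplax_adjoint C D F G \<alpha>" "oplax_adjoint D E F' G' \<beta>"
    "monoidal_transformation C D F G \<alpha>" "monoidal_transformation D E F' G' \<beta>"
  shows "monoidal_transformation C E (comp_smfun C E F F') (comp_smfun C E G G') (hcomp_trans C E G F' \<alpha> \<beta>)"
  unfolding monoidal_transformation_def
proof (intro conjI ballI)
  interpret \<alpha>: oplax_adjoint C D F G \<alpha> by fact
  interpret \<beta>: oplax_adjoint D E F' G' \<beta> by fact
  have U: "FU F ;;\<^bsub>D\<^esub> \<alpha> (Unit C) = FU G" "FU F' ;;\<^bsub>E\<^esub> \<beta> (Unit D) = FU G'"
    using assms(3,4) by (simp_all add: monoidal_transformation_def)
  \<comment> \<open>Strongators of \<open>G\<close> are isomorphisms, hence left adjoints, so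
    \<open>\<beta>\<close> passes strictly over \<open>FU G\<close> and
    \<open>FM G c d\<close>.\<close>
  have nat: "FA F' f ;;\<^bsub>E\<^esub> \<beta> (Cod D f) = \<beta> (Dom D f) ;;\<^bsub>E\<^esub> FA G' f" if "iso D f" for f
    by (rule \<beta>.natural[OF \<alpha>.F.D.left_adjoint_iso[OF that] refl refl])
  have "FU (comp_smfun C E F F') ;;\<^bsub>E\<^esub> hcomp_trans C E G F' \<alpha> \<beta> (Unit C)
    = FU F' ;;\<^bsub>E\<^esub> (FA F' (FU F ;;\<^bsub>D\<^esub> \<alpha> (Unit C)) ;;\<^bsub>E\<^esub> \<beta> (FO G (Unit C)))"
    by (simp add: hcomp_trans_def \<beta>.F.D.assoc \<beta>.F.FA_comp)
  also have "\<dots> = (FU F' ;;\<^bsub>E\<^esub> \<beta> (Unit D)) ;;\<^bsub>E\<^esub> FA G' (FU G)"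
    using nat[of "FU G"] by (simp add: U(1) \<beta>.F.D.assoc)
  also have "\<dots> = FU (comp_smfun C E G G')" by (simp add: U(2))
  finally show "FU (comp_smfun C E F F') ;;\<^bsub>E\<^esub> hcomp_trans C E G F' \<alpha> \<beta> (Unit C) = FU (comp_smfun C E G G')" .
  fix c d assume c: "c \<in> Obj C" and d: "d \<in> Obj C"
  have 1: "FM F c d ;;\<^bsub>D\<^esub> \<alpha> (c \<odot>\<^bsub>C\<^esub> d) = (\<alpha> c \<otimes>\<^bsub>D\<^esub> \<alpha> d) ;;\<^bsub>D\<^esub> FM G c d"
    using assms(3) c d by (simp add: monoidal_transformation_def)
  have 2: "FM F' (FO G c) (FO G d) ;;\<^bsub>E\<^esub> \<beta> (FO G c \<odot>\<^bsub>D\<^esub> FO G d) =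
      (\<beta> (FO G c) \<otimes>\<^bsub>E\<^esub> \<beta> (FO G d)) ;;\<^bsub>E\<^esub> FM G' (FO G c) (FO G d)"
    using assms(4) c d by (simp add: monoidal_transformation_def)
  let ?h = "hcomp_trans C E G F' \<alpha> \<beta>"
  have "FM (comp_smfun C E F F') c d ;;\<^bsub>E\<^esub> ?h (c \<odot>\<^bsub>C\<^esub> d)
    = FM F' (FO F c) (FO F d) ;;\<^bsub>E\<^esub> (FA F' (FM F c d ;;\<^bsub>D\<^esub> \<alpha> (c \<odot>\<^bsub>C\<^esub> d)) ;;\<^bsub>E\<^esub> \<beta> (FO G (c \<odot>\<^bsub>C\<^esub> d)))"
    using c d by (simp add: hcomp_trans_def \<beta>.F.D.assoc \<beta>.F.FA_comp)
  also have "\<dots> = (FM F' (FO F c) (FO F d) ;;\<^bsub>E\<^esub> FA F' (\<alpha> c \<otimes>\<^bsub>D\<^esub> \<alpha> d)) ;;\<^bsub>E\<^esub> (FA F' (FM G c d) ;;\<^bsub>E\<^esub> \<beta> (FO G (c \<odot>\<^bsub>C\<^esub> d)))"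
    unfolding 1 using c d by (simp add: \<beta>.F.D.assoc \<beta>.F.FA_comp)
  also have "FA F' (FM G c d) ;;\<^bsub>E\<^esub> \<beta> (FO G (c \<odot>\<^bsub>C\<^esub> d)) = \<beta> (FO G c \<odot>\<^bsub>D\<^esub> FO G d) ;;\<^bsub>E\<^esub> FA G' (FM G c d)"
    using nat[of "FM G c d"] c d by simp
  also have "FM F' (FO F c) (FO F d) ;;\<^bsub>E\<^esub> FA F' (\<alpha> c \<otimes>\<^bsub>D\<^esub> \<alpha> d)
      = (FA F' (\<alpha> c) \<otimes>\<^bsub>E\<^esub> FA F' (\<alpha> d)) ;;\<^bsub>E\<^esub> FM F' (FO G c) (FO G d)"
    by (rule \<beta>.F.FM_natural[symmetric]) (use c d in simp_all)
  also have "((FA F' (\<alpha> c) \<otimes>\<^bsub>E\<^esub> FA F' (\<alpha> d)) ;;\<^bsub>E\<^esub> FM F' (FO G c) (FO G d)) ;;\<^bsub>E\<^esub> (\<beta> (FO G c \<odot>\<^bsub>D\<^esub> FO G d) ;;\<^bsub>E\<^esub> FA G' (FM G c d))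
      = (FA F' (\<alpha> c) \<otimes>\<^bsub>E\<^esub> FA F' (\<alpha> d)) ;;\<^bsub>E\<^esub> ((FM F' (FO G c) (FO G d) ;;\<^bsub>E\<^esub> \<beta> (FO G c \<odot>\<^bsub>D\<^esub> FO G d)) ;;\<^bsub>E\<^esub> FA G' (FM G c d))"
    using c d by (simp add: \<beta>.F.D.assoc)
  also have "\<dots> = (?h c \<otimes>\<^bsub>E\<^esub> ?h d) ;;\<^bsub>E\<^esub> FM (comp_smfun C E G G') c d"
    unfolding 2 using c d by (simp add: hcomp_trans_def \<beta>.F.D.assoc \<beta>.F.D.exchange_assoc)
  finally show "FM (comp_smfun C E F F') c d ;;\<^bsub>E\<^esub> ?h (c \<odot>\<^bsub>C\<^esub> d) = (?h c \<otimes>\<^bsub>E\<^esub> ?h d) ;;\<^bsub>E\<^esub> FM (comp_smfun C E G G') c d" .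
qed

section \<open>Morphisms and 2-morphisms of regular calculi, elementwise\<close>

context lax_smpofunctor
begin

lemma PA_car: "\<lbrakk>f \<in> hom C c d; x \<in> car (PO P c)\<rbrakk> \<Longrightarrow> PA P f x \<in> car (PO P d)"
  using PA_in[of f c d] by (auto simp: poset_maps_def)

lemma PA_ple: "\<lbrakk>f \<in> hom C c d; x \<in> car (PO P c); y \<in> car (PO P c); ple (PO P c) x y\<rbrakk>
    \<Longrightarrow> ple (PO P d) (PA P f x) (PA P f y)"
  using PA_in[of f c d] by (auto simp: poset_maps_def monotone_on_def)

lemma PM_car: "\<lbrakk>c \<in> Obj C; d \<in> Obj C; x \<in> car (PO P c); y \<in> car (PO P d)\<rbrakk> \<Longrightarrow> PM P c d (x, y) \<in> car (PO P (c \<odot> d))"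
  using PM_in[of c d] by (auto simp: poset_maps_def prod_poset_def)

lemma PU_car: "PU P () \<in> car (PO P (Unit C))"
  using PU_in by (auto simp: poset_maps_def one_poset_def)

lemma ple_refl: "\<lbrakk>c \<in> Obj C; x \<in> car (PO P c)\<rbrakk> \<Longrightarrow> ple (PO P c) x x"
  using PO_poset[of c] by (auto simp: is_poset_def reflp_on_def)

lemma ple_trans: "\<lbrakk>ple (PO P c) x y; ple (PO P c) y z; c \<in> Obj C; x \<in> car (PO P c); y \<in> car (PO P c); z \<in> car (PO P c)\<rbrakk>
    \<Longrightarrow> ple (PO P c) x z"
  using PO_poset[of c] unfolding is_poset_def by (blast dest: transp_onD)

end

text \<open>Membership in \<open>rcalc_mors\<close> recast as a locale, with \<open>S\<close> the
  second component; the typing rules of \<open>F\<close> and elementwise rules for \<open>S\<close>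
  are then available together.\<close>

locale rc_mor = X: regular_calculus C P + Y: regular_calculus C' P' + sm_functor C C' F
  for C :: "('o, 'a) scat" and P :: "('o, 'a, 'p) laxfun" and C' :: "('o, 'a) scat" and P' :: "('o, 'a, 'p) laxfun"
    and F :: "('o, 'a, 'o, 'a) smfun" +
  fixes S :: "'o \<Rightarrow> 'p \<Rightarrow> 'p"
  assumes pres: "preserves_supply C C' F" and ext: "ext_smfun C F"
    and nat: "monoidal_2natural C P (pre_laxfun F P') S"
    and S_ext: "S \<in> extensional (Obj C)" "\<And>c. c \<in> Obj C \<Longrightarrow> S c \<in> extensional (car (PO P c))"
begin

lemma S_car: "\<lbrakk>c \<in> Obj C; x \<in> car (PO P c)\<rbrakk> \<Longrightarrow> S c x \<in> car (PO P' (FO F c))"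
  using nat by (auto simp: monoidal_2natural_def pre_laxfun_def poset_maps_def)

lemma S_ple: "\<lbrakk>c \<in> Obj C; x \<in> car (PO P c); y \<in> car (PO P c); ple (PO P c) x y\<rbrakk> \<Longrightarrow> ple (PO P' (FO F c)) (S c x) (S c y)"
  using nat by (auto simp: monoidal_2natural_def pre_laxfun_def poset_maps_def monotone_on_def)

lemma S_PA: "\<lbrakk>f \<in> hom C c d; x \<in> car (PO P c)\<rbrakk> \<Longrightarrow> S d (PA P f x) = PA P' (FA F f) (S c x)"
  using nat by (simp add: monoidal_2natural_def pre_laxfun_def)

lemma S_PU: "S (Unit C) (PU P ()) = PA P' (FU F) (PU P' ())"
  using nat by (simp add: monoidal_2natural_def pre_laxfun_def)

lemma S_PM: "\<lbrakk>c \<in> Obj C; d \<in> Obj C; x \<in> car (PO P c); y \<in> car (PO P d)\<rbrakk>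
    \<Longrightarrow> S (c \<odot>\<^bsub>C\<^esub> d) (PM P c d (x, y)) = PA P' (FM F c d) (PM P' (FO F c) (FO F d) (S c x, S d y))"
  using nat by (simp add: monoidal_2natural_def pre_laxfun_def)

end

lemma sharp_eqI:
  assumes "S \<in> extensional A" "T \<in> extensional A" "\<And>c. c \<in> A \<Longrightarrow> S c \<in> extensional (B c)" "\<And>c. c \<in> A \<Longrightarrow> T c \<in> extensional (B c)"
    "\<And>c x. \<lbrakk>c \<in> A; x \<in> B c\<rbrakk> \<Longrightarrow> S c x = T c x"
  shows "S = T"
proof (rule extensionalityI[OF assms(1,2)])
  show "S c = T c" if "c \<in> A" for c
    by (rule extensionalityI[OF assms(3,4)[OF that]]) (use assms(5) that in blast)
qed

text \<open>Named second component of the identity 1-cell, so that \<open>RgCalc_ops\<close>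
  rewrites to constants rather than to lambda terms; \<open>comp_sharp\<close> plays the same role
  for composites.\<close>

definition id_sharp :: "('o, 'a) scat \<Rightarrow> ('o, 'a, 'p) laxfun \<Rightarrow> 'o \<Rightarrow> 'p \<Rightarrow> 'p" where
  "id_sharp C P = (\<lambda>c \<in> Obj C. \<lambda>x \<in> car (PO P c). x)"

definition comp_sharp :: "('o, 'a) scat \<Rightarrow> ('o, 'a, 'p) laxfun \<Rightarrow> ('o, 'a, 'o, 'a) smfun
    \<Rightarrow> ('o \<Rightarrow> 'p \<Rightarrow> 'p) \<Rightarrow> ('o \<Rightarrow> 'p \<Rightarrow> 'p) \<Rightarrow> 'o \<Rightarrow> 'p \<Rightarrow> 'p" where
  "comp_sharp C P F S T = (\<lambda>c \<in> Obj C. \<lambda>x \<in> car (PO P c). T (FO F c) (S c x))"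

lemma sharp_simps [simp]:
  "\<lbrakk>c \<in> Obj C; x \<in> car (PO P c)\<rbrakk> \<Longrightarrow> id_sharp C P c x = x"
  "\<lbrakk>c \<in> Obj C; x \<in> car (PO P c)\<rbrakk> \<Longrightarrow> comp_sharp C P F S T c x = T (FO F c) (S c x)"
  "id_sharp C P \<in> extensional (Obj C)" "c \<in> Obj C \<Longrightarrow> id_sharp C P c \<in> extensional (car (PO P c))"
  "comp_sharp C P F S T \<in> extensional (Obj C)" "c \<in> Obj C \<Longrightarrow> comp_sharp C P F S T c \<in> extensional (car (PO P c))"
  by (simp_all add: id_sharp_def comp_sharp_def)

lemma rc_mor_id:
  assumes "regular_calculus C P"
  shows "rc_mor C P C P (id_smfun C) (id_sharp C P)"
proof -
  interpret regular_calculus C P by fact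
  interpret I: sm_functor C C "id_smfun C" by (rule sm_functor_id) (rule smpocat_axioms)
  show ?thesis
  proof
    show "monoidal_2natural C P (pre_laxfun (id_smfun C) P) (id_sharp C P)"
      unfolding monoidal_2natural_def
    proof (intro conjI ballI allI impI)
      show "id_sharp C P c \<in> poset_maps (PO P c) (PO (pre_laxfun (id_smfun C) P) c)" if "c \<in> Obj C" for c
        using that by (auto simp: pre_laxfun_def poset_maps_def monotone_on_def)
      show "id_sharp C P d (PA P f x) = PA (pre_laxfun (id_smfun C) P) f (id_sharp C P c x)"
        if "f \<in> hom C c d" "x \<in> car (PO P c)" for c d f x
        using that PA_car[OF that] hom_obj[OF that(1)] by (simp add: pre_laxfun_def hom_def)
    qed (auto simp: pre_laxfun_def PA_Idn PU_car PM_car)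
    show "preserves_supply C C (id_smfun C)" by (rule preserves_supply_id) (rule supplies_W_axioms)
    show "ext_smfun C (id_smfun C)" by (rule ext_id_smfun)
  qed simp_all
qed

lemma rc_mor_comp:
  assumes "rc_mor C P C' P' F S" "rc_mor C' P' C'' P'' G T"
  shows "rc_mor C P C'' P'' (comp_smfun C C'' F G) (comp_sharp C P F S T)"
proof -
  interpret F: rc_mor C P C' P' F S by fact
  interpret G: rc_mor C' P' C'' P'' G T by fact
  interpret H: sm_functor C C'' "comp_smfun C C'' F G"
    by (rule sm_functor_comp[OF F.sm_functor_axioms G.sm_functor_axioms])
  let ?H = "comp_smfun C C'' F G"
  show ?thesis
  proof
    show "monoidal_2natural C P (pre_laxfun ?H P'') (comp_sharp C P F S T)"
      unfolding monoidal_2natural_def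
    proof (intro conjI ballI allI impI)
      show "comp_sharp C P F S T c \<in> poset_maps (PO P c) (PO (pre_laxfun ?H P'') c)" if "c \<in> Obj C" for c
        using that by (auto simp: pre_laxfun_def poset_maps_def monotone_on_def F.S_car G.S_car F.S_ple G.S_ple)
      show "comp_sharp C P F S T d (PA P f x) = PA (pre_laxfun ?H P'') f (comp_sharp C P F S T c x)"
        if "f \<in> hom C c d" "x \<in> car (PO P c)" for c d f x
        using that F.X.PA_car[OF that] F.X.hom_obj[OF that(1)] F.FA_in[OF that(1)]
        by (simp add: pre_laxfun_def F.S_PA G.S_PA F.S_car F.X.hom_iff)
      have "T (FO F (Unit C)) (S (Unit C) (PU P ())) = PA P'' (FA G (FU F)) (PA P'' (FU G) (PU P'' ()))"
        by (simp add: F.S_PU G.S_PA[OF F.FU_in F.Y.PU_car] G.S_PU)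
      also have "\<dots> = PA P'' (FU G ;;\<^bsub>C''\<^esub> FA G (FU F)) (PU P'' ())"
        by (rule G.Y.PA_Cmp[symmetric, OF G.FU_in G.FA_in[OF F.FU_in] G.Y.PU_car])
      finally show "comp_sharp C P F S T (Unit C) (PU P ()) = PU (pre_laxfun ?H P'') ()"
        by (simp add: pre_laxfun_def F.X.PU_car)
    next
      fix c d x y assume ty: "c \<in> Obj C" "d \<in> Obj C" "x \<in> car (PO P c)" "y \<in> car (PO P d)"
      have m: "PM P' (FO F c) (FO F d) (S c x, S d y) \<in> car (PO P' (FO F c \<odot>\<^bsub>C'\<^esub> FO F d))"
        "PM P'' (FO G (FO F c)) (FO G (FO F d)) (T (FO F c) (S c x), T (FO F d) (S d y)) \<in> car (PO P'' (FO G (FO F c) \<odot>\<^bsub>C''\<^esub> FO G (FO F d)))"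
        using ty by (simp_all add: F.Y.PM_car G.Y.PM_car F.S_car G.S_car)
      have "T (FO F (c \<odot>\<^bsub>C\<^esub> d)) (S (c \<odot>\<^bsub>C\<^esub> d) (PM P c d (x, y)))
        = PA P'' (FA G (FM F c d)) (PA P'' (FM G (FO F c) (FO F d)) (PM P'' (FO G (FO F c)) (FO G (FO F d)) (T (FO F c) (S c x), T (FO F d) (S d y))))"
        using ty by (simp add: F.S_PM G.S_PA[OF F.FM_in m(1)] G.S_PM F.S_car)
      also have "\<dots> = PA P'' (FM G (FO F c) (FO F d) ;;\<^bsub>C''\<^esub> FA G (FM F c d)) (PM P'' (FO G (FO F c)) (FO G (FO F d)) (T (FO F c) (S c x), T (FO F d) (S d y)))"
        by (rule G.Y.PA_Cmp[symmetric, OF G.FM_in G.FA_in[OF F.FM_in] m(2)]) (use ty in simp_all)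
      finally show "comp_sharp C P F S T (c \<odot>\<^bsub>C\<^esub> d) (PM P c d (x, y)) =
          PM (pre_laxfun ?H P'') c d (comp_sharp C P F S T c x, comp_sharp C P F S T d y)"
        using ty by (simp add: pre_laxfun_def F.X.PM_car)
    qed
    show "preserves_supply C C'' ?H"
      by (rule preserves_supply_comp[OF F.sm_functor_axioms G.sm_functor_axioms F.X.supplies_W_axioms
            F.Y.supplies_W_axioms G.Y.supplies_W_axioms F.pres G.pres])
    show "ext_smfun C ?H" by (rule ext_comp_smfun)
  qed simp_all
qed

locale rc_2mor = S: rc_mor C P C' P' F S + T: rc_mor C P C' P' G T + oplax_adjoint C C' F G \<alpha>
  for C :: "('o, 'a) scat" and P :: "('o, 'a, 'p) laxfun" and C' :: "('o, 'a) scat" and P' :: "('o, 'a, 'p) laxfun"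
    and F S G T \<alpha> +
  assumes mon: "monoidal_transformation C C' F G \<alpha>"
    and sharp: "\<lbrakk>c \<in> Obj C; x \<in> car (PO P c)\<rbrakk> \<Longrightarrow> ple (PO P' (FO G c)) (PA P' (\<alpha> c) (S c x)) (T c x)"
begin

lemma comp_hom: "c \<in> Obj C \<Longrightarrow> \<alpha> c \<in> hom C' (FO F c) (FO G c)"
  by (simp add: hom_def)

end

lemma rc_2mor_id:
  assumes "rc_mor C P C' P' F S"
  shows "rc_2mor C P C' P' F S F S (id_trans C C' F)"
proof -
  interpret rc_mor C P C' P' F S by fact
  interpret I: oplax_adjoint C C' F F "id_trans C C' F" by (rule oplax_adjoint_id) (rule sm_functor_axioms)
  show ?thesis
  proof
    show "monoidal_transformation C C' F F (id_trans C C' F)" by (rule monoidal_id) (rule sm_functor_axioms)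
    show "ple (PO P' (FO F c)) (PA P' (id_trans C C' F c) (S c x)) (S c x)" if "c \<in> Obj C" "x \<in> car (PO P c)" for c x
      using that by (simp add: id_trans_def Y.PA_Idn S_car Y.ple_refl)
  qed
qed

lemma rc_2mor_vcomp:
  assumes "rc_2mor C P C' P' F S G T \<alpha>" "rc_2mor C P C' P' G T H U \<beta>"
  shows "rc_2mor C P C' P' F S H U (vcomp_trans C C' \<alpha> \<beta>)"
proof -
  interpret \<alpha>: rc_2mor C P C' P' F S G T \<alpha> by fact
  interpret \<beta>: rc_2mor C P C' P' G T H U \<beta> by fact
  interpret V: oplax_adjoint C C' F H "vcomp_trans C C' \<alpha> \<beta>"
    by (rule oplax_adjoint_vcomp[OF \<alpha>.oplax_adjoint_axioms \<beta>.oplax_adjoint_axioms])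
  show ?thesis
  proof
    show "monoidal_transformation C C' F H (vcomp_trans C C' \<alpha> \<beta>)"
      by (rule monoidal_vcomp[OF \<alpha>.oplax_adjoint_axioms \<beta>.oplax_adjoint_axioms \<alpha>.mon \<beta>.mon])
    fix c x assume c: "c \<in> Obj C" and x: "x \<in> car (PO P c)"
    note ah = \<alpha>.comp_hom[OF c] and bh = \<beta>.comp_hom[OF c] and Sx = \<alpha>.S.S_car[OF c x]
    have "PA P' (vcomp_trans C C' \<alpha> \<beta> c) (S c x) = PA P' (\<beta> c) (PA P' (\<alpha> c) (S c x))"
      using c \<alpha>.S.Y.PA_Cmp[OF ah bh Sx] by (simp add: vcomp_trans_def)
    moreover have "ple (PO P' (FO H c)) (PA P' (\<beta> c) (PA P' (\<alpha> c) (S c x))) (PA P' (\<beta> c) (T c x))"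
      by (rule \<alpha>.S.Y.PA_ple[OF bh \<alpha>.S.Y.PA_car[OF ah Sx] \<alpha>.T.S_car[OF c x] \<alpha>.sharp[OF c x]])
    ultimately show "ple (PO P' (FO H c)) (PA P' (vcomp_trans C C' \<alpha> \<beta> c) (S c x)) (U c x)"
      using \<alpha>.S.Y.ple_trans[OF _ \<beta>.sharp[OF c x]] \<alpha>.S.Y.PA_car[OF bh \<alpha>.S.Y.PA_car[OF ah Sx]]
        \<alpha>.S.Y.PA_car[OF bh \<alpha>.T.S_car[OF c x]] \<beta>.T.S_car[OF c x] c by simp
  qed
qed

text \<open>Naturality of \<open>S'\<close> at \<open>\<alpha> c\<close> exposes
  \<open>PA P' (\<alpha> c) (S c x)\<close> inside \<open>S'\<close>. Monotonicity then replaces it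
  by \<open>T c x\<close>, and the inequality for \<open>\<beta>\<close> finishes.\<close>

lemma rc_2mor_hcomp:
  assumes "rc_2mor C P C' P' F S G T \<alpha>" "rc_2mor C' P' C'' P'' F' S' G' T' \<beta>"
  shows "rc_2mor C P C'' P'' (comp_smfun C C'' F F') (comp_sharp C P F S S') (comp_smfun C C'' G G') (comp_sharp C P G T T')
    (hcomp_trans C C'' G F' \<alpha> \<beta>)"
proof -
  interpret \<alpha>: rc_2mor C P C' P' F S G T \<alpha> by fact
  interpret \<beta>: rc_2mor C' P' C'' P'' F' S' G' T' \<beta> by fact
  interpret V: oplax_adjoint C C'' "comp_smfun C C'' F F'" "comp_smfun C C'' G G'" "hcomp_trans C C'' G F' \<alpha> \<beta>"
    by (rule oplax_adjoint_hcomp[OF \<alpha>.oplax_adjoint_axioms \<beta>.oplax_adjoint_axioms])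
  interpret S: rc_mor C P C'' P'' "comp_smfun C C'' F F'" "comp_sharp C P F S S'"
    by (rule rc_mor_comp[OF \<alpha>.S.rc_mor_axioms \<beta>.S.rc_mor_axioms])
  interpret T: rc_mor C P C'' P'' "comp_smfun C C'' G G'" "comp_sharp C P G T T'"
    by (rule rc_mor_comp[OF \<alpha>.T.rc_mor_axioms \<beta>.T.rc_mor_axioms])
  show ?thesis
  proof
    show "monoidal_transformation C C'' (comp_smfun C C'' F F') (comp_smfun C C'' G G') (hcomp_trans C C'' G F' \<alpha> \<beta>)"
      by (rule monoidal_hcomp[OF \<alpha>.oplax_adjoint_axioms \<beta>.oplax_adjoint_axioms \<alpha>.mon \<beta>.mon])
    fix c x assume c: "c \<in> Obj C" and x: "x \<in> car (PO P c)"
    have Gc: "FO G c \<in> Obj C'" using c by simp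
    note ah = \<alpha>.comp_hom[OF c] and bh = \<beta>.comp_hom[OF Gc] and Sx = \<alpha>.S.S_car[OF c x] and Tx = \<alpha>.T.S_car[OF c x]
    note Fah = \<beta>.S.FA_in[OF ah] and ax = \<alpha>.S.Y.PA_car[OF ah Sx]
    have SSx: "S' (FO F c) (S c x) \<in> car (PO P'' (FO F' (FO F c)))" using \<beta>.S.S_car[OF _ Sx] c by simp
    have "PA P'' (hcomp_trans C C'' G F' \<alpha> \<beta> c) (S' (FO F c) (S c x)) = PA P'' (\<beta> (FO G c)) (PA P'' (FA F' (\<alpha> c)) (S' (FO F c) (S c x)))"
      using c \<beta>.S.Y.PA_Cmp[OF Fah bh SSx] by (simp add: hcomp_trans_def)
    also have "PA P'' (FA F' (\<alpha> c)) (S' (FO F c) (S c x)) = S' (FO G c) (PA P' (\<alpha> c) (S c x))"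
      by (rule \<beta>.S.S_PA[OF ah Sx, symmetric])
    finally have eq: "PA P'' (hcomp_trans C C'' G F' \<alpha> \<beta> c) (S' (FO F c) (S c x)) = PA P'' (\<beta> (FO G c)) (S' (FO G c) (PA P' (\<alpha> c) (S c x)))" .
    have "ple (PO P'' (FO F' (FO G c))) (S' (FO G c) (PA P' (\<alpha> c) (S c x))) (S' (FO G c) (T c x))"
      by (rule \<beta>.S.S_ple[OF Gc ax Tx \<alpha>.sharp[OF c x]])
    then have 1: "ple (PO P'' (FO G' (FO G c))) (PA P'' (\<beta> (FO G c)) (S' (FO G c) (PA P' (\<alpha> c) (S c x)))) (PA P'' (\<beta> (FO G c)) (S' (FO G c) (T c x)))"
      by (rule \<beta>.S.Y.PA_ple[OF bh \<beta>.S.S_car[OF Gc ax] \<beta>.S.S_car[OF Gc Tx]])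
    have "ple (PO P'' (FO G' (FO G c))) (PA P'' (\<beta> (FO G c)) (S' (FO G c) (PA P' (\<alpha> c) (S c x)))) (T' (FO G c) (T c x))"
      by (rule \<beta>.S.Y.ple_trans[OF 1 \<beta>.sharp[OF Gc Tx]])
        (use \<beta>.S.Y.PA_car[OF bh \<beta>.S.S_car[OF Gc ax]] \<beta>.S.Y.PA_car[OF bh \<beta>.S.S_car[OF Gc Tx]] \<beta>.T.S_car[OF Gc Tx] Gc in simp_all)
    then show "ple (PO P'' (FO (comp_smfun C C'' G G') c)) (PA P'' (hcomp_trans C C'' G F' \<alpha> \<beta> c) (comp_sharp C P F S S' c x)) (comp_sharp C P G T T' c x)"
      using c x eq by simp
  qed
qed

lemma RgCalc_Ob: "(C, P) \<in> Ob RgCalc \<longleftrightarrow> regular_calculus C P"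
  by (simp add: RgCalc_def)

section \<open>The 2-category of regular calculi\<close>

lemma RgCalc_H1:
  "\<lbrakk>regular_calculus C P; regular_calculus C' P'\<rbrakk> \<Longrightarrow> (F, S) \<in> H1 RgCalc (C, P) (C', P') \<longleftrightarrow> rc_mor C P C' P' F S"
  by (auto simp: RgCalc_def rcalc_mors_def rc_mor_def rc_mor_axioms_def sm_functor_iff regular_calculus_def supplies_W_def)

lemma RgCalc_H2:
  assumes "rc_mor C P C' P' F S" "rc_mor C P C' P' G T"
  shows "\<alpha> \<in> H2 RgCalc (C, P) (C', P') (F, S) (G, T) \<longleftrightarrow> \<alpha> \<in> extensional (Obj C) \<and> rc_2mor C P C' P' F S G T \<alpha>"
proof -
  have "oplax_adjoint C C' F G \<alpha> \<longleftrightarrow> left_adjoint_oplax C C' F G \<alpha>"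
    using assms by (simp add: oplax_adjoint_def oplax_adjoint_axioms_def rc_mor_def)
  then show ?thesis
    using assms by (auto simp: RgCalc_def rcalc_2mors_def rc_2mor_def rc_2mor_axioms_def)
qed

lemma RgCalc_H2I: "\<lbrakk>\<alpha> \<in> extensional (Obj C); rc_2mor C P C' P' F S G T \<alpha>\<rbrakk> \<Longrightarrow> \<alpha> \<in> H2 RgCalc (C, P) (C', P') (F, S) (G, T)"
  using RgCalc_H2 unfolding rc_2mor_def by blast

lemma RgCalc_ops:
  "I1 RgCalc (C, P) = (id_smfun C, id_sharp C P)"
  "C1 RgCalc (C, P) (C', P') (C'', P'') (F, S) (G, T) = (comp_smfun C C'' F G, comp_sharp C P F S T)"
  "I2 RgCalc (C, P) (C', P') (F, S) = id_trans C C' F"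
  "VC RgCalc (C, P) (C', P') FS GS HS \<alpha> \<beta> = vcomp_trans C C' \<alpha> \<beta>"
  "HC RgCalc (C, P) (C', P') (C'', P'') (F, S) (G, T) (F', S') (G', T') \<alpha> \<alpha>' = hcomp_trans C C'' G F' \<alpha> \<alpha>'"
  by (simp_all add: RgCalc_def id_sharp_def comp_sharp_def)

lemma rc_morD: "rc_mor C P C' P' F S \<Longrightarrow> sm_functor C C' F" "rc_mor C P C' P' F S \<Longrightarrow> ext_smfun C F"
  by (simp_all add: rc_mor_def rc_mor_axioms_def)

lemma rc_2morD: "rc_2mor C P C' P' F S G T \<alpha> \<Longrightarrow> oplax_adjoint C C' F G \<alpha>"
  by (simp add: rc_2mor_def)

lemma comp_sharp_id:
  assumes "rc_mor C P C' P' F S"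
  shows "comp_sharp C P (id_smfun C) (id_sharp C P) S = S" "comp_sharp C P F S (id_sharp C' P') = S"
proof -
  interpret rc_mor C P C' P' F S by fact
  show "comp_sharp C P (id_smfun C) (id_sharp C P) S = S"
    by (rule sharp_eqI[where A = "Obj C" and B = "\<lambda>c. car (PO P c)"]) (simp_all add: S_ext)
  show "comp_sharp C P F S (id_sharp C' P') = S"
    by (rule sharp_eqI[where A = "Obj C" and B = "\<lambda>c. car (PO P c)"]) (simp_all add: S_ext S_car)
qed

lemma comp_sharp_assoc:
  assumes "rc_mor C P C' P' F S"
  shows "comp_sharp C P (comp_smfun C C'' F G) (comp_sharp C P F S T) U = comp_sharp C P F S (comp_sharp C' P' G T U)"
proof -
  interpret rc_mor C P C' P' F S by fact
  show ?thesis
    by (rule sharp_eqI[where A = "Obj C" and B = "\<lambda>c. car (PO P c)"]) (simp_all add: S_car)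
qed

lemma two_category_RgCalc:
  "two_category (RgCalc :: (('o, 'a, 'p) rcalc, ('o, 'a, 'p) rcalc_mor, 'o \<Rightarrow> 'a) twocat)"
proof
qed (auto simp: RgCalc_Ob RgCalc_H1 RgCalc_H2 RgCalc_ops
    intro: RgCalc_H2I RgCalc_H2I[OF trans_extensional(3) rc_2mor_hcomp] rc_mor_id rc_mor_comp rc_2mor_id rc_2mor_vcomp rc_2mor_hcomp
      comp_smfun_id_left[OF rc_morD] comp_smfun_id_right[OF rc_morD]
      comp_smfun_assoc[OF rc_morD(1) rc_morD(1) rc_morD(1)] comp_sharp_id comp_sharp_assoc
      vcomp_id[OF rc_2morD] vcomp_assoc[OF rc_2morD rc_2morD rc_2morD] hcomp_id[OF rc_2morD]
      hcomp_assoc[OF rc_2morD rc_2morD rc_2morD] hcomp_id_id[OF rc_morD(1) rc_morD(1)]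
      interchange_trans[OF rc_2morD rc_2morD rc_2morD rc_2morD])

section \<open>The 2-functor Prd\<close>

definition Prd_lax :: "('o, 'a) scat \<Rightarrow> ('o, 'a, 'a) laxfun" where
  "Prd_lax R = snd (Prd_ob R)"

lemma Prd_ob_eq: "Prd_ob R = (R, Prd_lax R)"
  by (simp add: Prd_lax_def Prd_ob_def)

lemma Prd_lax_simps [simp]:
  "car (PO (Prd_lax R) r) = hom R (Unit R) r" "ple (PO (Prd_lax R) r) = Leq R" "PA (Prd_lax R) g f = f ;;\<^bsub>R\<^esub> g"
  "PU (Prd_lax R) u = Idn R (Unit R)"
  "PM (Prd_lax R) r r' (f, f') = Supply R (Unit R) W_delta ;;\<^bsub>R\<^esub> (f \<otimes>\<^bsub>R\<^esub> f')"
  by (simp_all add: Prd_lax_def Prd_ob_def)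

text \<open>Coassociativity of \<open>delta\<close> at I, since that is the inverse unitor: it is
  the triangle at I, I, where both unitors agree.\<close>

lemma (in smpocat) Assoc_inverse_LUnit:
  "(inverse_of C (LUnit C (Unit C)) \<otimes> Idn C (Unit C)) ;; Assoc C (Unit C) (Unit C) (Unit C) =
    Idn C (Unit C) \<otimes> inverse_of C (LUnit C (Unit C))"
proof -
  let ?I = "Unit C" and ?l = "LUnit C (Unit C)"
  have "((inverse_of C ?l \<otimes> Idn C ?I) ;; Assoc C ?I ?I ?I) ;; (Idn C ?I \<otimes> ?l)
    = (inverse_of C ?l \<otimes> Idn C ?I) ;; (?l \<otimes> Idn C ?I)"
    using triangle[of ?I ?I] by (simp add: assoc LUnit_Unit)
  also have "\<dots> = (Idn C ?I \<otimes> inverse_of C ?l) ;; (Idn C ?I \<otimes> ?l)"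
    by (simp add: exchange)
  finally show ?thesis
    by (rule iso_cancel_right[rotated]) (simp_all add: TenA_iso)
qed

text \<open>Laxity comes from I being a cocommutative comonoid through its inverse unitor,
  adjointness of the laxators from the two lax naturality axioms.\<close>

lemma regular_calculus_Prd:
  assumes "prerelational R"
  shows "regular_calculus R (Prd_lax R)"
proof -
  interpret prerelational R by fact
  let ?I = "Unit R"
  note delta_Unit [simp]
  \<comment> \<open>Naturality of \<open>RUnit\<close>, turned around; \<open>LUnit\<close> may
    stand at I because the unitors agree there.\<close>
  have nat: "inverse_of R (LUnit R ?I) ;;\<^bsub>R\<^esub> (f \<otimes>\<^bsub>R\<^esub> Idn R ?I) = f ;;\<^bsub>R\<^esub> inverse_of R (RUnit R (Cod R f))"
    if "f \<in> Arr R" "Dom R f = ?I" for f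
    using inverse_natural[of "RUnit R ?I" "RUnit R (Cod R f)" "f \<otimes>\<^bsub>R\<^esub> Idn R ?I" f] that Cod_in
    by (simp add: RUnit_natural LUnit_Unit)
  have PU: "PU (Prd_lax R) \<in> poset_maps one_poset (PO (Prd_lax R) ?I)"
    by (auto simp: poset_maps_def one_poset_def hom_def monotone_on_def)
  have PM: "PM (Prd_lax R) c d \<in> poset_maps (prod_poset (PO (Prd_lax R) c) (PO (Prd_lax R) d)) (PO (Prd_lax R) (c \<odot>\<^bsub>R\<^esub> d))"
    if c: "c \<in> Obj R" and d: "d \<in> Obj R" for c d
  proof -
    have "delta ?I ;;\<^bsub>R\<^esub> (f \<otimes>\<^bsub>R\<^esub> g) \<sqsubseteq>\<^bsub>R\<^esub> delta ?I ;;\<^bsub>R\<^esub> (f' \<otimes>\<^bsub>R\<^esub> g')"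
      if "f \<in> hom R ?I c" "f' \<in> hom R ?I c" "g \<in> hom R ?I d" "g' \<in> hom R ?I d" "f \<sqsubseteq>\<^bsub>R\<^esub> f'" "g \<sqsubseteq>\<^bsub>R\<^esub> g'" for f f' g g'
      by (rule Cmp_mono_right[OF TenA_mono[OF that], of _ ?I "?I \<odot>\<^bsub>R\<^esub> ?I" "c \<odot>\<^bsub>R\<^esub> d"])
        (use that in \<open>simp_all add: hom_def\<close>)
    then show ?thesis using c d
      by (auto simp: poset_maps_def prod_poset_def hom_def monotone_on_def simp del: delta_Unit)
  qed
  show ?thesis
  proof
    show "is_poset (PO (Prd_lax R) c)" if "c \<in> Obj R" for c
      by (simp add: is_poset_def hom_refl hom_trans hom_antisym)
    show "PA (Prd_lax R) f \<in> poset_maps (PO (Prd_lax R) c) (PO (Prd_lax R) d)" if "f \<in> hom R c d" for f c d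
      using that by (auto simp: poset_maps_def monotone_on_def intro: Cmp_in Cmp_mono_left)
    show "PA (Prd_lax R) (Idn R c) x = x" if "c \<in> Obj R" "x \<in> car (PO (Prd_lax R) c)" for c x
      using that by (simp add: hom_def)
    show "PA (Prd_lax R) (f ;;\<^bsub>R\<^esub> g) x = PA (Prd_lax R) g (PA (Prd_lax R) f x)"
      if "f \<in> hom R c d" "g \<in> hom R d e" "x \<in> car (PO (Prd_lax R) c)" for c d e f g x
      using that by (simp add: hom_def assoc)
    show "ple (PO (Prd_lax R) d) (PA (Prd_lax R) f x) (PA (Prd_lax R) g x)"
      if "f \<in> hom R c d" "g \<in> hom R c d" "f \<sqsubseteq>\<^bsub>R\<^esub> g" "x \<in> car (PO (Prd_lax R) c)" for c d f g x
      using that by (auto intro: Cmp_mono_right)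
    show "PM (Prd_lax R) c' d' (PA (Prd_lax R) f x, PA (Prd_lax R) g y) = PA (Prd_lax R) (f \<otimes>\<^bsub>R\<^esub> g) (PM (Prd_lax R) c d (x, y))"
      if "f \<in> hom R c c'" "g \<in> hom R d d'" "x \<in> car (PO (Prd_lax R) c)" "y \<in> car (PO (Prd_lax R) d)" for c c' d d' f g x y
      using that by (simp add: hom_def assoc exchange)
    show "PA (Prd_lax R) (Assoc R c d e) (PM (Prd_lax R) (c \<odot>\<^bsub>R\<^esub> d) e (PM (Prd_lax R) c d (x, y), z)) =
        PM (Prd_lax R) c (d \<odot>\<^bsub>R\<^esub> e) (x, PM (Prd_lax R) d e (y, z))"
      if "c \<in> Obj R" "d \<in> Obj R" "e \<in> Obj R" "x \<in> car (PO (Prd_lax R) c)" "y \<in> car (PO (Prd_lax R) d)" "z \<in> car (PO (Prd_lax R) e)"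
      for c d e x y z
    proof -
      let ?l = "inverse_of R (LUnit R ?I)"
      have ty: "c \<in> Obj R" "d \<in> Obj R" "e \<in> Obj R" "x \<in> Arr R" "y \<in> Arr R" "z \<in> Arr R" "Dom R x = ?I" "Dom R y = ?I" "Dom R z = ?I"
        "Cod R x = c" "Cod R y = d" "Cod R z = e" using that by (auto simp: hom_def)
      have "(?l ;;\<^bsub>R\<^esub> ((?l ;;\<^bsub>R\<^esub> (x \<otimes>\<^bsub>R\<^esub> y)) \<otimes>\<^bsub>R\<^esub> (Idn R ?I ;;\<^bsub>R\<^esub> z))) ;;\<^bsub>R\<^esub> Assoc R c d e
        = ?l ;;\<^bsub>R\<^esub> ((?l \<otimes>\<^bsub>R\<^esub> Idn R ?I) ;;\<^bsub>R\<^esub> (((x \<otimes>\<^bsub>R\<^esub> y) \<otimes>\<^bsub>R\<^esub> z) ;;\<^bsub>R\<^esub> Assoc R c d e))"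
        using ty by (subst exchange[symmetric]) (simp_all add: assoc)
      also have "\<dots> = ?l ;;\<^bsub>R\<^esub> (((?l \<otimes>\<^bsub>R\<^esub> Idn R ?I) ;;\<^bsub>R\<^esub> Assoc R ?I ?I ?I) ;;\<^bsub>R\<^esub> (x \<otimes>\<^bsub>R\<^esub> (y \<otimes>\<^bsub>R\<^esub> z)))"
        using ty by (simp add: Assoc_natural assoc)
      also have "\<dots> = ?l ;;\<^bsub>R\<^esub> (x \<otimes>\<^bsub>R\<^esub> (?l ;;\<^bsub>R\<^esub> (y \<otimes>\<^bsub>R\<^esub> z)))"
        using ty by (simp add: Assoc_inverse_LUnit exchange)
      finally show ?thesis using ty by simp
    qed
    show "PA (Prd_lax R) (LUnit R c) (PM (Prd_lax R) ?I c (PU (Prd_lax R) (), x)) = x"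
      if "c \<in> Obj R" "x \<in> car (PO (Prd_lax R) c)" for c x
      using that by (simp add: hom_def assoc LUnit_natural)
    show "PA (Prd_lax R) (RUnit R c) (PM (Prd_lax R) c ?I (x, PU (Prd_lax R) ())) = x"
      if "c \<in> Obj R" "x \<in> car (PO (Prd_lax R) c)" for c x
      using that by (simp add: hom_def assoc nat)
    show "PA (Prd_lax R) (Swap R c d) (PM (Prd_lax R) c d (x, y)) = PM (Prd_lax R) d c (y, x)"
      if "c \<in> Obj R" "d \<in> Obj R" "x \<in> car (PO (Prd_lax R) c)" "y \<in> car (PO (Prd_lax R) d)" for c d x y
      using that Swap_nat[of x ?I c y ?I d] by (simp add: hom_def assoc Swap_Unit)
    \<comment> \<open>The left adjoint is the only map to the one-point poset; the inequality
      \<open>b \<le> Idn\<close> it has to satisfy is \<open>Unit_endo_le\<close>.\<close>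
    show "right_adjoint_map one_poset (PO (Prd_lax R) ?I) (PU (Prd_lax R))"
      unfolding right_adjoint_map_def
      by (intro conjI PU bexI[of _ "\<lambda>_. ()"]) (auto simp: poset_maps_def one_poset_def monotone_on_def Unit_endo_le)
    show "right_adjoint_map (prod_poset (PO (Prd_lax R) c) (PO (Prd_lax R) d)) (PO (Prd_lax R) (c \<odot>\<^bsub>R\<^esub> d)) (PM (Prd_lax R) c d)"
      if c: "c \<in> Obj R" and d: "d \<in> Obj R" for c d
      unfolding right_adjoint_map_def
    proof (intro conjI PM c d bexI[of _ "\<lambda>h. (h ;;\<^bsub>R\<^esub> pr1 c d, h ;;\<^bsub>R\<^esub> pr2 c d)"])
      have p: "pr1 c d \<in> hom R (c \<odot>\<^bsub>R\<^esub> d) c" "pr2 c d \<in> hom R (c \<odot>\<^bsub>R\<^esub> d) d" using c d by (simp_all add: hom_def)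
      show "(\<lambda>h. (h ;;\<^bsub>R\<^esub> pr1 c d, h ;;\<^bsub>R\<^esub> pr2 c d)) \<in>
          poset_maps (PO (Prd_lax R) (c \<odot>\<^bsub>R\<^esub> d)) (prod_poset (PO (Prd_lax R) c) (PO (Prd_lax R) d))"
        using p by (auto simp: poset_maps_def prod_poset_def monotone_on_def intro: Cmp_in Cmp_mono_left)
      show "\<forall>b \<in> car (PO (Prd_lax R) (c \<odot>\<^bsub>R\<^esub> d)). ple (PO (Prd_lax R) (c \<odot>\<^bsub>R\<^esub> d)) b
          (PM (Prd_lax R) c d (b ;;\<^bsub>R\<^esub> pr1 c d, b ;;\<^bsub>R\<^esub> pr2 c d))"
      proof
        fix b assume "b \<in> car (PO (Prd_lax R) (c \<odot>\<^bsub>R\<^esub> d))"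
        then have b: "b \<in> hom R ?I (c \<odot>\<^bsub>R\<^esub> d)" by simp
        then have ty: "b \<in> Arr R" "Dom R b = ?I" "Cod R b = c \<odot>\<^bsub>R\<^esub> d" by (auto simp: hom_def)
        \<comment> \<open>By \<open>delta_pr\<close> the left side is \<open>b\<close> itself, so
          \<open>lax_delta\<close> bounds \<open>b\<close> by the pairing of its
          projections.\<close>
        have "(b ;;\<^bsub>R\<^esub> delta (c \<odot>\<^bsub>R\<^esub> d)) ;;\<^bsub>R\<^esub> (pr1 c d \<otimes>\<^bsub>R\<^esub> pr2 c d) \<sqsubseteq>\<^bsub>R\<^esub> (delta ?I ;;\<^bsub>R\<^esub> (b \<otimes>\<^bsub>R\<^esub> b)) ;;\<^bsub>R\<^esub> (pr1 c d \<otimes>\<^bsub>R\<^esub> pr2 c d)"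
          by (rule Cmp_mono_left[OF lax_delta[OF b]]) (use c d ty in \<open>simp_all add: hom_def\<close>)
        then show "ple (PO (Prd_lax R) (c \<odot>\<^bsub>R\<^esub> d)) b (PM (Prd_lax R) c d (b ;;\<^bsub>R\<^esub> pr1 c d, b ;;\<^bsub>R\<^esub> pr2 c d))"
          using c d ty by (simp add: assoc delta_pr exchange)
      qed
      show "\<forall>a \<in> car (prod_poset (PO (Prd_lax R) c) (PO (Prd_lax R) d)).
         ple (prod_poset (PO (Prd_lax R) c) (PO (Prd_lax R) d))
           (PM (Prd_lax R) c d a ;;\<^bsub>R\<^esub> pr1 c d, PM (Prd_lax R) c d a ;;\<^bsub>R\<^esub> pr2 c d) a"
      proof
        fix a assume a: "a \<in> car (prod_poset (PO (Prd_lax R) c) (PO (Prd_lax R) d))"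
        obtain x y where xy: "a = (x, y)" "x \<in> hom R ?I c" "y \<in> hom R ?I d" using a by (auto simp: prod_poset_def)
        then have ty: "x \<in> Arr R" "Dom R x = ?I" "Cod R x = c" "y \<in> Arr R" "Dom R y = ?I" "Cod R y = d" by (auto simp: hom_def)
        let ?l = "inverse_of R (LUnit R ?I)"
        have l: "?l \<in> hom R ?I (?I \<odot>\<^bsub>R\<^esub> ?I)" by (simp add: hom_def)
        \<comment> \<open>Projecting a pairing discards the other entry; since that entry followed
          by \<open>eps\<close> lies below the identity of I, the projection lies below the entry
          that is kept.\<close>
        have ex: "x ;;\<^bsub>R\<^esub> eps c \<sqsubseteq>\<^bsub>R\<^esub> Idn R ?I" "y ;;\<^bsub>R\<^esub> eps d \<sqsubseteq>\<^bsub>R\<^esub> Idn R ?I"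
          using lax_eps[OF xy(2)] lax_eps[OF xy(3)] by (simp_all add: eps_Unit)
        have "x \<otimes>\<^bsub>R\<^esub> (y ;;\<^bsub>R\<^esub> eps d) \<sqsubseteq>\<^bsub>R\<^esub> x \<otimes>\<^bsub>R\<^esub> Idn R ?I"
          by (rule TenA_mono[of _ ?I c _ _ ?I ?I]) (use ty c d ex in \<open>simp_all add: hom_def\<close>)
        then have "(x \<otimes>\<^bsub>R\<^esub> (y ;;\<^bsub>R\<^esub> eps d)) ;;\<^bsub>R\<^esub> RUnit R c \<sqsubseteq>\<^bsub>R\<^esub> (x \<otimes>\<^bsub>R\<^esub> Idn R ?I) ;;\<^bsub>R\<^esub> RUnit R c"
          by (rule Cmp_mono_left[of _ _ "?I \<odot>\<^bsub>R\<^esub> ?I" "c \<odot>\<^bsub>R\<^esub> ?I" _ c]) (use ty c d in \<open>simp_all add: hom_def\<close>)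
        then have "?l ;;\<^bsub>R\<^esub> ((x \<otimes>\<^bsub>R\<^esub> (y ;;\<^bsub>R\<^esub> eps d)) ;;\<^bsub>R\<^esub> RUnit R c) \<sqsubseteq>\<^bsub>R\<^esub> ?l ;;\<^bsub>R\<^esub> ((x \<otimes>\<^bsub>R\<^esub> Idn R ?I) ;;\<^bsub>R\<^esub> RUnit R c)"
          by (rule Cmp_mono_right[OF _ l, of _ _ c]) (use ty c d in \<open>simp_all add: hom_def\<close>)
        then have 1: "PM (Prd_lax R) c d a ;;\<^bsub>R\<^esub> pr1 c d \<sqsubseteq>\<^bsub>R\<^esub> x"
          using ty c d by (simp add: xy(1) pr1_def assoc exchange_assoc RUnit_natural flip: LUnit_Unit)
        have "(x ;;\<^bsub>R\<^esub> eps c) \<otimes>\<^bsub>R\<^esub> y \<sqsubseteq>\<^bsub>R\<^esub> Idn R ?I \<otimes>\<^bsub>R\<^esub> y"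
          by (rule TenA_mono[of _ ?I ?I _ _ ?I d]) (use ty c d ex in \<open>simp_all add: hom_def\<close>)
        then have "((x ;;\<^bsub>R\<^esub> eps c) \<otimes>\<^bsub>R\<^esub> y) ;;\<^bsub>R\<^esub> LUnit R d \<sqsubseteq>\<^bsub>R\<^esub> (Idn R ?I \<otimes>\<^bsub>R\<^esub> y) ;;\<^bsub>R\<^esub> LUnit R d"
          by (rule Cmp_mono_left[of _ _ "?I \<odot>\<^bsub>R\<^esub> ?I" "?I \<odot>\<^bsub>R\<^esub> d" _ d]) (use ty c d in \<open>simp_all add: hom_def\<close>)
        then have "?l ;;\<^bsub>R\<^esub> (((x ;;\<^bsub>R\<^esub> eps c) \<otimes>\<^bsub>R\<^esub> y) ;;\<^bsub>R\<^esub> LUnit R d) \<sqsubseteq>\<^bsub>R\<^esub> ?l ;;\<^bsub>R\<^esub> ((Idn R ?I \<otimes>\<^bsub>R\<^esub> y) ;;\<^bsub>R\<^esub> LUnit R d)"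
          by (rule Cmp_mono_right[OF _ l, of _ _ d]) (use ty c d in \<open>simp_all add: hom_def\<close>)
        then have 2: "PM (Prd_lax R) c d a ;;\<^bsub>R\<^esub> pr2 c d \<sqsubseteq>\<^bsub>R\<^esub> y"
          using ty c d by (simp add: xy(1) pr2_def assoc exchange_assoc LUnit_natural)
        show "ple (prod_poset (PO (Prd_lax R) c) (PO (Prd_lax R) d))
           (PM (Prd_lax R) c d a ;;\<^bsub>R\<^esub> pr1 c d, PM (Prd_lax R) c d a ;;\<^bsub>R\<^esub> pr2 c d) a"
          using 1 2 by (simp add: xy(1) prod_poset_def)
      qed
    qed
  qed (fact PU PM)+
qed

definition Prd_sharp :: "('o, 'a) scat \<Rightarrow> ('o, 'a) scat \<Rightarrow> ('o, 'a, 'o, 'a) smfun \<Rightarrow> 'o \<Rightarrow> 'a \<Rightarrow> 'a" where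
  "Prd_sharp R R' F = (\<lambda>r \<in> Obj R. \<lambda>f \<in> hom R (Unit R) r. FU F ;;\<^bsub>R'\<^esub> FA F f)"

lemma Prd_mor_eq: "Prd_mor R R' F = (F, Prd_sharp R R' F)"
  by (simp add: Prd_mor_def Prd_sharp_def)

lemma Prd_sharp_simps [simp]:
  "\<lbrakk>r \<in> Obj R; f \<in> hom R (Unit R) r\<rbrakk> \<Longrightarrow> Prd_sharp R R' F r f = FU F ;;\<^bsub>R'\<^esub> FA F f"
  "Prd_sharp R R' F \<in> extensional (Obj R)" "r \<in> Obj R \<Longrightarrow> Prd_sharp R R' F r \<in> extensional (hom R (Unit R) r)"
  by (simp_all add: Prd_sharp_def)

text \<open>Compatibility with the binary laxator combines \<open>FU_inverse_LUnit\<close>, which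
  commutes \<open>FU F\<close> past \<open>delta\<close> at I, with naturality of
  \<open>FM F\<close> at \<open>x\<close> and \<open>y\<close>.\<close>

lemma rc_mor_Prd:
  assumes "prerelational R" "prerelational R'" "sm_functor R R' F" "ext_smfun R F"
  shows "rc_mor R (Prd_lax R) R' (Prd_lax R') F (Prd_sharp R R' F)"
proof -
  interpret prl_functor R R' F by (intro prl_functor.intro assms)
  interpret X: regular_calculus R "Prd_lax R" by (rule regular_calculus_Prd) fact
  interpret Y: regular_calculus R' "Prd_lax R'" by (rule regular_calculus_Prd) fact
  let ?I = "Unit R"
  show ?thesis
  proof
    show "monoidal_2natural R (Prd_lax R) (pre_laxfun F (Prd_lax R')) (Prd_sharp R R' F)"
      unfolding monoidal_2natural_def
    proof (intro conjI ballI allI impI)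
      fix c assume c: "c \<in> Obj R"
      have "FU F ;;\<^bsub>R'\<^esub> FA F f \<sqsubseteq>\<^bsub>R'\<^esub> FU F ;;\<^bsub>R'\<^esub> FA F g" if "f \<in> hom R ?I c" "g \<in> hom R ?I c" "f \<sqsubseteq>\<^bsub>R\<^esub> g" for f g
        by (rule D.Cmp_mono_right[OF FA_Leq FU_in]) (use that c in \<open>simp_all add: hom_def\<close>)
      then show "Prd_sharp R R' F c \<in> poset_maps (PO (Prd_lax R) c) (PO (pre_laxfun F (Prd_lax R')) c)"
        using c by (auto simp: poset_maps_def pre_laxfun_def monotone_on_def C.hom_iff D.hom_iff)
    next
      fix c d f x assume f: "f \<in> hom R c d" and x: "x \<in> car (PO (Prd_lax R) c)"
      have "x ;;\<^bsub>R\<^esub> f \<in> hom R ?I d" using C.Cmp_in[of x ?I c f d] f x by simp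
      then show "Prd_sharp R R' F d (PA (Prd_lax R) f x) = PA (pre_laxfun F (Prd_lax R')) f (Prd_sharp R R' F c x)"
        using f x C.hom_obj[OF f] by (simp add: pre_laxfun_def) (simp add: hom_def FA_comp D.assoc)
    next
      show "Prd_sharp R R' F ?I (PU (Prd_lax R) ()) = PU (pre_laxfun F (Prd_lax R')) ()"
        by (simp add: pre_laxfun_def C.Idn_in FA_Idn)
    next
      fix c d x y assume ty: "c \<in> Obj R" "d \<in> Obj R" "x \<in> car (PO (Prd_lax R) c)" "y \<in> car (PO (Prd_lax R) d)"
      have h: "C.delta ?I ;;\<^bsub>R\<^esub> (x \<otimes>\<^bsub>R\<^esub> y) \<in> hom R ?I (c \<odot>\<^bsub>R\<^esub> d)" using X.PM_car[OF ty] by simp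
      have xy: "x \<in> Arr R" "y \<in> Arr R" "Dom R x = ?I" "Dom R y = ?I" "Cod R x = c" "Cod R y = d" using ty by (auto simp: hom_def)
      let ?l = "inverse_of R' (LUnit R' (Unit R'))"
      have "FU F ;;\<^bsub>R'\<^esub> FA F (C.delta ?I ;;\<^bsub>R\<^esub> (x \<otimes>\<^bsub>R\<^esub> y)) = (FU F ;;\<^bsub>R'\<^esub> FA F (inverse_of R (LUnit R ?I))) ;;\<^bsub>R'\<^esub> FA F (x \<otimes>\<^bsub>R\<^esub> y)"
        using xy by (simp add: C.delta_Unit FA_comp D.assoc)
      also have "\<dots> = ?l ;;\<^bsub>R'\<^esub> ((FU F \<otimes>\<^bsub>R'\<^esub> FU F) ;;\<^bsub>R'\<^esub> (FM F ?I ?I ;;\<^bsub>R'\<^esub> FA F (x \<otimes>\<^bsub>R\<^esub> y)))"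
        using xy by (simp add: FU_inverse_LUnit D.assoc)
      also have "FM F ?I ?I ;;\<^bsub>R'\<^esub> FA F (x \<otimes>\<^bsub>R\<^esub> y) = (FA F x \<otimes>\<^bsub>R'\<^esub> FA F y) ;;\<^bsub>R'\<^esub> FM F c d"
        by (rule FM_natural[symmetric]) (use xy in simp_all)
      also have "?l ;;\<^bsub>R'\<^esub> ((FU F \<otimes>\<^bsub>R'\<^esub> FU F) ;;\<^bsub>R'\<^esub> ((FA F x \<otimes>\<^bsub>R'\<^esub> FA F y) ;;\<^bsub>R'\<^esub> FM F c d))
        = (D.delta (Unit R') ;;\<^bsub>R'\<^esub> ((FU F ;;\<^bsub>R'\<^esub> FA F x) \<otimes>\<^bsub>R'\<^esub> (FU F ;;\<^bsub>R'\<^esub> FA F y))) ;;\<^bsub>R'\<^esub> FM F c d"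
        using xy ty by (simp add: D.delta_Unit D.exchange_assoc D.assoc)
      finally show "Prd_sharp R R' F (c \<odot>\<^bsub>R\<^esub> d) (PM (Prd_lax R) c d (x, y)) =
          PM (pre_laxfun F (Prd_lax R')) c d (Prd_sharp R R' F c x, Prd_sharp R R' F d y)"
        using ty h by (simp add: pre_laxfun_def)
    qed
    show "preserves_supply R R' F" by (rule preserves_supply)
    show "ext_smfun R F" by fact
  qed simp_all
qed

text \<open>An element is an arrow \<open>x\<close> out of I, so the required inequality is
  oplaxness at \<open>x\<close> preceded by \<open>FU F\<close>; the unit equation of monoidality
  turns the right side into \<open>FU G ;; FA G x\<close>.\<close>

lemma rc_2mor_Prd:
  assumes "prerelational R" "prerelational R'" "ext_smfun R F" "ext_smfun R G" "oplax_adjoint R R' F G \<alpha>"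
  shows "rc_2mor R (Prd_lax R) R' (Prd_lax R') F (Prd_sharp R R' F) G (Prd_sharp R R' G) \<alpha>"
proof -
  interpret oplax_adjoint R R' F G \<alpha> by fact
  interpret S: rc_mor R "Prd_lax R" R' "Prd_lax R'" F "Prd_sharp R R' F"
    by (rule rc_mor_Prd[OF assms(1,2) F.sm_functor_axioms assms(3)])
  interpret T: rc_mor R "Prd_lax R" R' "Prd_lax R'" G "Prd_sharp R R' G"
    by (rule rc_mor_Prd[OF assms(1,2) G.sm_functor_axioms assms(4)])
  have mon: "monoidal_transformation R R' F G \<alpha>"
    by (rule oplax_adjoint_monoidal[OF assms(5,1,2)])
  show ?thesis
  proof
    show "monoidal_transformation R R' F G \<alpha>" by fact
    fix c x assume c: "c \<in> Obj R" and "x \<in> car (PO (Prd_lax R) c)"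
    then have h: "x \<in> hom R (Unit R) c" by simp
    then have x: "x \<in> Arr R" "Dom R x = Unit R" "Cod R x = c" by (auto simp: hom_def)
    have "FU F ;;\<^bsub>R'\<^esub> (FA F x ;;\<^bsub>R'\<^esub> \<alpha> c) \<sqsubseteq>\<^bsub>R'\<^esub> FU F ;;\<^bsub>R'\<^esub> (\<alpha> (Unit R) ;;\<^bsub>R'\<^esub> FA G x)"
      by (rule F.D.Cmp_mono_right[OF oplax[OF x] F.FU_in, of "FO G c"]) (use x c in \<open>simp_all add: hom_def\<close>)
    moreover have "FU F ;;\<^bsub>R'\<^esub> (\<alpha> (Unit R) ;;\<^bsub>R'\<^esub> FA G x) = FU G ;;\<^bsub>R'\<^esub> FA G x"
      by (rule F.D.assoc_eq) (use mon x in \<open>simp_all add: monoidal_transformation_def\<close>)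
    ultimately show "ple (PO (Prd_lax R') (FO G c)) (PA (Prd_lax R') (\<alpha> c) (Prd_sharp R R' F c x)) (Prd_sharp R R' G c x)"
      using c x h by (simp add: F.D.assoc)
  qed
qed

lemma Prd_sharp_id:
  assumes "prerelational R"
  shows "Prd_sharp R R (id_smfun R) = id_sharp R (Prd_lax R)"
proof -
  interpret prerelational R by fact
  show ?thesis
    by (rule sharp_eqI[where A = "Obj R" and B = "\<lambda>c. hom R (Unit R) c"])
      (simp_all add: id_sharp_def, simp add: hom_def)
qed

lemma Prd_sharp_comp:
  assumes "sm_functor R R' F" "sm_functor R' R'' G"
  shows "Prd_sharp R R'' (comp_smfun R R'' F G) = comp_sharp R (Prd_lax R) F (Prd_sharp R R' F) (Prd_sharp R' R'' G)"
proof -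
  interpret F: sm_functor R R' F by fact
  interpret G: sm_functor R' R'' G by fact
  show ?thesis
  proof (rule sharp_eqI[where A = "Obj R" and B = "\<lambda>c. hom R (Unit R) c"])
    fix c x assume c: "c \<in> Obj R" and h: "x \<in> hom R (Unit R) c"
    then have x: "x \<in> Arr R" "Dom R x = Unit R" "Cod R x = c" by (auto simp: hom_def)
    have "FU F ;;\<^bsub>R'\<^esub> FA F x \<in> hom R' (Unit R') (FO F c)" using x by (simp add: hom_def)
    then show "Prd_sharp R R'' (comp_smfun R R'' F G) c x = comp_sharp R (Prd_lax R) F (Prd_sharp R R' F) (Prd_sharp R' R'' G) c x"
      using c h x by (simp add: comp_sharp_def G.FA_comp G.D.assoc)
  qed (simp_all add: comp_sharp_def)
qed

text \<open>Both 2-categories compute 2-cell operations on underlying transformations, so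
  preservation of these is immediate for the identity action \<open>Prd_cell\<close>. The substance
  lies in \<open>regular_calculus_Prd\<close>, \<open>rc_mor_Prd\<close> and
  \<open>rc_2mor_Prd\<close>.\<close>

theorem proposition5p23:
  shows "two_functor
    (PrlPoCat :: (('o, 'a) scat, ('o, 'a, 'o, 'a) smfun, 'o \<Rightarrow> 'a) twocat)
    (RgCalc :: (('o, 'a, 'a) rcalc, ('o, 'a, 'a) rcalc_mor, 'o \<Rightarrow> 'a) twocat)
    Prd_ob Prd_mor Prd_cell"
  by (intro two_functor.intro two_functor_axioms.intro two_category_PrlPoCat two_category_RgCalc)
  (auto simp: Prd_ob_eq Prd_mor_eq Prd_cell_def PrlPoCat_simps PrlPoCat_ops RgCalc_Ob RgCalc_H1 RgCalc_ops
    regular_calculus_Prd Prd_sharp_id Prd_sharp_comp intro: rc_mor_Prd RgCalc_H2I rc_2mor_Prd)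

end
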